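(* Let $q>1$ be real, let $\hat f\in x\mathbb{C}[[x]]$ be a generic $q$-Gevrey series, and let $\lambda\in\mathbb{C}^*$, $d\in[-\pi,\pi)$. Assume that the spiral $\lambda q^{\mathbb{Z}}$ is not a singular direction of $\hat f$ and that no point of the half line $(0,e^{id}\infty)$ lies on a singular direction of $\hat f$. Then: 1. $S_q^{[\lambda]}\hat f=\mathcal{S}_q^{[\lambda]}\hat f$ on a suitable domain $\Omega$; 2. $S_q^{d}\hat f=\mathcal{S}_q^{d}\hat f$ on a suitable sector with vertex $0$ containing the direction $d$. Moreover, $$\mathcal{S}_q^d\hat f=\frac1{\ln q}\int_{e^{id}}^{qe^{id}}\mathcal{S}_q^{[\lambda]}\hat f\,\frac{d\lambda}{\lambda}.$$
   Context: Let $p=q^{-1}\in(0,1)$, $\sigma_qf(x)=f(qx)$. A generic $q$-Gevrey series is a power series $\hat f$ with $\Delta\hat f\in\mathbb{C}\{x\}$ for some operator $\Delta=a_0(x)(x\sigma_q)^n+a_1(x)(x\sigma_q)^{n-1}+\dots+a_n(x)$ with $a_j\in\mathbb{C}\{x\}$ and $a_0(0)a_n(0)\ne0$. $[n]_q=\frac{q^n-1}{q-1}$, $[n]_q^!=[n]_q\cdots[1]_q$, $[0]_q^!=1$. $e_q(x)=\sum_{n\ge0}\frac{x^n}{[n]_q^!}=\prod_{k\ge0}(1+(1-p)p^kx)$ and $\theta_p(x)=\sum_{n\in\mathbb{Z}}p^{n(n-1)/2}x^n$. The two formal $q$-Borel transforms $x\mathbb{C}[[x]]\to\mathbb{C}[[\xi]]$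 are $\mathcal{B}_q\left(\sum a_nx^{n+1}\right)=\sum\frac{a_n}{[n]_q^!}\xi^n$ and $B_q\left(\sum a_nx^{n+1}\right)=\sum\frac{a_n}{q^{n(n-1)/2}}\xi^n$. A function has $q$-exponential growth of order $1$ at infinity if there are $K,\mu>0$ with $|\phi(x)|<K|x|^{\mu}e_q(|x|)$ as $|x|\to\infty$ (in its domain). For $\lambda\in\mathbb{C}^*$, $[\lambda;q]=\lambda q^{\mathbb{Z}}$, and $\mathbb{H}^{[\lambda;q]}$ is the set of germs $\phi$ analytic at $0$ for which there exist a domain $\Omega'\subset\mathbb{C}$ and $r>0$ such that $\bigcup_{m\in\mathbb{Z}}\{|x-\lambda q^m|<rq^m\}\subset\Omega'$ and $\phi$ continues to an analytic function on $\Omega'$ with $q$-exponential growth of order $1$ at infinity. $\mathbb{H}_q^d=\bigcap_{\lambda\in(0,\infty e^{id})}\mathbb{H}^{[\lambda;q]}$. The spiral $[\lambda;q]$ is called a singular direction of $\hat f$ if $B_q\hat f\notin\mathbb{H}^{[\lambda;q]}$ (equivalently $\mathcal{B}_q\hat f\notin\mathbb{H}^{[\lambda/(1-p);q]}$). The discrete (Jackson) integral is $\int_{\lambda p^{\mathbb{Z}}}f(\xi)\,d_p\xi=(1-p)\lambda\sum_{n\in\mathbb{Z}}f(p^n\lambda)p^n$. When $[\lambda;q]$ is not singular, with $\psi=\mathcal{B}_q\hat f$ and $\phi=B_q\hat f$, $$\mathcal{S}_q^{[\lambda]}\hat f(x)=\frac{q}{1-p}\int_{\lambda p^{\mathbb{Z}}}\frac{\psi(\xi/(1-p))}{e_q\left(\frac{q\xi}{(1-p)x}\right)}\,d_p\xi,\qquad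 S_q^{[\lambda]}\hat f(x)=\frac{q}{1-p}\int_{\lambda p^{\mathbb{Z}}}\frac{\phi(\xi)}{\theta_p(q\xi/x)}\,d_p\xi .$$ When no spiral meeting $(0,e^{id}\infty)$ is singular, $$\mathcal{S}_q^{d}\hat f(x)=\frac{q-1}{\ln q}\int_0^{e^{id}\infty}\frac{\psi(\xi)}{e_q(q\xi/x)}\,d\xi,\qquad S_q^{d}\hat f(x)=\frac{q}{\ln q}\int_0^{e^{id}\infty}\frac{\phi(\xi)}{\theta_p(q\xi/x)}\,d\xi .$$ *)

theory Defs
  imports "HOL-Complex_Analysis.Complex_Analysis"
begin

section \<open>Generic \<open>q\<close>-Gevrey series\<close>

definition fps_sigma_q :: "real \<Rightarrow> complex fps \<Rightarrow> complex fps" where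
  "fps_sigma_q q f = f oo (fps_const (of_real q) * fps_X)"

text \<open>The operator \<open>a 0 (x \<sigma>)^n + a 1 (x \<sigma>)^(n-1) + \<dots> + a n\<close>, where \<open>\<sigma> f (x) = f (q x)\<close>.\<close>

definition q_diff_op :: "real \<Rightarrow> nat \<Rightarrow> (nat \<Rightarrow> complex fps) \<Rightarrow> complex fps \<Rightarrow> complex fps" where
  "q_diff_op q n a f = (\<Sum>j\<le>n. a j * ((\<lambda>g. fps_X * fps_sigma_q q g) ^^ (n - j)) f)"

definition generic_q_gevrey :: "real \<Rightarrow> complex fps \<Rightarrow> bool" where
  "generic_q_gevrey q f \<longleftrightarrow>
     (\<exists>n a. (\<forall>j\<le>n. fps_conv_radius (a j) > 0) \<and>
            fps_nth (a 0) 0 * fps_nth (a n) 0 \<noteq> 0 \<and>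
            fps_conv_radius (q_diff_op q n a f) > 0)"

section \<open>The \<open>q\<close>-exponential and the theta function\<close>

definition q_number :: "real \<Rightarrow> nat \<Rightarrow> real" where
  "q_number q n = (q ^ n - 1) / (q - 1)"

definition q_fact :: "real \<Rightarrow> nat \<Rightarrow> real" where
  "q_fact q n = (\<Prod>k=1..n. q_number q k)"

definition q_exp :: "real \<Rightarrow> 'a::{real_normed_field,banach} \<Rightarrow> 'a" where
  "q_exp q x = (\<Sum>n. x ^ n / of_real (q_fact q n))"

definition theta :: "real \<Rightarrow> complex \<Rightarrow> complex" where
  "theta p x = (\<Sum>\<^sub>\<infinity>n::int. of_real (p powi (n * (n - 1) div 2)) * x powi n)"

section \<open>The two formal \<open>q\<close>-Borel transforms\<close>

text \<open>Both act on series without constant term: the coefficient of \<open>x^(n+1)\<close> is sent to that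
  of \<open>\<xi>^n\<close>.\<close>

definition borel_e :: "real \<Rightarrow> complex fps \<Rightarrow> complex fps" where
  "borel_e q f = Abs_fps (\<lambda>n. fps_nth f (Suc n) / of_real (q_fact q n))"

definition borel_theta :: "real \<Rightarrow> complex fps \<Rightarrow> complex fps" where
  "borel_theta q f = Abs_fps (\<lambda>n. fps_nth f (Suc n) / of_real (q ^ (n * (n - 1) div 2)))"

section \<open>Continuation along a \<open>q\<close>-spiral and singular directions\<close>

definition q_spiral :: "real \<Rightarrow> complex \<Rightarrow> complex set" where
  "q_spiral q l = range (\<lambda>m::int. l * of_real (q powi m))"

text \<open>The domain \<open>\<Omega>\<close> need not contain \<open>0\<close>, but \<open>0\<close> lies in its closure; \<open>g\<close> continues the germ
  with Taylor series \<open>\<phi>\<close> if it coincides with it on the part of \<open>\<Omega>\<close> that is close to \<open>0\<close>.\<close>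

definition spiral_continuation ::
    "real \<Rightarrow> complex \<Rightarrow> complex fps \<Rightarrow> complex set \<Rightarrow> (complex \<Rightarrow> complex) \<Rightarrow> bool" where
  "spiral_continuation q l \<phi> \<Omega> g \<longleftrightarrow>
     open \<Omega> \<and> connected \<Omega> \<and>
     (\<exists>r>0. (\<Union>m::int. ball (l * of_real (q powi m)) (r * q powi m)) \<subseteq> \<Omega>) \<and>
     g holomorphic_on \<Omega> \<and>
     (\<forall>\<^sub>F x in at 0 within \<Omega>. g x = eval_fps \<phi> x)"

definition q_exp_growth :: "real \<Rightarrow> complex set \<Rightarrow> (complex \<Rightarrow> complex) \<Rightarrow> bool" where
  "q_exp_growth q \<Omega> g \<longleftrightarrow>
     (\<exists>K>0. \<exists>\<mu>>0. \<exists>R. \<forall>x\<in>\<Omega>. cmod x > R \<longrightarrow>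
        cmod (g x) < K * cmod x powr \<mu> * q_exp q (cmod x))"

definition H_spiral :: "real \<Rightarrow> complex \<Rightarrow> complex fps set" where
  "H_spiral q l =
     {\<phi>. fps_conv_radius \<phi> > 0 \<and> (\<exists>\<Omega> g. spiral_continuation q l \<phi> \<Omega> g \<and> q_exp_growth q \<Omega> g)}"

definition singular_direction :: "real \<Rightarrow> complex fps \<Rightarrow> complex \<Rightarrow> bool" where
  "singular_direction q f l \<longleftrightarrow> borel_theta q f \<notin> H_spiral q l"

text \<open>The value at \<open>\<xi>\<close> of the continuation of \<open>\<phi>\<close> along the spiral through \<open>\<xi>\<close>. The Borel transforms
  of a generic \<open>q\<close>-Gevrey series extend meromorphically to the plane, so for them this value does
  not depend on the choice of \<open>\<Omega>\<close>.\<close>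

definition continued_value :: "real \<Rightarrow> complex fps \<Rightarrow> complex \<Rightarrow> complex" where
  "continued_value q \<phi> \<xi> = (THE w. \<exists>\<Omega> g. spiral_continuation q \<xi> \<phi> \<Omega> g \<and> w = g \<xi>)"

section \<open>Jackson integrals and integrals along a half line\<close>

definition jackson_integrable :: "real \<Rightarrow> complex \<Rightarrow> (complex \<Rightarrow> complex) \<Rightarrow> bool" where
  "jackson_integrable p l F \<longleftrightarrow>
     (\<lambda>n::int. F (of_real (p powi n) * l) * of_real (p powi n)) summable_on UNIV"

definition jackson_integral :: "real \<Rightarrow> complex \<Rightarrow> (complex \<Rightarrow> complex) \<Rightarrow> complex" where
  "jackson_integral p l F =
     of_real (1 - p) * l * (\<Sum>\<^sub>\<infinity>n::int. F (of_real (p powi n) * l) * of_real (p powi n))"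

definition half_line :: "real \<Rightarrow> complex set" where
  "half_line d = {of_real t * cis d | t. t > 0}"

definition half_line_integrable :: "real \<Rightarrow> (complex \<Rightarrow> complex) \<Rightarrow> bool" where
  "half_line_integrable d F \<longleftrightarrow>
     set_integrable lborel {0<..} (\<lambda>t. F (of_real t * cis d) * cis d)"

definition half_line_integral :: "real \<Rightarrow> (complex \<Rightarrow> complex) \<Rightarrow> complex" where
  "half_line_integral d F =
     set_lebesgue_integral lborel {0<..} (\<lambda>t. F (of_real t * cis d) * cis d)"

section \<open>The four \<open>q\<close>-Borel-Laplace sums\<close>

definition integrand_e :: "real \<Rightarrow> complex fps \<Rightarrow> complex \<Rightarrow> complex \<Rightarrow> complex" where
  "integrand_e q f x \<xi> = continued_value q (borel_e q f) \<xi> / q_exp q (of_real q * \<xi> / x)"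

definition integrand_theta :: "real \<Rightarrow> complex fps \<Rightarrow> complex \<Rightarrow> complex \<Rightarrow> complex" where
  "integrand_theta q f x \<xi> =
     continued_value q (borel_theta q f) \<xi> / theta (1 / q) (of_real q * \<xi> / x)"

definition spiral_integrand_e :: "real \<Rightarrow> complex fps \<Rightarrow> complex \<Rightarrow> complex \<Rightarrow> complex" where
  "spiral_integrand_e q f x \<xi> = integrand_e q f x (\<xi> / of_real (1 - 1 / q))"

definition spiral_sum_e :: "real \<Rightarrow> complex \<Rightarrow> complex fps \<Rightarrow> complex \<Rightarrow> complex" where
  "spiral_sum_e q l f x =
     of_real (q / (1 - 1 / q)) * jackson_integral (1 / q) l (spiral_integrand_e q f x)"

definition spiral_sum_theta :: "real \<Rightarrow> complex \<Rightarrow> complex fps \<Rightarrow> complex \<Rightarrow> complex" where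
  "spiral_sum_theta q l f x =
     of_real (q / (1 - 1 / q)) * jackson_integral (1 / q) l (integrand_theta q f x)"

definition direction_sum_e :: "real \<Rightarrow> real \<Rightarrow> complex fps \<Rightarrow> complex \<Rightarrow> complex" where
  "direction_sum_e q d f x = of_real ((q - 1) / ln q) * half_line_integral d (integrand_e q f x)"

definition direction_sum_theta :: "real \<Rightarrow> real \<Rightarrow> complex fps \<Rightarrow> complex \<Rightarrow> complex" where
  "direction_sum_theta q d f x = of_real (q / ln q) * half_line_integral d (integrand_theta q f x)"

section \<open>Domains of the sums\<close>

text \<open>For \<open>\<xi>\<close> in \<open>q_spiral q l\<close>, the denominators of the spiral sums vanish only for \<open>x\<close> in
  \<open>q_spiral q (-l)\<close>; for \<open>\<xi>\<close> on the half line of argument \<open>d\<close>, only for \<open>x\<close> on the opposite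
  half line.\<close>

definition spiral_domain :: "real \<Rightarrow> complex \<Rightarrow> real \<Rightarrow> complex set" where
  "spiral_domain q l \<rho> = {x. 0 < cmod x \<and> cmod x < \<rho>} - q_spiral q (- l)"

definition slit_sector :: "real \<Rightarrow> real \<Rightarrow> complex set" where
  "slit_sector d \<rho> = {x. cmod x < \<rho> \<and> x / cis d \<notin> \<real>\<^sub>\<le>\<^sub>0}"

end

theory Submission
  imports Defs
begin

text \<open>Put \<open>p = 1 / q\<close>, \<open>E z = e\<^sub>q (z / (1 - p))\<close> and \<open>\<kappa> = E (- p)\<close>, the product of all
  \<open>1 - p^k\<close> with \<open>k \<ge> 1\<close>. Euler's identities turn the quotient of the coefficients of the two Borel
  transforms, which is a multiple of \<open>1 / ((1 - p) \<dots> (1 - p^n))\<close>, into a relation between the functions: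
  \<open>\<phi> \<xi> = \<kappa> (\<Sum>k. p^k / ((1 - p) \<dots> (1 - p^k)) \<psi> (p^k \<xi> / (1 - p)))\<close>. Substitute this into the theta sum
  over a spiral and collect the terms that contain \<open>\<psi>\<close> at a given point: by the quasi-periodicity of theta,
  the factor of this value is an Euler series that sums to \<open>\<kappa> E (p / z) / theta z\<close>, and this is \<open>1 / E z\<close>
  by the triple product.
  The \<open>q\<close>-difference equation becomes a functional equation for \<open>\<phi>\<close>, which gives the continuation of \<open>\<phi>\<close>
  to the plane without a countable closed set; hence the continued values are well defined. A half line is the
  disjoint union of the scaled intervals \<open>p^n [1, q)\<close>, so that an integral over it is the integral over
  \<open>[1, q]\<close> of sums over spirals, to which the first statement applies.\<close>

section \<open>Euler's identities and the triple product\<close>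

text \<open>The obstacle is absolute convergence. Continued values of \<phi> may grow like a
  q-exponential, so the interchange of sums needs lower bounds for theta and \<open>E\<close> along
  whole spirals, away from their zeros. They come from comparing \<open>norm (qT z)\<close> with
  \<open>qT (norm z)\<close>: the quotient is constant along a spiral, and \<open>qT\<close> is
  positive at positive reals. Growth is then \<open>E\<close> against \<open>E\<close>: the argument
  in the denominator is larger by a factor proportional to \<open>1 / norm x\<close>, and once this
  factor exceeds a threshold every step along the spiral gains a fixed factor. This is the origin of
  the radii.

  The second transform is not continued by an equation of its own. Inverting Euler's relation
  expresses \<psi> as a series of values of \<phi> at the points \<open>p^k * \<xi>\<close>, which
  transports both the domain and the growth.

  A continued value refers to domains of any shape. Uniqueness is therefore reduced to one reference
  function on the complement of a countable closed set, whose removal leaves every open connected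
  set connected.\<close>

definition qpoch :: "real \<Rightarrow> nat \<Rightarrow> real" where
  "qpoch p n = (\<Prod>k=1..n. 1 - p ^ k)"

definition qcoeff :: "real \<Rightarrow> nat \<Rightarrow> real" where
  "qcoeff p n = p ^ (n * (n - 1) div 2) / qpoch p n"

text \<open>This is the product of all \<open>1 + p^k * z\<close> with \<open>k \<ge> 0\<close>,
  given by its power series. It is polymorphic because the estimates compare its values at complex
  points with those at their norms.\<close>

definition qE :: "real \<Rightarrow> 'a::{real_normed_field,banach} \<Rightarrow> 'a" where
  "qE p z = (\<Sum>n. of_real (qcoeff p n) * z ^ n)"

lemma tri_Suc: "Suc n * (Suc n - 1) div 2 = n * (n - 1) div 2 + n"
proof (cases n)
  case (Suc m)
  have "Suc n * (Suc n - 1) = n * (n - 1) + n * 2" by (simp add: Suc)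
  then show ?thesis by simp
qed simp

lemma qpoch_0 [simp]: "qpoch p 0 = 1"
  by (simp add: qpoch_def)

lemma qcoeff_0 [simp]: "qcoeff p 0 = 1"
  by (simp add: qcoeff_def)

lemma qpoch_Suc: "qpoch p (Suc n) = qpoch p n * (1 - p ^ Suc n)"
  by (simp add: qpoch_def)

locale q_base =
  fixes p :: real
  assumes p_pos: "0 < p" and p_less_1: "p < 1"
begin

lemma pow_Suc_less_1: "p ^ Suc n < 1"
  using p_pos p_less_1 by (simp add: power_Suc_less_one del: power_Suc)

lemma qpoch_pos: "qpoch p n > 0"
proof (induction n)
  case (Suc n)
  then show ?case using pow_Suc_less_1[of n] by (simp add: qpoch_Suc del: power_Suc)
qed simp

lemma qpoch_le_1: "qpoch p n \<le> 1"
proof (induction n)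
  case (Suc n)
  have "qpoch p n * (1 - p ^ Suc n) \<le> qpoch p n * 1"
    using qpoch_pos[of n] p_pos by (intro mult_left_mono) auto
  with Suc show ?case unfolding qpoch_Suc by linarith
qed simp

lemma qcoeff_pos: "qcoeff p n > 0"
  using p_pos qpoch_pos by (simp add: qcoeff_def)

lemma qcoeff_Suc: "qcoeff p (Suc n) * (1 - p ^ Suc n) = p ^ n * qcoeff p n"
  using pow_Suc_less_1[of n] qpoch_pos[of n]
  unfolding qcoeff_def tri_Suc qpoch_Suc power_add by (simp add: field_simps del: power_Suc)

lemma summable_qcoeff: "summable (\<lambda>n. qcoeff p n * y ^ n)" if "y \<ge> 0" for y :: real
proof -
  have "(\<lambda>n. y * p ^ n / (1 - p ^ Suc n)) \<longlonglongrightarrow> y * 0 / (1 - 0)"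
    using p_pos p_less_1 by (intro tendsto_intros LIMSEQ_power_zero LIMSEQ_Suc) auto
  then have "\<forall>\<^sub>F n in sequentially. y * p ^ n / (1 - p ^ Suc n) < 1 / 2"
    by (rule order_tendstoD) simp
  then obtain N where N: "\<And>n. n \<ge> N \<Longrightarrow> y * p ^ n / (1 - p ^ Suc n) < 1 / 2"
    by (auto simp: eventually_sequentially)
  show ?thesis
  proof (rule summable_ratio_test)
    show "norm (qcoeff p (Suc n) * y ^ Suc n) \<le> 1 / 2 * norm (qcoeff p n * y ^ n)" if "n \<ge> N" for n
    proof -
      have e: "qcoeff p (Suc n) = p ^ n * qcoeff p n / (1 - p ^ Suc n)"
        using qcoeff_Suc[of n] pow_Suc_less_1[of n] by (simp add: eq_divide_eq del: power_Suc)
      have "qcoeff p (Suc n) * y ^ Suc n = y * p ^ n / (1 - p ^ Suc n) * (qcoeff p n * y ^ n)"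
        unfolding e by simp
      also have "\<dots> \<le> 1 / 2 * (qcoeff p n * y ^ n)"
        using N[OF that] qcoeff_pos[of n] \<open>y \<ge> 0\<close> by (intro mult_right_mono) auto
      finally show ?thesis
        using qcoeff_pos[of n] qcoeff_pos[of "Suc n"] \<open>y \<ge> 0\<close>
        by (simp add: abs_mult power_abs)
    qed
  qed simp
qed

lemma summable_norm_qE:
  fixes z :: "'a::{real_normed_field,banach}"
  shows "summable (\<lambda>n. norm (of_real (qcoeff p n) * z ^ n))"
proof -
  have "norm (of_real (qcoeff p n) * z ^ n) = qcoeff p n * norm z ^ n" for n
    using qcoeff_pos[of n] by (simp add: norm_mult norm_power)
  then show ?thesis using summable_qcoeff[of "norm z"] by simp
qed

lemma qE_sums:
  fixes z :: "'a::{real_normed_field,banach}"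
  shows "(\<lambda>n. of_real (qcoeff p n) * z ^ n) sums qE p z"
  unfolding qE_def by (rule summable_sums[OF summable_norm_cancel[OF summable_norm_qE]])

lemma qE_0 [simp]: "qE p 0 = 1"
  using powser_zero[of "\<lambda>n. of_real (qcoeff p n)"] by (simp add: qE_def)

text \<open>The recursion \<open>(1 - p^(n+1)) * c (n+1) = p^n * c n\<close> of the coefficients
  says \<open>E z - E (p z) = z * E (p z)\<close>. Zeros, finite product expansions and growth of
  \<open>E\<close> are all drawn from this equation; no infinite product is formed.\<close>

lemma qE_rec:
  fixes z :: "'a::{real_normed_field,banach}"
  shows "qE p z = (1 + z) * qE p (of_real p * z)"
proof -
  have "(\<lambda>n. of_real (qcoeff p n) * z ^ n - of_real (qcoeff p n) * (of_real p * z) ^ n) sums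
        (qE p z - qE p (of_real p * z))"
    by (intro sums_diff qE_sums)
  also have "(\<lambda>n. of_real (qcoeff p n) * z ^ n - of_real (qcoeff p n) * (of_real p * z) ^ n) =
     (\<lambda>n. of_real (qcoeff p n * (1 - p ^ n)) * z ^ n)"
    by (simp add: power_mult_distrib algebra_simps del: of_real_divide)
  finally have "(\<lambda>n. of_real (qcoeff p (Suc n) * (1 - p ^ Suc n)) * z ^ Suc n) sums
        (qE p z - qE p (of_real p * z))"
    by (subst sums_Suc_iff) simp
  then have "(\<lambda>n. z * (of_real (qcoeff p n) * (of_real p * z) ^ n)) sums
        (qE p z - qE p (of_real p * z))"
    unfolding qcoeff_Suc by (simp add: power_mult_distrib mult_ac)
  moreover have "(\<lambda>n. z * (of_real (qcoeff p n) * (of_real p * z) ^ n)) sums (z * qE p (of_real p * z))"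
    by (intro sums_mult qE_sums)
  ultimately have "qE p z - qE p (of_real p * z) = z * qE p (of_real p * z)"
    by (rule sums_unique2)
  then show ?thesis by (simp add: algebra_simps)
qed

lemma continuous_on_qE [continuous_intros]:
  fixes f :: "'b::t2_space \<Rightarrow> 'a::{real_normed_field,banach}"
  assumes "continuous_on S f"
  shows "continuous_on S (\<lambda>x. qE p (f x))"
proof -
  have "continuous_on UNIV (qE p :: 'a \<Rightarrow> 'a)"
    unfolding qE_def
    by (intro continuous_at_imp_continuous_on ballI isCont_powser_converges_everywhere)
       (rule summable_norm_cancel[OF summable_norm_qE])
  from continuous_on_compose2[OF this assms] show ?thesis by simp
qed

lemma qE_of_real: "qE p (of_real y :: 'a::{real_normed_field,banach}) = of_real (qE p y)"
proof -
  have "(\<lambda>n. of_real (of_real (qcoeff p n) * y ^ n) :: 'a) sums of_real (qE p y)"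
    by (intro sums_of_real qE_sums)
  moreover have "(\<lambda>n. of_real (qcoeff p n) * (of_real y :: 'a) ^ n) sums qE p (of_real y)"
    by (rule qE_sums)
  ultimately show ?thesis
    by (simp add: sums_unique2)
qed

lemma norm_qE_le: "norm (qE p z) \<le> qE p (norm z)"
  for z :: "'a::{real_normed_field,banach}"
proof -
  have "(\<lambda>n. norm (of_real (qcoeff p n) * z ^ n)) = (\<lambda>n. of_real (qcoeff p n) * norm z ^ n)"
    using qcoeff_pos by (simp only: norm_mult norm_of_real norm_power abs_of_pos of_real_eq_id id_apply)
  then have "(\<lambda>n. norm (of_real (qcoeff p n) * z ^ n)) sums qE p (norm z)"
    using qE_sums[of "norm z"] by simp
  then show ?thesis
    unfolding qE_def[of _ z] using summable_norm[OF summable_norm_qE[of z]] by (simp add: sums_iff)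
qed

lemma qE_mono: "0 \<le> x \<Longrightarrow> x \<le> y \<Longrightarrow> qE p x \<le> qE p (y::real)"
  by (rule sums_le[OF _ qE_sums qE_sums])
     (use qcoeff_pos in \<open>auto intro!: mult_left_mono power_mono simp: less_imp_le\<close>)

lemma qE_ge_1: "0 \<le> x \<Longrightarrow> qE p x \<ge> (1::real)"
  using qE_mono[of 0 x] by simp

text \<open>Euler's other series, the reciprocal of the product of all \<open>1 - p^k * w\<close>;
  it is used in the unit disc.\<close>

definition qA :: "complex \<Rightarrow> complex" where
  "qA w = (\<Sum>n. of_real (1 / qpoch p n) * w ^ n)"

lemma summable_qA_real:
  fixes y :: real
  assumes "0 \<le> y" "y < 1"
  shows "summable (\<lambda>n. 1 / qpoch p n * y ^ n)"
proof -
  have "(\<lambda>n. y / (1 - p ^ Suc n)) \<longlonglongrightarrow> y / (1 - 0)"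
    using p_pos p_less_1 by (intro tendsto_intros LIMSEQ_power_zero LIMSEQ_Suc) auto
  moreover obtain c where c: "y < c" "c < 1" using dense[OF assms(2)] by blast
  ultimately have "\<forall>\<^sub>F n in sequentially. y / (1 - p ^ Suc n) < c"
    by (intro order_tendstoD(2)[of _ "y / (1 - 0)"]) auto
  then obtain N where N: "\<And>n. n \<ge> N \<Longrightarrow> y / (1 - p ^ Suc n) < c"
    by (auto simp: eventually_sequentially)
  show ?thesis
  proof (rule summable_ratio_test[OF c(2)])
    show "norm (1 / qpoch p (Suc n) * y ^ Suc n) \<le> c * norm (1 / qpoch p n * y ^ n)" if "n \<ge> N" for n
    proof -
      have "1 / qpoch p (Suc n) * y ^ Suc n = y / (1 - p ^ Suc n) * (1 / qpoch p n * y ^ n)"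
        by (simp add: qpoch_Suc)
      also have "\<dots> \<le> c * (1 / qpoch p n * y ^ n)"
        using N[OF that] qpoch_pos[of n] assms by (intro mult_right_mono) auto
      finally show ?thesis
        using qpoch_pos[of n] qpoch_pos[of "Suc n"] assms
        by (simp add: abs_mult power_abs)
    qed
  qed
qed

lemma summable_norm_qA: "summable (\<lambda>n. norm (of_real (1 / qpoch p n) * w ^ n))"
  if "norm w < 1" for w :: complex
proof -
  have "norm (of_real (1 / qpoch p n) * w ^ n) = 1 / qpoch p n * norm w ^ n" for n
    using qpoch_pos[of n] by (simp only: norm_mult norm_of_real norm_power) simp
  then show ?thesis using summable_qA_real[of "norm w"] that by simp
qed

text \<open>Write \<open>S F\<close> for the dilation \<open>F (p x)\<close>, which is
  multiplicative. The first generating series satisfies \<open>S FA = (1 - x) FA\<close>, the second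
  \<open>FB = (1 - x) S FB\<close>, so their product is invariant under \<open>S\<close>; as
  \<open>p^n < 1\<close> for \<open>n > 0\<close>, it is constant. The same finite identity later
  inverts the relation between the two Borel transforms.\<close>

lemma euler_convolution:
  "(\<Sum>i\<le>n. 1 / qpoch p i * ((-1) ^ (n - i) * qcoeff p (n - i))) = (if n = 0 then 1 else 0)"
proof -
  define FA where "FA = Abs_fps (\<lambda>k. 1 / qpoch p k)"
  define FB where "FB = Abs_fps (\<lambda>k. (-1) ^ k * qcoeff p k)"
  define S where "S = (\<lambda>F. Abs_fps (\<lambda>k. p ^ k * fps_nth F k))"
  have S_mult: "S (F * G) = S F * S G" for F G
  proof (rule fps_ext)
    fix n
    have "p ^ n * (fps_nth F i * fps_nth G (n - i)) = p ^ i * fps_nth F i * (p ^ (n - i) * fps_nth G (n - i))"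
      if "i \<in> {0..n}" for i
    proof -
      have "p ^ n = p ^ i * p ^ (n - i)" using that by (simp flip: power_add)
      then show ?thesis by simp
    qed
    then show "fps_nth (S (F * G)) n = fps_nth (S F * S G) n"
      unfolding S_def fps_nth_Abs_fps fps_mult_nth sum_distrib_left by (intro sum.cong) auto
  qed
  have SA: "S FA = (1 - fps_X) * FA"
  proof (rule fps_ext)
    fix n
    show "fps_nth (S FA) n = fps_nth ((1 - fps_X) * FA) n"
    proof (cases n)
      case (Suc m)
      have "1 / qpoch p (Suc m) * (1 - p ^ Suc m) = 1 / qpoch p m"
        using pow_Suc_less_1[of m] unfolding qpoch_Suc by simp
      then show ?thesis
        by (simp add: Suc S_def FA_def left_diff_distrib right_diff_distrib del: power_Suc)
    qed (simp add: S_def FA_def)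
  qed
  have SB: "FB = (1 - fps_X) * S FB"
  proof (rule fps_ext)
    fix n
    show "fps_nth FB n = fps_nth ((1 - fps_X) * S FB) n"
    proof (cases n)
      case (Suc m)
      have "(-1) ^ Suc m * (qcoeff p (Suc m) * (1 - p ^ Suc m)) = - ((-1) ^ m * (p ^ m * qcoeff p m))"
        unfolding qcoeff_Suc by simp
      moreover have "fps_nth FB (Suc m) - p ^ Suc m * fps_nth FB (Suc m)
          = (-1) ^ Suc m * (qcoeff p (Suc m) * (1 - p ^ Suc m))"
        unfolding FB_def fps_nth_Abs_fps by algebra
      moreover have "p ^ m * fps_nth FB m = (-1) ^ m * (p ^ m * qcoeff p m)"
        unfolding FB_def fps_nth_Abs_fps by algebra
      ultimately show ?thesis
        unfolding Suc S_def by (simp only: left_diff_distrib fps_sub_nth fps_nth_Abs_fps fps_X_mult_nth mult_1_left diff_Suc_1) (simp del: power_Suc)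
    qed (simp add: S_def FB_def)
  qed
  have "S (FA * FB) = FA * ((1 - fps_X) * S FB)"
    unfolding S_mult SA by (simp only: mult_ac)
  then have D: "S (FA * FB) = FA * FB"
    using SB by simp
  have "fps_nth (FA * FB) n = (if n = 0 then 1 else 0)"
  proof (cases n)
    case (Suc m)
    have "p ^ n * fps_nth (FA * FB) n = fps_nth (FA * FB) n"
      using arg_cong[OF D, of "\<lambda>F. fps_nth F n"] by (simp add: S_def)
    then show ?thesis using pow_Suc_less_1[of m] Suc by auto
  qed (simp add: FA_def FB_def)
  then show ?thesis
    by (simp add: FA_def FB_def fps_mult_nth atLeast0AtMost)
qed

lemma qA_mult_qE: "qA w * qE p (- w) = 1" if "norm w < 1"
proof -
  let ?a = "\<lambda>n. of_real (1 / qpoch p n) * w ^ n" and ?b = "\<lambda>n. of_real (qcoeff p n) * (- w) ^ n"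
  have "(\<lambda>n. \<Sum>i\<le>n. ?a i * ?b (n - i)) sums (qA w * qE p (- w))"
    using Cauchy_product_sums[OF summable_norm_qA[OF that] summable_norm_qE[of "- w"]]
    by (simp add: qA_def qE_def)
  moreover have "(\<Sum>i\<le>n. ?a i * ?b (n - i)) = (if n = 0 then 1 else 0)" for n
  proof -
    have "?a i * ?b (n - i) = of_real (1 / qpoch p i * ((-1) ^ (n - i) * qcoeff p (n - i))) * w ^ n"
      if "i \<le> n" for i
    proof -
      have "w ^ n = w ^ i * w ^ (n - i)" using that by (simp flip: power_add)
      moreover have "(- w) ^ (n - i) = (-1) ^ (n - i) * w ^ (n - i)"
        by (rule power_minus)
      ultimately show ?thesis by (simp add: mult_ac)
    qed
    then have "(\<Sum>i\<le>n. ?a i * ?b (n - i))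
      = of_real (\<Sum>i\<le>n. 1 / qpoch p i * ((-1) ^ (n - i) * qcoeff p (n - i))) * w ^ n"
      unfolding of_real_sum sum_distrib_right by (intro sum.cong) auto
    then show ?thesis unfolding euler_convolution by simp
  qed
  moreover have "(\<lambda>n. if n = 0 then 1 else 0) sums (1::complex)"
    using sums_single[of 0 "\<lambda>_. 1::complex"] by simp
  ultimately show ?thesis
    by (simp add: sums_unique2)
qed

definition \<kappa> :: real where "\<kappa> = qE p (- p)"

text \<open>Each use of the recursion strips one factor, so that \<open>E (- p^(n+1))\<close> is the
  product of the \<open>1 - p^k\<close> with \<open>k > n\<close>. This exhibits
  \<open>1 / qpoch p n\<close> as the value of an everywhere convergent series, which is what
  connects the two transforms.\<close>

lemma qE_minus_pow_Suc: "qE p (- (p ^ Suc n)) = \<kappa> / qpoch p n"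
proof (induction n)
  case (Suc n)
  have "qE p (- (p ^ Suc n)) = (1 - p ^ Suc n) * qE p (- (p ^ Suc (Suc n)))"
    using qE_rec[of "- (p ^ Suc n)"] by simp
  then have "\<kappa> = qpoch p n * (1 - p ^ Suc n) * qE p (- (p ^ Suc (Suc n)))"
    using Suc qpoch_pos[of n] by (simp add: divide_eq_eq mult_ac)
  then show ?case
    using qpoch_pos[of "Suc n"] unfolding qpoch_Suc[symmetric] by (simp add: eq_divide_eq mult.commute del: power_Suc)
qed (simp add: \<kappa>_def)

lemma \<kappa>_nonzero: "\<kappa> \<noteq> 0"
  using qA_mult_qE[of "of_real p"] p_pos p_less_1 qE_of_real[of "- p", where 'a = complex]
  by (auto simp: \<kappa>_def)

lemma qE_minus_inverse_pow: "qE p (- (1 / p ^ n)) = (0::real)"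
proof (induction n)
  case 0
  then show ?case using qE_rec[of "- 1 :: real"] by simp
next
  case (Suc n)
  then show ?case using qE_rec[of "- (1 / p ^ Suc n)"] p_pos by simp
qed

end

section \<open>Sums over the integers and interchange of summations\<close>

lemma summable_on_int:
  fixes f :: "int \<Rightarrow> 'a::banach"
  assumes "summable (\<lambda>n. norm (f (int n)))" "summable (\<lambda>n. norm (f (- int n)))"
  shows "f abs_summable_on UNIV"
proof -
  have "(\<lambda>n. norm (f n)) summable_on range int"
    using assms(1) by (subst summable_on_reindex) (auto simp: o_def summable_on_UNIV_nonneg_real_iff)
  moreover have "(\<lambda>n. norm (f n)) summable_on range (\<lambda>n. - int n)"
    using assms(2) by (subst summable_on_reindex)
      (auto simp: o_def summable_on_UNIV_nonneg_real_iff inj_on_def)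
  \<comment> \<open>The index 0 lies in both halves; it is removed from the second one to make the
    union disjoint.\<close>
  then have "(\<lambda>n. norm (f n)) summable_on (range (\<lambda>n. - int n) - range int)"
    by (rule summable_on_subset_banach) auto
  ultimately have "(\<lambda>n. norm (f n)) summable_on (range int \<union> (range (\<lambda>n. - int n) - range int))"
    by (intro summable_on_Un_disjoint) auto
  moreover have "range int \<union> (range (\<lambda>n. - int n) - range int) = UNIV"
    by (auto, metis int_cases2 rangeI)
  ultimately show ?thesis by simp
qed

lemma abs_summable_on_TimesI:
  fixes f :: "'a \<Rightarrow> 'b \<Rightarrow> 'c::banach"
  assumes "\<And>x. x \<in> A \<Longrightarrow> ((\<lambda>y. norm (f x y)) has_sum g x) B" "g summable_on A"
  shows "(\<lambda>(x, y). f x y) summable_on A \<times> B"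
proof -
  have "(\<lambda>z. norm (case z of (x, y) \<Rightarrow> f x y)) summable_on A \<times> B"
    by (rule summable_on_SigmaI[where g = g]) (use assms in auto)
  then show ?thesis by (rule abs_summable_summable)
qed

text \<open>Fubini with the row sums and the column sums given explicitly: once the double family is
  summable, evaluating it in one order yields an identity for the other.\<close>

lemma has_sum_swap_sums:
  fixes f :: "'a \<Rightarrow> 'b \<Rightarrow> 'c::banach"
  assumes "(\<lambda>(x, y). f x y) summable_on A \<times> B"
    and g: "\<And>x. x \<in> A \<Longrightarrow> (f x has_sum g x) B"
    and h: "\<And>y. y \<in> B \<Longrightarrow> ((\<lambda>x. f x y) has_sum h y) A"
    and G: "(g has_sum G) A"
  shows "(h has_sum G) B"
proof -
  obtain S where S: "((\<lambda>(x, y). f x y) has_sum S) (A \<times> B)"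
    using assms(1) by (auto simp: summable_on_def)
  have "(g has_sum S) A"
    by (rule has_sum_SigmaD[OF S]) (use g in auto)
  then have "S = G" using G has_sum_unique by blast
  have "((\<lambda>(y, x). f x y) has_sum S) (B \<times> A)"
    using S by (subst (asm) has_sum_swap) (simp add: case_prod_unfold)
  then show ?thesis
    unfolding \<open>S = G\<close> by (rule has_sum_SigmaD) (use h in auto)
qed

lemma int_tri_add_1: "(n + 1) * ((n + 1) - 1) div 2 = n * (n - 1) div 2 + (n :: int)"
proof -
  have "(n + 1) * ((n + 1) - 1) = n * (n - 1) + n * 2" by (simp add: algebra_simps)
  then show ?thesis by simp
qed

lemma int_tri_of_nat: "int n * (int n - 1) div 2 = int (n * (n - 1) div 2)"
proof (induction n)
  case (Suc n)
  show ?case using int_tri_add_1[of "int n"] unfolding tri_Suc of_nat_Suc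
    by (simp add: Suc add.commute)
qed simp

lemma int_tri_uminus: "(- n) * (- n - 1) div 2 = n * (n - 1) div 2 + (n :: int)"
  using int_tri_add_1[of n] by (simp add: algebra_simps)

text \<open>Theta over any normed field: its value at \<open>norm z\<close> is the sum of the norms
  of the terms at \<open>z\<close>, and is needed to verify absolute convergence.\<close>

definition gtheta :: "real \<Rightarrow> 'a::{real_normed_field,banach} \<Rightarrow> 'a" where
  "gtheta p z = (\<Sum>\<^sub>\<infinity>n::int. of_real (p powi (n * (n - 1) div 2)) * z powi n)"

lemma theta_eq_gtheta: "theta p z = gtheta p z"
  by (simp add: theta_def gtheta_def)

context q_base
begin

text \<open>Since \<open>qpoch p n \<le> 1\<close>, the terms with \<open>n \<ge> 0\<close> are
  bounded by those of \<open>E\<close> at \<open>norm z\<close>; the substitution of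
  \<open>- n\<close> for \<open>n\<close> turns the other half into the same series at
  \<open>p / norm z\<close>.\<close>

lemma gtheta_summable:
  fixes z :: "'a::{real_normed_field,banach}"
  assumes "z \<noteq> 0"
  shows "(\<lambda>n::int. of_real (p powi (n * (n - 1) div 2)) * z powi n) abs_summable_on UNIV"
proof (rule summable_on_int)
  have le: "p ^ (n * (n - 1) div 2) * y ^ n \<le> qcoeff p n * y ^ n" if "y \<ge> 0" for n and y :: real
    using qpoch_pos[of n] qpoch_le_1[of n] p_pos that
    by (intro mult_right_mono) (auto simp: qcoeff_def le_divide_eq mult_left_le)
  have *: "summable (\<lambda>n. p ^ (n * (n - 1) div 2) * y ^ n)" if "y \<ge> 0" for y :: real
    by (rule summable_comparison_test'[OF summable_qcoeff[OF that]])
       (use le that p_pos in auto)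
  show "summable (\<lambda>n. norm (of_real (p powi (int n * (int n - 1) div 2)) * z powi int n))"
    using *[of "norm z"] p_pos by (simp add: norm_mult norm_power int_tri_of_nat)
  have "norm (of_real (p powi (- int n * (- int n - 1) div 2)) * z powi (- int n))
      = p ^ (n * (n - 1) div 2) * (p / norm z) ^ n" for n
    unfolding int_tri_uminus int_tri_of_nat of_nat_add[symmetric] power_int_of_nat
    using p_pos by (simp add: norm_mult norm_power norm_inverse power_add power_divide power_int_minus power_mult_distrib divide_inverse power_inverse)
  then show "summable (\<lambda>n. norm (of_real (p powi (- int n * (- int n - 1) div 2)) * z powi (- int n)))"
    using *[of "p / norm z"] p_pos by simp
qed

lemma gtheta_has_sum:
  fixes z :: "'a::{real_normed_field,banach}"
  assumes "z \<noteq> 0"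
  shows "((\<lambda>n::int. of_real (p powi (n * (n - 1) div 2)) * z powi n) has_sum gtheta p z) UNIV"
  unfolding gtheta_def by (rule has_sum_infsum[OF abs_summable_summable[OF gtheta_summable[OF assms]]])

lemma gtheta_shift:
  fixes z :: "'a::{real_normed_field,banach}"
  assumes "z \<noteq> 0"
  shows "gtheta p z = z * gtheta p (of_real p * z)"
proof -
  let ?g = "\<lambda>n::int. of_real (p powi (n * (n - 1) div 2)) * z powi n"
  have "bij_betw (\<lambda>n::int. n + 1) UNIV UNIV"
    by (rule bij_betwI[where g = "\<lambda>n. n - 1"]) auto
  from has_sum_reindex_bij_betw[OF this, of ?g] gtheta_has_sum[OF assms]
  have "((\<lambda>n. ?g (n + 1)) has_sum gtheta p z) UNIV" by blast
  moreover have "?g (n + 1) = z * (of_real (p powi (n * (n - 1) div 2)) * (of_real p * z) powi n)" for n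
    using p_pos assms unfolding int_tri_add_1
    by (simp add: power_int_add power_int_add_1 power_int_mult_distrib of_real_power_int)
  moreover have "((\<lambda>n. z * (of_real (p powi (n * (n - 1) div 2)) * (of_real p * z) powi n))
      has_sum (z * gtheta p (of_real p * z))) UNIV"
    using p_pos assms by (intro has_sum_cmult_right gtheta_has_sum) auto
  ultimately show ?thesis by (simp add: has_sum_unique)
qed

lemma gtheta_shift_pow:
  fixes z :: "'a::{real_normed_field,banach}"
  assumes "z \<noteq> 0"
  shows "gtheta p z = z ^ m * of_real (p ^ (m * (m - 1) div 2)) * gtheta p (of_real p ^ m * z)"
proof (induction m)
  case (Suc m)
  have "gtheta p (of_real p ^ m * z) = of_real p ^ m * z * gtheta p (of_real p * (of_real p ^ m * z))"
    using assms p_pos by (intro gtheta_shift) auto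
  then show ?case using Suc unfolding tri_Suc power_add by (simp add: mult_ac)
qed simp

text \<open>Expand \<open>\<kappa> E z\<close> over all integers, which is possible since \<open>E (- p^(n+1)) = 0\<close> for \<open>n < 0\<close>, and
  then expand \<open>E (- p^(n+1))\<close>; interchanging the sums gives theta times an Euler series in \<open>- p / z\<close>.\<close>

lemma triple_product_outside:
  assumes "norm z > p"
  shows "theta p z = of_real \<kappa> * qE p z * qE p (of_real p / z)"
proof -
  have [simp]: "z \<noteq> 0" using assms p_pos by auto
  \<comment> \<open>\<open>qA w\<close> is the reciprocal of \<open>E (p / z)\<close>; the
    hypothesis on \<open>z\<close> says exactly that \<open>w\<close> lies in the unit disc, where
    this series converges.\<close>
  define w where "w = - (of_real p / z)"
  have w: "norm w < 1" using assms p_pos by (simp add: w_def norm_divide divide_less_eq)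
  let ?th = "\<lambda>n::int. complex_of_real (p powi (n * (n - 1) div 2)) * z powi n"
  let ?e = "\<lambda>m. complex_of_real (qcoeff p m)"
  define f where "f = (\<lambda>m n. ?e m * (- of_real p) ^ m * (of_real (p powi (n * (n - 1) div 2)) * (of_real p ^ m * z) powi n))"
  \<comment> \<open>Quasi-periodicity trades the dilation by \<open>p^m\<close> for the triangular
    power in \<open>qcoeff p m\<close>. It is applied twice, at \<open>z\<close> for the value and
    at \<open>norm z\<close> for absolute convergence, hence the polymorphic
    \<open>y\<close>.\<close>
  have shift: "gtheta p (of_real p ^ m * y) * of_real (qcoeff p m) * of_real p ^ m =
      gtheta p y * (of_real (1 / qpoch p m) * (of_real p / y) ^ m)"
    if "y \<noteq> 0" for m and y :: "'b :: {real_normed_field,banach}"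
    using that p_pos qpoch_pos[of m] gtheta_shift_pow[OF that, of m]
    by (simp add: qcoeff_def power_divide mult_ac)
  have cols: "(f m has_sum gtheta p z * (of_real (1 / qpoch p m) * w ^ m)) UNIV" for m
  proof -
    have "(f m has_sum ?e m * (- of_real p) ^ m * gtheta p (of_real p ^ m * z)) UNIV"
      unfolding f_def using p_pos by (intro has_sum_cmult_right gtheta_has_sum) auto
    also have "?e m * (- of_real p) ^ m * gtheta p (of_real p ^ m * z)
        = (-1) ^ m * (gtheta p (of_real p ^ m * z) * ?e m * of_real p ^ m)"
      by (simp add: power_minus[of "of_real p"])
    also have "\<dots> = gtheta p z * (of_real (1 / qpoch p m) * w ^ m)"
      unfolding shift[OF \<open>z \<noteq> 0\<close>] by (simp add: w_def power_minus[of "of_real p / z"] del: of_real_divide)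
    finally show ?thesis .
  qed
  have norm_cols: "((\<lambda>n. norm (f m n)) has_sum gtheta p (norm z) * (1 / qpoch p m * norm w ^ m)) UNIV" for m
  proof -
    have "((\<lambda>n. qcoeff p m * p ^ m * (of_real (p powi (n * (n - 1) div 2)) * (of_real p ^ m * norm z) powi n))
      has_sum qcoeff p m * p ^ m * gtheta p (of_real p ^ m * norm z)) UNIV"
      using p_pos by (intro has_sum_cmult_right gtheta_has_sum) auto
    also have "qcoeff p m * p ^ m * gtheta p (of_real p ^ m * norm z) 
       = gtheta p (norm z) * (1 / qpoch p m * norm w ^ m)"
      using shift[of "norm z" m] p_pos by (simp add: w_def norm_divide mult_ac)
    also have "(\<lambda>n. qcoeff p m * p ^ m * (of_real (p powi (n * (n - 1) div 2)) * (of_real p ^ m * norm z) powi n))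
       = (\<lambda>n. norm (f m n))"
      using p_pos qcoeff_pos[of m] by (auto simp: f_def norm_mult norm_power norm_power_int)
    finally show ?thesis .
  qed
  have summ: "(\<lambda>(m, n). f m n) summable_on UNIV \<times> UNIV"
  proof (rule abs_summable_on_TimesI[OF norm_cols])
    show "(\<lambda>m. gtheta p (norm z) * (1 / qpoch p m * norm w ^ m)) summable_on UNIV"
      by (intro summable_on_cmult_right norm_summable_imp_summable_on)
         (use summable_qA_real[of "norm w"] w qpoch_pos in \<open>auto simp: abs_mult abs_of_pos power_abs\<close>)
  qed
  have rows: "((\<lambda>m. f m n) has_sum ?th n * qE p (- (of_real p powi (n + 1)))) UNIV" for n
  proof -
    have "((\<lambda>m. ?th n * (?e m * (- (of_real p powi (n + 1))) ^ m)) has_sum ?th n * qE p (- (of_real p powi (n + 1)))) UNIV"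
      by (intro has_sum_cmult_right norm_summable_imp_has_sum summable_norm_qE qE_sums)
    moreover have "?th n * (?e m * (- (of_real p powi (n + 1))) ^ m) = f m n" for m
    proof -
      have "(of_real p ^ m) powi n = ((of_real p powi n) ^ m :: complex)"
        by (simp add: power_int_power power_int_power' mult.commute)
      then show ?thesis
        using p_pos by (simp add: f_def power_int_mult_distrib power_int_add_1 power_mult_distrib power_minus[of "_ * _"] power_minus[of "of_real p"] mult_ac)
    qed
    ultimately show ?thesis by simp
  qed
  have "((\<lambda>m. gtheta p z * (of_real (1 / qpoch p m) * w ^ m)) has_sum gtheta p z * qA w) UNIV"
    using summable_norm_qA[OF w]
    by (intro has_sum_cmult_right norm_summable_imp_has_sum) (auto simp: qA_def summable_norm_cancel)
  then have "((\<lambda>n. ?th n * qE p (- (of_real p powi (n + 1)))) has_sum gtheta p z * qA w) UNIV"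
    by (rule has_sum_swap_sums[OF summ cols rows])
  moreover have "((\<lambda>n. ?th n * qE p (- (of_real p powi (n + 1)))) has_sum of_real \<kappa> * qE p z) UNIV"
  proof -
    have zero: "qE p (- (complex_of_real p powi (n + 1))) = 0" if neg: "n \<notin> range int" for n
    proof -
      obtain k where n: "n = - int (Suc k)"
        using neg by (metis int_cases rangeI)
      have "- (complex_of_real p powi (n + 1)) = of_real (- (1 / p ^ k))"
        unfolding n by (simp add: power_int_minus divide_inverse)
      then show ?thesis using qE_minus_inverse_pow[of k] by (simp only: qE_of_real) simp
    qed
    have "?th (int k) * qE p (- (of_real p powi (int k + 1))) = of_real \<kappa> * (of_real (qcoeff p k) * z ^ k)" for k
    proof -
      have "- (complex_of_real p powi (int k + 1)) = of_real (- (p ^ Suc k))"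
        by (simp add: power_int_add_1')
      then have "qE p (- (complex_of_real p powi (int k + 1))) = of_real (\<kappa> / qpoch p k)"
        by (simp only: qE_of_real qE_minus_pow_Suc)
      then show ?thesis by (simp add: int_tri_of_nat qcoeff_def)
    qed
    then have "((\<lambda>k. ?th (int k) * qE p (- (of_real p powi (int k + 1)))) has_sum of_real \<kappa> * qE p z) UNIV"
      using has_sum_cmult_right[OF norm_summable_imp_has_sum[OF summable_norm_qE qE_sums], of "of_real \<kappa>" z]
      by (simp only:)
    then have "((\<lambda>n. ?th n * qE p (- (of_real p powi (n + 1)))) has_sum of_real \<kappa> * qE p z) (range int)"
      by (subst has_sum_reindex) (auto simp: o_def)
    then show ?thesis
      by (rule has_sum_cong_neutral[THEN iffD1, rotated -1]) (use zero in auto)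
  qed
  ultimately have "of_real \<kappa> * qE p z = gtheta p z * qA w"
    using has_sum_unique by blast
  then show ?thesis
    using qA_mult_qE[OF w] by (simp add: theta_eq_gtheta w_def mult_ac) 
qed

text \<open>The recursion at \<open>z\<close> and at \<open>1 / z\<close> releases the factors
  \<open>1 + z\<close> and \<open>1 + 1 / z\<close>, whose quotient is \<open>z\<close>. So the
  product side of the triple product has the quasi-periodicity of theta.\<close>

lemma qE_inversion:
  fixes z :: "'a::{real_normed_field,banach}"
  assumes "z \<noteq> 0"
  shows "qE p z * qE p (of_real p / z) = z * (qE p (of_real p * z) * qE p (1 / z))"
proof -
  have "qE p z * qE p (of_real p / z) = (1 + z) * qE p (of_real p * z) * qE p (of_real p / z)"
    using qE_rec[of z] by simp
  also have "\<dots> = z * (qE p (of_real p * z) * ((1 + 1 / z) * qE p (of_real p * (1 / z))))"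
    using assms by (simp add: field_simps)
  also have "(1 + 1 / z) * qE p (of_real p * (1 / z)) = qE p (1 / z)"
    using qE_rec[of "1 / z"] by simp
  finally show ?thesis .
qed

text \<open>Both sides satisfy \<open>F y = y * F (p y)\<close>, so validity for
  \<open>norm z > p^k\<close> passes to \<open>norm z > p^(k+1)\<close>. The start
  \<open>k = 0\<close> lies inside the region already treated because \<open>p < 1\<close>, and the
  powers of \<open>p\<close> come below every positive norm.\<close>

theorem triple_product:
  assumes "z \<noteq> 0"
  shows "theta p z = of_real \<kappa> * qE p z * qE p (of_real p / z)"
proof -
  have "\<forall>z::complex. norm z > p ^ k \<longrightarrow> theta p z = of_real \<kappa> * qE p z * qE p (of_real p / z)" for k
  proof (induction k)
    case 0
    then show ?case using triple_product_outside p_less_1 by auto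
  next
    case (Suc k)
    show ?case
    proof (intro allI impI)
      fix z :: complex assume z: "norm z > p ^ Suc k"
      define y where "y = z / of_real p"
      have y: "norm y > p ^ k" using z p_pos by (simp add: y_def norm_divide field_simps)
      have "y \<noteq> 0" and z_eq: "z = of_real p * y" using y p_pos by (auto simp: y_def)
      have "y * theta p z = theta p y"
        using gtheta_shift[OF \<open>y \<noteq> 0\<close>] by (simp add: theta_eq_gtheta z_eq)
      also have "\<dots> = of_real \<kappa> * qE p y * qE p (of_real p / y)"
        using Suc y by blast
      also have "\<dots> = y * (of_real \<kappa> * qE p z * qE p (1 / y))"
        using qE_inversion[OF \<open>y \<noteq> 0\<close>] by (simp add: z_eq mult_ac)
      finally show "theta p z = of_real \<kappa> * qE p z * qE p (of_real p / z)"
        using \<open>y \<noteq> 0\<close> p_pos by (simp add: z_eq mult_ac)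
    qed
  qed
  moreover have "(\<lambda>k. p ^ k) \<longlonglongrightarrow> 0"
    using p_pos p_less_1 by (intro LIMSEQ_power_zero) auto
  then have "\<forall>\<^sub>F k in sequentially. p ^ k < norm z"
    using assms by (intro order_tendstoD) auto
  then obtain k where "p ^ k < norm z" by (auto simp: eventually_sequentially)
  ultimately show ?thesis by blast
qed

end

section \<open>Zeros and lower bounds of \<open>E\<close> and theta\<close>

context q_base
begin

lemma qE_prod:
  fixes z :: "'a::{real_normed_field,banach}"
  shows "qE p z = (\<Prod>i<n. 1 + of_real p ^ i * z) * qE p (of_real p ^ n * z)"
proof (induction n)
  case (Suc n)
  then show ?case using qE_rec[of "of_real p ^ n * z"] by (simp add: mult_ac)
qed simp

text \<open>As \<open>E (p^n z)\<close> tends to \<open>E 0 = 1\<close>, it is nonzero for some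
  \<open>n\<close>; a zero of \<open>E\<close> must therefore be a zero of one of the finitely many
  factors split off by the recursion.\<close>

lemma qE_eq_0D:
  fixes z :: complex
  assumes "qE p z = 0"
  shows "\<exists>n. z = - (1 / of_real p ^ n)"
proof -
  have "(\<lambda>n. of_real p ^ n * z) \<longlonglongrightarrow> 0 * z"
    using p_pos p_less_1 by (intro tendsto_intros LIMSEQ_power_zero) auto
  moreover have "isCont (qE p) (0::complex)"
    using continuous_on_qE[OF continuous_on_id, of UNIV] by (auto simp: continuous_on_eq_continuous_at)
  ultimately have "(\<lambda>n. qE p (of_real p ^ n * z)) \<longlonglongrightarrow> qE p 0"
    by (intro isCont_tendsto_compose[of 0 "qE p"]) auto
  then have "\<forall>\<^sub>F n in sequentially. qE p (of_real p ^ n * z) \<noteq> 0"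
    by (rule tendsto_imp_eventually_ne) simp
  then obtain n where "qE p (of_real p ^ n * z) \<noteq> 0"
    by (auto simp: eventually_sequentially)
  then have "(\<Prod>i<n. 1 + of_real p ^ i * z) = 0" using qE_prod[of z n] assms by simp
  then obtain i where "1 + of_real p ^ i * z = 0" by auto
  then have "z = - (1 / of_real p ^ i)" using p_pos by (simp add: field_simps add_eq_0_iff)
  then show ?thesis ..
qed

text \<open>Theta without the constant \<kappa>, by the triple product. Its values at positive reals
  are the standard against which complex values are measured.\<close>

definition qT :: "'a::{real_normed_field,banach} \<Rightarrow> 'a" where
  "qT z = qE p z * qE p (of_real p / z)"

lemma theta_eq_qT: "z \<noteq> 0 \<Longrightarrow> theta p z = of_real \<kappa> * qT z"
  using triple_product by (simp add: qT_def mult.assoc)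

lemma qT_rec:
  fixes z :: "'a::{real_normed_field,banach}"
  assumes "z \<noteq> 0"
  shows "qT z = z * qT (of_real p * z)"
  using qE_inversion[OF assms] p_pos assms by (simp add: qT_def)

lemma qT_nonzero:
  fixes z :: complex
  assumes "z \<noteq> 0" "\<And>n::int. z \<noteq> - of_real (p powi n)"
  shows "qT z \<noteq> 0"
proof
  assume "qT z = 0"
  then consider "qE p z = 0" | "qE p (of_real p / z) = 0" by (auto simp: qT_def)
  then show False
  proof cases
    case 1
    then obtain n where "z = - (1 / of_real p ^ n)" using qE_eq_0D by blast
    then show False using assms(2)[of "- int n"] by (simp add: power_int_minus divide_inverse)
  next
    case 2
    then obtain n where "of_real p / z = - (1 / of_real p ^ n)" using qE_eq_0D by blast
    then have "z = - of_real (p ^ Suc n)" using \<open>z \<noteq> 0\<close> p_pos by (simp add: field_simps)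
    then show False using assms(2)[of "int (Suc n)"] by (simp only: power_int_of_nat)
  qed
qed

lemma qT_pos: "y > 0 \<Longrightarrow> qT y > (0::real)"
  using qE_ge_1[of y] qE_ge_1[of "p / y"] p_pos by (simp add: qT_def)

text \<open>The quotient of \<open>\<bar>qT z\<bar>\<close> and \<open>qT \<bar>z\<bar>\<close> is invariant under \<open>z \<mapsto> p z\<close>, so that it is bounded
  on a compact set of spirals.\<close>

lemma qT_ratio_invariant:
  fixes z :: complex
  assumes "z \<noteq> 0"
  shows "qT (p powi n * norm z) * norm (qT z) = qT (norm z) * norm (qT (of_real (p powi n) * z))"
proof -
  have step: "qT (p * norm w) * norm (qT w) = qT (norm w) * norm (qT (of_real p * w))" if "w \<noteq> 0" for w :: complex
    using qT_rec[OF that] qT_rec[of "norm w"] that by (simp add: norm_mult)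
  have powers: "qT (p ^ k * norm w) * norm (qT w) = qT (norm w) * norm (qT (of_real (p ^ k) * w))"
    if "w \<noteq> 0" for k and w :: complex
  proof (induction k)
    case (Suc k)
    have pos: "qT (p ^ k * norm w) > 0" using p_pos that by (intro qT_pos) auto
    have "qT (p ^ Suc k * norm w) * norm (qT w) * qT (p ^ k * norm w)
       = qT (p * norm (of_real (p ^ k) * w)) * (qT (p ^ k * norm w) * norm (qT w))"
      using p_pos by (simp add: norm_mult norm_power mult_ac)
    also have "\<dots> = qT (norm w) * (qT (p * norm (of_real (p ^ k) * w)) * norm (qT (of_real (p ^ k) * w)))"
      unfolding Suc by simp
    also have "\<dots> = qT (norm w) * (qT (p ^ k * norm w) * norm (qT (of_real (p ^ Suc k) * w)))"
      using step[of "of_real (p ^ k) * w"] that p_pos by (simp add: norm_mult norm_power mult_ac)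
    finally show ?case using pos by simp
  qed simp
  show ?thesis
  proof (cases n rule: int_cases2)
    case (nonneg k)
    then show ?thesis using powers[OF assms, of k] by simp
  next
    case (nonpos k)
    \<comment> \<open>For a nonpositive exponent the dilated point is taken as the base point and
      the identity for powers is read backwards.\<close>
    define u where "u = of_real (p powi n) * z"
    have "of_real (p ^ k) * u = z" "p ^ k * norm u = norm z" "norm u = p powi n * norm z"
      using p_pos by (simp_all add: u_def nonpos power_int_minus norm_mult norm_inverse norm_power)
    moreover have "u \<noteq> 0" using assms p_pos by (simp add: u_def)
    ultimately show ?thesis
      using powers[of u k] unfolding u_def[symmetric] by metis
  qed
qed

lemma qT_compact_bound:
  fixes K :: "complex set"
  assumes "compact K" and ne: "\<And>w. w \<in> K \<Longrightarrow> w \<noteq> 0" "\<And>w n. w \<in> K \<Longrightarrow> w \<noteq> - of_real (p powi n)"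
  obtains M where "M > 0" "\<And>w n. w \<in> K \<Longrightarrow> qT (p powi n * norm w) \<le> M * norm (qT (of_real (p powi n) * w))"
proof -
  have "continuous_on K (\<lambda>w. qT (norm w) / norm (qT w))"
    unfolding qT_def using ne qT_nonzero by (intro continuous_intros) (auto simp: qT_def)
  then have "bounded ((\<lambda>w. qT (norm w) / norm (qT w)) ` K)"
    using \<open>compact K\<close> by (intro compact_imp_bounded compact_continuous_image)
  then obtain M where M: "M > 0" "\<And>w. w \<in> K \<Longrightarrow> norm (qT (norm w) / norm (qT w)) \<le> M"
    by (auto simp: bounded_pos)
  show thesis
  proof
    fix w n assume "w \<in> K"
    then have nz: "norm (qT w) > 0" and "w \<noteq> 0" using ne qT_nonzero by auto
    have "qT (norm w) \<le> M * norm (qT w)"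
      using M(2)[OF \<open>w \<in> K\<close>] nz by (simp add: divide_le_eq abs_le_iff)
    then have "qT (norm w) * norm (qT (of_real (p powi n) * w)) \<le> M * norm (qT w) * norm (qT (of_real (p powi n) * w))"
      by (rule mult_right_mono) simp
    then show "qT (p powi n * norm w) \<le> M * norm (qT (of_real (p powi n) * w))"
      unfolding qT_ratio_invariant[OF \<open>w \<noteq> 0\<close>, of n, symmetric]
      using nz by (simp add: mult.assoc mult.left_commute[of M] mult.commute[of _ "norm (qT w)"])
  qed (fact M(1))
qed

text \<open>For the sums with \<open>E\<close> in the denominator, the factor
  \<open>E (p / z)\<close> of \<open>qT z\<close> is removed by means of
  \<open>norm (E (p / z)) \<le> E (p / norm z)\<close>. For theta the surplus
  \<open>E (p / norm z)\<close> is kept: it is the sum of the norms of the Euler series in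
  \<open>p / z\<close> that appears in the interchange.\<close>

lemma qE_lower_bound:
  fixes z :: complex
  assumes "qT (norm z) \<le> M * norm (qT z)" "z \<noteq> 0" "M > 0"
  shows "qE p (norm z) \<le> M * norm (qE p z)"
    and "qE p (p / norm z) * qE p (norm z) \<le> M * norm (qT z)"
proof -
  have E1: "qE p (p / norm z) \<ge> 1" using p_pos by (intro qE_ge_1) auto
  have "norm (qE p (of_real p / z)) \<le> qE p (p / norm z)"
    using norm_qE_le[of "of_real p / z"] p_pos by (simp add: norm_divide)
  then have "norm (qT z) \<le> norm (qE p z) * qE p (p / norm z)"
    unfolding qT_def norm_mult by (intro mult_left_mono) auto
  then have "M * norm (qT z) \<le> M * (norm (qE p z) * qE p (p / norm z))"
    using \<open>M > 0\<close> by (intro mult_left_mono) auto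
  moreover have "qE p (norm z) * qE p (p / norm z) \<le> M * norm (qT z)"
    using assms(1) by (simp add: qT_def[of "norm z"])
  ultimately have "qE p (norm z) * qE p (p / norm z) \<le> (M * norm (qE p z)) * qE p (p / norm z)"
    by (simp only: mult.assoc)
  then show "qE p (norm z) \<le> M * norm (qE p z)" using E1 by simp
  show "qE p (p / norm z) * qE p (norm z) \<le> M * norm (qT z)"
    using assms(1) by (simp add: qT_def mult_ac)
qed

text \<open>With \<open>y = b / p^(n+1)\<close>, one step of the recursion multiplies the left
  \<open>E\<close> by \<open>1 + y\<close> and the right one by \<open>1 + s * y\<close>. The
  threshold for \<open>s\<close> ensures \<open>Q * (1 + y) \<le> (1 + s * y) / 2\<close> for all
  \<open>y \<ge> b0\<close>, so that enlarging the argument by \<open>s\<close> pays for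
  \<open>Q^n\<close> and leaves a geometric gain.\<close>

lemma qE_growth_compare:
  fixes b0 b Q s :: real
  assumes "b0 > 0" "Q \<ge> 1" "s \<ge> 2 * Q * (1 + 1 / b0)" "b \<ge> b0"
  shows "Q ^ n * qE p (b / p ^ n) \<le> (1 / 2) ^ n * qE p (s * b / p ^ n)"
proof (induction n)
  case 0
  have "1 / b0 > 0" using assms by simp
  then have "2 * Q * (1 + 1 / b0) \<ge> 1" using assms by (smt (verit) mult_less_cancel_left2)
  then have "s \<ge> 1" using assms by linarith
  then show ?case using assms by (auto intro!: qE_mono simp: mult_le_cancel_right1)
next
  case (Suc n)
  have rec: "qE p (y / p ^ Suc n) = (1 + y / p ^ Suc n) * qE p (y / p ^ n)" for y
    using qE_rec[of "y / p ^ Suc n"] p_pos by simp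
  define y where "y = b / p ^ Suc n"
  have pw: "0 < p ^ Suc n" "p ^ Suc n \<le> 1" using p_pos p_less_1 by (auto simp: power_le_one simp del: power_Suc)
  have "b0 * p ^ Suc n \<le> b" using assms pw(2) by (smt (verit) mult_left_le)
  then have y: "y \<ge> b0" using pw(1) unfolding y_def by (simp add: le_divide_eq del: power_Suc)
  have "2 * Q * (1 + y) \<le> 2 * Q * (1 + 1 / b0) * y"
  proof -
    have "1 \<le> y / b0" using y assms by simp
    then have "1 + y \<le> (1 + 1 / b0) * y" by (simp add: algebra_simps)
    then have "2 * Q * (1 + y) \<le> 2 * Q * ((1 + 1 / b0) * y)" using assms by (intro mult_left_mono) auto
    then show ?thesis by (simp only: mult.assoc)
  qed
  also have "\<dots> \<le> s * y" using assms y by (intro mult_right_mono) auto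
  finally have fac: "Q * (1 + y) \<le> 1 / 2 * (1 + s * y)" by simp
  have "Q ^ Suc n * qE p (b / p ^ Suc n) = (Q * (1 + y)) * (Q ^ n * qE p (b / p ^ n))"
    unfolding rec y_def by simp
  also have "\<dots> \<le> (1 / 2 * (1 + s * y)) * ((1 / 2) ^ n * qE p (s * b / p ^ n))"
  proof (rule mult_mono[OF fac Suc])
    have "qE p (b / p ^ n) \<ge> 1" using assms p_pos by (intro qE_ge_1) auto
    then show "0 \<le> Q ^ n * qE p (b / p ^ n)" using assms by (intro mult_nonneg_nonneg) auto
    show "0 \<le> 1 / 2 * (1 + s * y)" using fac assms y by (smt (verit) mult_nonneg_nonneg)
  qed
  also have "\<dots> = (1 / 2) ^ Suc n * qE p (s * b / p ^ Suc n)"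
    unfolding rec y_def by simp
  finally show ?case .
qed

end

section \<open>The functional equation of the Borel transform\<close>

locale q_pair = q_base +
  fixes q :: real
  assumes p_eq: "p = 1 / q"
begin

lemma q_eq: "q = 1 / p"
  using p_eq p_pos by auto

lemma q_gt_1: "q > 1"
  using p_pos p_less_1 by (simp add: q_eq)

lemma q_fact_eq: "q_fact q n = qpoch p n / (p ^ (n * (n - 1) div 2) * (1 - p) ^ n)"
proof (induction n)
  case (Suc n)
  have "q_number q (Suc n) = (1 - p ^ Suc n) / (p ^ n * (1 - p))"
    using p_pos p_less_1 by (simp add: q_number_def q_eq field_simps)
  moreover have "q_fact q (Suc n) = q_fact q n * q_number q (Suc n)"
    by (simp add: q_fact_def)
  ultimately show ?case
    unfolding Suc tri_Suc qpoch_Suc power_add by simp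
qed (simp add: q_fact_def)

lemma q_exp_eq_qE:
  fixes x :: "'a::{real_normed_field,banach}"
  shows "q_exp q x = qE p (of_real (1 - p) * x)"
proof -
  have "x ^ n / of_real (q_fact q n) = of_real (qcoeff p n) * (of_real (1 - p) * x) ^ n" for n
    unfolding q_fact_eq qcoeff_def by (simp add: power_mult_distrib)
  then show ?thesis unfolding q_exp_def qE_def by presburger
qed

lemma borel_theta_nth: "fps_nth (borel_theta q f) n = fps_nth f (Suc n) * of_real (p ^ (n * (n - 1) div 2))"
  by (simp add: borel_theta_def p_eq power_divide)

lemma tri_add: "(k + m) * (k + m - 1) div 2 = k * (k - 1) div 2 + m * (m - 1) div 2 + k * (m::nat)"
proof (induction m)
  case (Suc m)
  show ?case using Suc tri_Suc[of "k + m"] tri_Suc[of m] by simp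
qed simp

text \<open>Coefficients of a convergent series grow at most geometrically, and the triangular power
  of \<open>p\<close> beats every geometric growth; the majorant is a multiple of the series of
  \<open>E\<close> at \<open>R / r\<close>.\<close>

lemma summable_fps_qcoeff:
  fixes a :: "complex fps"
  assumes "fps_conv_radius a > 0" "R \<ge> 0"
  shows "summable (\<lambda>k. norm (fps_nth a k) * p ^ (k * (k - 1) div 2) * R ^ k)"
proof -
  obtain r where r: "r > 0" "ereal r < fps_conv_radius a"
    using assms(1) by (metis ereal_dense2 ereal_less(2) zero_ereal_def)
  have "summable (\<lambda>k. norm (fps_nth a k * of_real r ^ k))"
    using r by (intro norm_summable_fps) auto
  then have "Bseq (\<lambda>k. norm (fps_nth a k * of_real r ^ k))"
    by (intro convergent_imp_Bseq convergentI[OF summable_LIMSEQ_zero])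
  then obtain C where C: "C > 0" "\<And>k. norm (fps_nth a k) * r ^ k \<le> C"
    using r by (auto simp: Bseq_def norm_mult norm_power)
  show ?thesis
  proof (rule summable_comparison_test'[where N = 0])
    show "summable (\<lambda>k. C * (qcoeff p k * (R / r) ^ k))"
      using assms r by (intro summable_mult summable_qcoeff) auto
    fix k :: nat
    have "norm (fps_nth a k) * p ^ (k * (k - 1) div 2) * R ^ k
      = (norm (fps_nth a k) * r ^ k) * (p ^ (k * (k - 1) div 2) * (R / r) ^ k)"
      using r by (simp add: power_divide)
    also have "\<dots> \<le> C * (qcoeff p k * (R / r) ^ k)"
    proof (rule mult_mono[OF C(2)])
      show "p ^ (k * (k - 1) div 2) * (R / r) ^ k \<le> qcoeff p k * (R / r) ^ k"
        using assms r p_pos qpoch_pos[of k] qpoch_le_1[of k]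
        by (intro mult_right_mono) (auto simp: qcoeff_def le_divide_eq mult_left_le)
    qed (use C assms r p_pos in auto)
    finally show "norm (norm (fps_nth a k) * p ^ (k * (k - 1) div 2) * R ^ k) \<le> C * (qcoeff p k * (R / r) ^ k)"
      using assms p_pos by simp
  qed
qed

text \<open>Applied to the right side of the q-difference equation, which converges by hypothesis:
  its transform is entire.\<close>

lemma fps_conv_radius_borel_theta:
  assumes "fps_conv_radius f > 0"
  shows "fps_conv_radius (borel_theta q f) = \<infinity>"
proof -
  have "fps_conv_radius (fps_shift 1 f) > 0" using assms by simp
  have "ereal r \<le> fps_conv_radius (borel_theta q f)" for r :: real
  proof -
    have "summable (\<lambda>n. norm (fps_nth (borel_theta q f) n * of_real \<bar>r\<bar> ^ n))"
      using summable_fps_qcoeff[OF \<open>fps_conv_radius (fps_shift 1 f) > 0\<close>, of "\<bar>r\<bar>"] p_pos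
      by (simp add: borel_theta_nth norm_mult norm_power)
    from conv_radius_geI[OF summable_norm_cancel[OF this]]
    have "ereal \<bar>r\<bar> \<le> fps_conv_radius (borel_theta q f)"
      unfolding fps_conv_radius_def by simp
    then show ?thesis by (rule order_trans[rotated]) simp
  qed
  then show ?thesis by (intro ereal_top)
qed

text \<open>The triangular exponent of \<open>k + m\<close> is the sum of those of \<open>k\<close>
  and \<open>m\<close> and of the cross term \<open>k * m\<close>. The cross term dilates the
  argument by \<open>p^k\<close>, so that multiplication by \<open>a\<close> becomes a weighted sum
  of dilations. With \<open>h\<close> free of a constant term, the coefficient of index
  \<open>N + 1\<close> of \<open>a * h\<close> involves only \<open>k \<le> N\<close>.\<close>

lemma eval_borel_theta_mult:
  assumes "fps_conv_radius a > 0" "fps_nth h 0 = 0" "norm \<xi> < fps_conv_radius (borel_theta q h)"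
  shows "((\<lambda>k. fps_nth a k * of_real (p ^ (k * (k - 1) div 2)) * \<xi> ^ k * eval_fps (borel_theta q h) (of_real p ^ k * \<xi>))
     has_sum eval_fps (borel_theta q (a * h)) \<xi>) UNIV"
    and "summable (\<lambda>N. fps_nth (borel_theta q (a * h)) N * \<xi> ^ N)"
proof -
  let ?A = "\<lambda>k. fps_nth a k * of_real (p ^ (k * (k - 1) div 2)) * \<xi> ^ k"
  let ?B = "\<lambda>k m. fps_nth (borel_theta q h) m * (of_real p ^ k * \<xi>) ^ m"
  define f where "f = (\<lambda>k m. ?A k * ?B k m)"
  define F where "F = (\<lambda>N. fps_nth (borel_theta q (a * h)) N * \<xi> ^ N)"
  have pk: "norm (of_real p ^ k * \<xi>) \<le> norm \<xi>" for k
    using p_pos p_less_1 by (simp add: norm_mult norm_power power_le_one mult_left_le_one_le)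
  have B_sum: "summable (\<lambda>m. norm (?B k m))" for k
  proof (rule norm_summable_fps)
    show "ereal (norm (of_real p ^ k * \<xi>)) < fps_conv_radius (borel_theta q h)"
      using pk[of k] assms(3) by (metis ereal_less_eq(3) le_less_trans)
  qed
  have A_sum: "summable (\<lambda>k. norm (?A k))"
    using summable_fps_qcoeff[OF assms(1), of "norm \<xi>"] p_pos by (simp add: norm_mult norm_power)
  have summ: "(\<lambda>(k, m). f k m) summable_on UNIV \<times> UNIV"
  proof (rule abs_summable_on_TimesI)
    show "((\<lambda>m. norm (f k m)) has_sum norm (?A k) * (\<Sum>m. norm (?B k m))) UNIV" for k
      unfolding f_def norm_mult[of "?A k"] using B_sum[of k]
      by (intro has_sum_cmult_right norm_summable_imp_has_sum) (auto simp: summable_sums)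
    show "(\<lambda>k. norm (?A k) * (\<Sum>m. norm (?B k m))) summable_on UNIV"
    proof (rule norm_summable_imp_summable_on, rule summable_comparison_test'[where N = 0])
      show "summable (\<lambda>k. norm (?A k) * (\<Sum>m. norm (?B 0 m)))"
        using A_sum by (rule summable_mult2)
      fix k
      have "(\<Sum>m. norm (?B k m)) \<le> (\<Sum>m. norm (?B 0 m))"
        using B_sum[of k] B_sum[of 0] pk[of k] by (intro suminf_le) (auto simp: norm_mult norm_power intro!: mult_left_mono power_mono)
      then show "norm (norm (norm (?A k) * (\<Sum>m. norm (?B k m)))) \<le> norm (?A k) * (\<Sum>m. norm (?B 0 m))"
        using B_sum[of k] by (auto simp: suminf_nonneg abs_mult intro!: mult_left_mono)
    qed
  qed
  have f_eq: "f k m = fps_nth a k * fps_nth h (Suc m) * (of_real (p ^ ((k + m) * (k + m - 1) div 2)) * \<xi> ^ (k + m))" for k m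
    unfolding f_def borel_theta_nth tri_add power_add by (simp add: power_mult_distrib power_mult mult_ac)
  have diag: "(\<Sum>k\<in>{..N}. f k (N - k)) = F N" for N
  proof -
    have "fps_nth (a * h) (Suc N) = (\<Sum>k\<le>N. fps_nth a k * fps_nth h (Suc (N - k)))"
      using assms(2) by (simp add: fps_mult_nth atLeast0AtMost Suc_diff_le)
    then show ?thesis
      by (simp add: F_def f_eq borel_theta_nth sum_distrib_right mult.assoc)
  qed
  obtain S where S: "((\<lambda>(k, m). f k m) has_sum S) (UNIV \<times> UNIV)"
    using summ by (auto simp: summable_on_def)
  have rows: "((\<lambda>k. ?A k * eval_fps (borel_theta q h) (of_real p ^ k * \<xi>)) has_sum S) UNIV"
  proof (rule has_sum_SigmaD[OF S])
    show "((\<lambda>m. case (k, m) of (k, m) \<Rightarrow> f k m) has_sum ?A k * eval_fps (borel_theta q h) (of_real p ^ k * \<xi>)) UNIV" for k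
      unfolding f_def case_prod_conv using B_sum[of k]
      by (intro has_sum_cmult_right norm_summable_imp_has_sum) (auto simp: eval_fps_def summable_sums summable_norm_cancel)
  qed
  \<comment> \<open>Regrouping along the diagonals \<open>N = k + m\<close> produces the power
    series of the transform of the product.\<close>
  have "((\<lambda>(N, k). f k (N - k)) has_sum S) (Sigma UNIV (\<lambda>N. {..N}))"
    by (rule has_sum_reindex_bij_witness[where i = "\<lambda>(k, m). (k + m, k)" and j = "\<lambda>(N, k). (k, N - k)", THEN iffD2, OF _ _ _ _ _ _ S])
       auto
  then have "(F has_sum S) UNIV"
    by (rule has_sum_SigmaD) (auto simp: diag[symmetric] intro: has_sum_finite)
  then have "F sums S" by (rule has_sum_imp_sums)
  then have "S = eval_fps (borel_theta q (a * h)) \<xi>"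
    by (simp add: eval_fps_def F_def sums_iff)
  with rows show "((\<lambda>k. ?A k * eval_fps (borel_theta q h) (of_real p ^ k * \<xi>))
     has_sum eval_fps (borel_theta q (a * h)) \<xi>) UNIV" by simp
  show "summable (\<lambda>N. fps_nth (borel_theta q (a * h)) N * \<xi> ^ N)"
    using \<open>F sums S\<close> by (simp add: F_def sums_iff)
qed

text \<open>Shifting the index from \<open>m\<close> to \<open>m + 1\<close> adds \<open>m\<close>
  to the triangular exponent; the resulting \<open>p^m\<close> cancels all but one factor of the
  \<open>q^(m+1)\<close> produced by the dilation.\<close>

lemma borel_theta_X_sigma:
  assumes "fps_nth h 0 = 0"
  shows "borel_theta q (fps_X * fps_sigma_q q h) = fps_const (of_real q) * fps_X * borel_theta q h"
proof (rule fps_ext)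
  fix n
  show "fps_nth (borel_theta q (fps_X * fps_sigma_q q h)) n = fps_nth (fps_const (of_real q) * fps_X * borel_theta q h) n"
  proof (cases n)
    case (Suc m)
    have "q ^ m * p ^ m = 1"
      using q_gt_1 by (simp add: p_eq flip: power_mult_distrib)
    then have "complex_of_real q ^ m * of_real p ^ m = 1"
      by (metis of_real_1 of_real_mult of_real_power)
    then show ?thesis
      unfolding Suc borel_theta_nth tri_Suc fps_sigma_q_def fps_compose_linear power_add
      using assms by (simp add: borel_theta_nth mult.assoc) 
  qed (simp add: borel_theta_nth fps_sigma_q_def fps_compose_linear assms)
qed

lemma X_sigma_funpow:
  assumes "fps_nth f 0 = 0"
  shows "fps_nth (((\<lambda>g. fps_X * fps_sigma_q q g) ^^ m) f) 0 = 0"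
    and "borel_theta q (((\<lambda>g. fps_X * fps_sigma_q q g) ^^ m) f) = (fps_const (of_real q) * fps_X) ^ m * borel_theta q f"
proof (induction m)
  case (Suc m)
  { case 2 then show ?case using Suc by (simp add: borel_theta_X_sigma mult_ac) }
qed (auto simp: assms)

lemma borel_theta_sum: "borel_theta q (sum g A) = (\<Sum>i\<in>A. borel_theta q (g i))"
  by (rule fps_ext) (simp add: borel_theta_nth fps_sum_nth sum_distrib_right)

lemma has_sum_finite_sum:
  fixes f :: "'a \<Rightarrow> 'b \<Rightarrow> complex"
  assumes "finite I" "\<And>i. i \<in> I \<Longrightarrow> (f i has_sum s i) A"
  shows "((\<lambda>x. \<Sum>i\<in>I. f i x) has_sum (\<Sum>i\<in>I. s i)) A"
  using assms by (induction I rule: finite_induct) (auto intro: has_sum_add)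

text \<open>Powers of \<open>x \<sigma>\<close> become powers of \<open>q \<xi>\<close>, and
  multiplication by \<open>a j\<close> spreads them over all dilations. \<open>b k\<close> collects
  everything that multiplies the value at \<open>p^k * \<xi>\<close>; it is a polynomial in
  \<xi>.\<close>

lemma borel_functional_equation:
  fixes a :: "nat \<Rightarrow> complex fps" and n :: nat
  defines "b \<equiv> \<lambda>k \<xi>. (\<Sum>j\<le>n. fps_nth (a j) k * of_real (p ^ (k * (k - 1) div 2)) * \<xi> ^ k * (of_real q * (of_real p ^ k * \<xi>)) ^ (n - j))"
  assumes f0: "fps_nth f 0 = 0" and a: "\<And>j. j \<le> n \<Longrightarrow> fps_conv_radius (a j) > 0"
    and \<xi>: "norm \<xi> < fps_conv_radius (borel_theta q f)"
  shows "((\<lambda>k. b k \<xi> * eval_fps (borel_theta q f) (of_real p ^ k * \<xi>))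
     has_sum eval_fps (borel_theta q (q_diff_op q n a f)) \<xi>) UNIV"
proof -
  let ?X = "\<lambda>m. ((\<lambda>g. fps_X * fps_sigma_q q g) ^^ m) f"
  have radX: "fps_conv_radius ((fps_const (complex_of_real q) * fps_X) ^ m) = \<infinity>" for m
  proof -
    have "fps_conv_radius (fps_const (complex_of_real q) * fps_X) = \<infinity>"
      using fps_conv_radius_cmult_left[of "complex_of_real q" fps_X] q_gt_1 by simp
    then show ?thesis using fps_conv_radius_power[of "fps_const (complex_of_real q) * fps_X" m] by simp
  qed
  have rad: "fps_conv_radius (borel_theta q (?X m)) \<ge> fps_conv_radius (borel_theta q f)" for m
    unfolding X_sigma_funpow(2)[OF f0]
    using fps_conv_radius_mult[of "(fps_const (complex_of_real q) * fps_X) ^ m" "borel_theta q f"] radX[of m] by simp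
  have ev: "eval_fps (borel_theta q (?X m)) z = (of_real q * z) ^ m * eval_fps (borel_theta q f) z"
    if "norm z < fps_conv_radius (borel_theta q f)" for m z
    unfolding X_sigma_funpow(2)[OF f0]
    using that radX[of m] q_gt_1 fps_conv_radius_cmult_left[of "complex_of_real q" fps_X]
    by (simp add: eval_fps_mult eval_fps_power)
  have pk: "ereal (norm (of_real p ^ k * \<xi>)) < fps_conv_radius (borel_theta q f)" for k
  proof -
    have "norm (of_real p ^ k * \<xi>) \<le> norm \<xi>" 
      using p_pos p_less_1 by (simp add: norm_mult norm_power power_le_one mult_left_le_one_le)
    then show ?thesis using \<xi> by (metis ereal_less_eq(3) le_less_trans)
  qed
  have rad2: "ereal (norm \<xi>) < fps_conv_radius (borel_theta q (?X m))" for m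
    using \<xi> rad[of m] by (rule less_le_trans)
  have sums: "((\<lambda>k. fps_nth (a j) k * of_real (p ^ (k * (k - 1) div 2)) * \<xi> ^ k * (of_real q * (of_real p ^ k * \<xi>)) ^ (n - j) 
       * eval_fps (borel_theta q f) (of_real p ^ k * \<xi>))
     has_sum eval_fps (borel_theta q (a j * ?X (n - j))) \<xi>) UNIV" if "j \<le> n" for j
    using eval_borel_theta_mult(1)[OF a[OF that] X_sigma_funpow(1)[OF f0] rad2, of "n - j"]
    unfolding ev[OF pk] by (simp only: mult.assoc)
  have nth_sum: "eval_fps (borel_theta q (q_diff_op q n a f)) \<xi> = (\<Sum>j\<le>n. eval_fps (borel_theta q (a j * ?X (n - j))) \<xi>)"
  proof -
    have "summable (\<lambda>N. fps_nth (borel_theta q (a j * ?X (n - j))) N * \<xi> ^ N)" if "j \<le> n" for j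
      by (rule eval_borel_theta_mult(2)[OF a[OF that] X_sigma_funpow(1)[OF f0] rad2])
    then show ?thesis
      unfolding q_diff_op_def borel_theta_sum eval_fps_def fps_sum_nth sum_distrib_right
      by (intro suminf_sum) auto
  qed
  show ?thesis
    unfolding nth_sum b_def sum_distrib_right by (intro has_sum_finite_sum sums) auto
qed

end

section \<open>Meromorphic continuation of the Borel transform\<close>

text \<open>For bounded \<xi>, all but a fixed finite number of the points
  \<open>p^k * \<xi>\<close> lie in the disc where \<open>h\<close> is bounded, so the tail is
  dominated by a multiple of \<open>B k\<close> and the Weierstrass test applies. It serves both the
  continuation of \<phi> and, with constant \<open>c k\<close>, the series defining \<psi>.\<close>

lemma (in q_base) scaled_series:
  fixes c :: "nat \<Rightarrow> complex \<Rightarrow> complex"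
  assumes "open \<Omega>" "h holomorphic_on \<Omega>" and inv: "\<And>\<xi>. \<xi> \<in> \<Omega> \<Longrightarrow> of_real p * \<xi> \<in> \<Omega>"
    and \<delta>: "\<delta> > 0" "\<And>\<xi>. \<xi> \<in> \<Omega> \<Longrightarrow> norm \<xi> < \<delta> \<Longrightarrow> norm (h \<xi>) \<le> M"
    and c: "\<And>k. c k holomorphic_on UNIV"
      "\<And>R. \<exists>B. summable B \<and> (\<forall>k \<xi>. norm \<xi> \<le> R \<longrightarrow> norm (c k \<xi>) \<le> B k)"
  shows "(\<lambda>\<xi>. \<Sum>k. c k \<xi> * h (of_real p ^ k * \<xi>)) holomorphic_on \<Omega>"
    and "\<And>\<xi>. \<xi> \<in> \<Omega> \<Longrightarrow> summable (\<lambda>k. norm (c k \<xi> * h (of_real p ^ k * \<xi>)))"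
proof -
  have inv_pow: "of_real p ^ k * \<xi> \<in> \<Omega>" if "\<xi> \<in> \<Omega>" for k \<xi>
    using that by (induction k) (auto simp: mult.assoc inv)
  have tail: "\<exists>B K. summable B \<and> (\<forall>k\<ge>K. \<forall>\<xi>\<in>\<Omega>. norm \<xi> \<le> R \<longrightarrow> norm (c k \<xi> * h (of_real p ^ k * \<xi>)) \<le> B k)" for R
  proof -
    obtain B where B: "summable B" "\<And>k \<xi>. norm \<xi> \<le> R \<Longrightarrow> norm (c k \<xi>) \<le> B k" using c(2) by blast
    have "(\<lambda>k. p ^ k * R) \<longlonglongrightarrow> 0 * R"
      using p_pos p_less_1 by (intro tendsto_intros LIMSEQ_power_zero) auto
    then have "\<forall>\<^sub>F k in sequentially. p ^ k * R < \<delta>"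
      using \<delta>(1) by (intro order_tendstoD) auto
    then obtain K where K: "\<And>k. k \<ge> K \<Longrightarrow> p ^ k * R < \<delta>" by (auto simp: eventually_sequentially)
    have "norm (c k \<xi> * h (of_real p ^ k * \<xi>)) \<le> B k * M" if "k \<ge> K" "\<xi> \<in> \<Omega>" "norm \<xi> \<le> R" for k \<xi>
    proof -
      have "p ^ k * norm \<xi> \<le> p ^ k * R" using that p_pos by (intro mult_left_mono) auto
      also have "\<dots> < \<delta>" using K[OF that(1)] .
      finally have "norm (of_real p ^ k * \<xi>) < \<delta>"
        using p_pos by (simp add: norm_mult norm_power)
      then have "norm (h (of_real p ^ k * \<xi>)) \<le> M" using \<delta>(2) inv_pow that(2) by blast
      moreover have "0 \<le> B k" using B(2)[OF that(3), of k] norm_ge_zero order_trans by blast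
      ultimately show ?thesis unfolding norm_mult using B(2)[OF that(3), of k] by (intro mult_mono) auto
    qed
    then show ?thesis using B(1) by (intro exI[of _ "\<lambda>k. B k * M"] exI[of _ K]) (auto intro: summable_mult2)
  qed
  show "summable (\<lambda>k. norm (c k \<xi> * h (of_real p ^ k * \<xi>)))" if "\<xi> \<in> \<Omega>" for \<xi>
  proof -
    obtain B K where BK: "summable B" "\<forall>k\<ge>K. \<forall>\<xi>'\<in>\<Omega>. norm \<xi>' \<le> norm \<xi> \<longrightarrow> norm (c k \<xi>' * h (of_real p ^ k * \<xi>')) \<le> B k"
      using tail by blast
    show ?thesis
    proof (rule summable_comparison_test'[OF BK(1)])
      show "norm (norm (c k \<xi> * h (of_real p ^ k * \<xi>))) \<le> B k" if "k \<ge> K" for k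
        using BK(2)[rule_format, OF that \<open>\<xi> \<in> \<Omega>\<close> order_refl] by simp
    qed
  qed
  show "(\<lambda>\<xi>. \<Sum>k. c k \<xi> * h (of_real p ^ k * \<xi>)) holomorphic_on \<Omega>"
  proof (rule holomorphic_uniform_sequence[OF \<open>open \<Omega>\<close>])
    show "(\<lambda>\<xi>. \<Sum>k<N. c k \<xi> * h (of_real p ^ k * \<xi>)) holomorphic_on \<Omega>" for N
    proof (intro holomorphic_intros)
      show "c k holomorphic_on \<Omega>" for k using c(1) holomorphic_on_subset by blast
      have "h \<circ> (\<lambda>\<xi>. of_real p ^ k * \<xi>) holomorphic_on \<Omega>" for k
        using inv_pow by (intro holomorphic_on_compose_gen[OF _ \<open>h holomorphic_on \<Omega>\<close>] holomorphic_intros) auto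
      then show "(\<lambda>\<xi>. h (of_real p ^ k * \<xi>)) holomorphic_on \<Omega>" for k by (simp add: o_def)
    qed
    fix \<xi> assume "\<xi> \<in> \<Omega>"
    then obtain d where d: "d > 0" "cball \<xi> d \<subseteq> \<Omega>" using \<open>open \<Omega>\<close> open_contains_cball by blast
    obtain B K where BK: "summable B" "\<forall>k\<ge>K. \<forall>\<xi>'\<in>\<Omega>. norm \<xi>' \<le> norm \<xi> + d \<longrightarrow> norm (c k \<xi>' * h (of_real p ^ k * \<xi>')) \<le> B k"
      using tail by blast
    have "norm \<xi>' \<le> norm \<xi> + d" if "\<xi>' \<in> cball \<xi> d" for \<xi>'
      using that norm_triangle_sub[of \<xi>' \<xi>] by (simp add: dist_norm norm_minus_commute)
    then have "\<forall>\<^sub>F k in sequentially. \<forall>\<xi>'\<in>cball \<xi> d. norm (c k \<xi>' * h (of_real p ^ k * \<xi>')) \<le> B k"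
      unfolding eventually_sequentially using BK(2) d(2) by blast
    then have "uniform_limit (cball \<xi> d) (\<lambda>N \<xi>. \<Sum>k<N. c k \<xi> * h (of_real p ^ k * \<xi>))
        (\<lambda>\<xi>. \<Sum>k. c k \<xi> * h (of_real p ^ k * \<xi>)) sequentially"
      by (rule Weierstrass_m_test_ev) (fact BK(1))
    then show "\<exists>d>0. cball \<xi> d \<subseteq> \<Omega> \<and> uniform_limit (cball \<xi> d) (\<lambda>N \<xi>. \<Sum>k<N. c k \<xi> * h (of_real p ^ k * \<xi>))
        (\<lambda>\<xi>. \<Sum>k. c k \<xi> * h (of_real p ^ k * \<xi>)) sequentially"
      using d by blast
  qed
qed

lemma eval_fps_bounded_near_0:
  fixes \<phi> :: "complex fps"
  assumes "fps_conv_radius \<phi> > 0"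
  obtains \<delta> M where "\<delta> > 0" "ereal \<delta> < fps_conv_radius \<phi>" "\<And>\<xi>. norm \<xi> < \<delta> \<Longrightarrow> norm (eval_fps \<phi> \<xi>) \<le> M"
proof -
  obtain r where r: "r > 0" "ereal r < fps_conv_radius \<phi>"
    using assms by (metis ereal_dense2 ereal_less(2) zero_ereal_def)
  have "continuous_on (cball 0 r) (eval_fps \<phi>)"
  proof (rule continuous_on_subset[OF continuous_on_eval_fps])
    show "cball (0::complex) r \<subseteq> eball 0 (fps_conv_radius \<phi>)"
    proof
      fix x :: complex assume "x \<in> cball 0 r"
      then have "ereal (norm x) \<le> ereal r" by simp
      also note r(2)
      finally show "x \<in> eball 0 (fps_conv_radius \<phi>)" by (simp add: in_eball_iff)
    qed
  qed
  then have "bounded (eval_fps \<phi> ` cball 0 r)"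
    by (intro compact_imp_bounded compact_continuous_image) auto
  then obtain M where "\<And>\<xi>. \<xi> \<in> cball 0 r \<Longrightarrow> norm (eval_fps \<phi> \<xi>) \<le> M"
    unfolding bounded_iff by blast
  with r show thesis by (intro that[of r M]) auto
qed

text \<open>The equation expresses \<open>\<phi>\<close> at \<open>\<xi>\<close> by its values at the points \<open>p^k \<xi>\<close> with \<open>k \<ge> 1\<close>, as long as
  \<open>b 0 \<xi> \<noteq> 0\<close>; each use of it enlarges the disc of definition by the factor \<open>1 / p\<close>.\<close>

lemma (in q_base) continuation_by_functional_equation:
  fixes b :: "nat \<Rightarrow> complex \<Rightarrow> complex" and \<phi> :: "complex fps"
  assumes rad: "fps_conv_radius \<phi> > 0"
    and b: "\<And>k. b k holomorphic_on UNIV"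
      "\<And>R. \<exists>B. summable B \<and> (\<forall>k \<xi>. norm \<xi> \<le> R \<longrightarrow> norm (b k \<xi>) \<le> B k)"
    and b0: "b 0 0 \<noteq> 0"
    and G: "G holomorphic_on UNIV"
    and eq: "\<And>\<xi>. norm \<xi> < fps_conv_radius \<phi> \<Longrightarrow>
      ((\<lambda>k. b k \<xi> * eval_fps \<phi> (of_real p ^ k * \<xi>)) has_sum G \<xi>) UNIV"
  obtains Z \<Phi> \<epsilon> where "countable Z" "closed Z" "\<And>\<xi>. \<xi> \<notin> Z \<Longrightarrow> of_real p * \<xi> \<notin> Z" 
    "\<Phi> holomorphic_on - Z" "\<epsilon> > 0" "ereal \<epsilon> < fps_conv_radius \<phi>" "ball 0 \<epsilon> \<inter> Z = {}"
    "\<And>\<xi>. norm \<xi> < \<epsilon> \<Longrightarrow> \<Phi> \<xi> = eval_fps \<phi> \<xi>"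
proof -
  obtain \<delta>1 M where \<delta>1: "\<delta>1 > 0" "ereal \<delta>1 < fps_conv_radius \<phi>" 
    and M: "\<And>\<xi>. norm \<xi> < \<delta>1 \<Longrightarrow> norm (eval_fps \<phi> \<xi>) \<le> M"
    using eval_fps_bounded_near_0[OF rad] by metis
  have cont_b0: "continuous_on UNIV (b 0)" using b(1) by (rule holomorphic_on_imp_continuous_on)
  then have "isCont (b 0) 0" by (simp add: continuous_on_eq_continuous_at)
  then have "\<exists>e>0. \<forall>y. dist 0 y < e \<longrightarrow> b 0 y \<noteq> 0" using b0 by (rule continuous_at_avoid)
  then obtain \<delta>2 where \<delta>2: "\<delta>2 > 0" "\<And>\<xi>. norm \<xi> < \<delta>2 \<Longrightarrow> b 0 \<xi> \<noteq> 0" by auto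
  define \<delta> where "\<delta> = min \<delta>1 \<delta>2"
  have \<delta>: "\<delta> > 0" using \<delta>1 \<delta>2 by (simp add: \<delta>_def)
  have rad_less: "ereal \<delta> < fps_conv_radius \<phi>"
    using \<delta>1(2) unfolding \<delta>_def by (metis ereal_less_eq(3) le_less_trans min.cobounded1)
  have \<delta>_M: "norm (eval_fps \<phi> \<xi>) \<le> M" if "norm \<xi> < \<delta>" for \<xi> using M that by (simp add: \<delta>_def)
  \<comment> \<open>Continuing to \<xi> uses the equation at points \<open>p^k * \<xi>\<close> as
    well; \<open>Z\<close> gathers the points for which one of these uses would divide by
    zero.\<close>
  define Z where "Z = {\<xi>. \<exists>k. b 0 (of_real p ^ k * \<xi>) = 0}"
  have p_inv: "of_real p * \<xi> \<notin> Z" if "\<xi> \<notin> Z" for \<xi>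
  proof
    assume "of_real p * \<xi> \<in> Z"
    then obtain k where "b 0 (of_real p ^ k * (of_real p * \<xi>)) = 0" by (auto simp: Z_def)
    then have "b 0 (of_real p ^ Suc k * \<xi>) = 0" by (simp add: mult_ac)
    then show False using that unfolding Z_def by blast
  qed
  have pk_less: "norm (of_real p ^ k * \<xi>) \<le> norm \<xi>" for k and \<xi> :: complex
    using p_pos p_less_1 by (simp add: norm_mult norm_power power_le_one mult_left_le_one_le)
  have Z_ball: "\<xi> \<notin> Z" if "norm \<xi> < \<delta>" for \<xi>
  proof -
    have "b 0 (of_real p ^ k * \<xi>) \<noteq> 0" for k
      using pk_less[of k \<xi>] that by (intro \<delta>2(2)) (simp add: \<delta>_def)
    then show ?thesis by (simp add: Z_def)
  qed
  \<comment> \<open>In this ball \<open>p^m * \<xi>\<close> already lies in the disc without zeros,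
    so only the finitely many conditions with \<open>k < m\<close> matter. This is why the
    complement of \<open>Z\<close> is open.\<close>
  have Z_local: "ball 0 (\<delta> / p ^ m) - Z = ball 0 (\<delta> / p ^ m) \<inter> (\<Inter>k\<in>{..<m}. {\<xi>. b 0 (of_real p ^ k * \<xi>) \<noteq> 0})" for m
  proof -
    have "\<xi> \<notin> Z" if \<xi>: "norm \<xi> < \<delta> / p ^ m" "\<And>k. k < m \<Longrightarrow> b 0 (of_real p ^ k * \<xi>) \<noteq> 0" for \<xi>
    proof -
      have "norm (of_real p ^ m * \<xi>) < \<delta>"
        using \<xi>(1) p_pos by (simp add: norm_mult norm_power field_simps)
      then have *: "of_real p ^ m * \<xi> \<notin> Z" by (rule Z_ball)
      have "b 0 (of_real p ^ k * \<xi>) \<noteq> 0" for k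
      proof (cases "k < m")
        case False
        then have "of_real p ^ k * \<xi> = of_real p ^ (k - m) * (of_real p ^ m * \<xi>)"
          by (simp flip: power_add mult.assoc)
        moreover have "b 0 (of_real p ^ (k - m) * (of_real p ^ m * \<xi>)) \<noteq> 0"
          using * unfolding Z_def by blast
        ultimately show ?thesis by (simp only: not_False_eq_True)
      qed (use \<xi>(2) in auto)
      then show ?thesis by (simp add: Z_def)
    qed
    then show ?thesis by (auto simp: Z_def)
  qed
  define D where "D = (\<lambda>m. ball 0 (\<delta> / p ^ m) - Z)"
  have D_open: "open (D m)" for m
    unfolding D_def Z_local
    by (intro open_Int open_ball open_INT open_Collect_neq continuous_intros ballI
          continuous_on_compose2[OF cont_b0]) auto
  have D_mono: "D m \<subseteq> D m'" if "m \<le> m'" for m m'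
  proof -
    have "\<delta> / p ^ m \<le> \<delta> / p ^ m'"
      using that p_pos p_less_1 \<delta> by (intro divide_left_mono power_decreasing) auto
    then show ?thesis by (auto simp: D_def)
  qed
  have D_cover: "(\<Union>m. D m) = - Z"
  proof -
    have "\<exists>m. norm \<xi> < \<delta> / p ^ m" for \<xi> :: complex
    proof -
      have "(\<lambda>m. p ^ m * norm \<xi>) \<longlonglongrightarrow> 0 * norm \<xi>"
        using p_pos p_less_1 by (intro tendsto_intros LIMSEQ_power_zero) auto
      then have "\<forall>\<^sub>F m in sequentially. p ^ m * norm \<xi> < \<delta>"
        using \<delta> by (intro order_tendstoD) auto
      then obtain m where "p ^ m * norm \<xi> < \<delta>" by (auto simp: eventually_sequentially)
      then show ?thesis using p_pos by (intro exI[of _ m]) (simp add: field_simps)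
    qed
    then show ?thesis by (auto simp: D_def)
  qed
  have "open (- Z)" unfolding D_cover[symmetric] using D_open by blast
  then have "closed Z" by (simp add: closed_def)
  have "countable Z"
  proof -
    have "countable {\<xi>. b 0 \<xi> = 0}"
    proof (cases "b 0 constant_on UNIV")
      case True
      then have "{\<xi>. b 0 \<xi> = 0} = {}" using b0 by (auto simp: constant_on_def)
      then show ?thesis by simp
    next
      case False
      \<comment> \<open>The whole plane as a countable union of closed sets, a side condition of the
        countability of zeros.\<close>
      have "fsigma (\<Union>((\<lambda>_::nat. UNIV :: complex set) ` UNIV))" by (rule fsigma.intros) simp
      then have "countable {\<xi>\<in>UNIV. b 0 \<xi> = 0}"
        using b(1) False by (intro holomorphic_countable_zeros) auto
      then show ?thesis by simp
    qed
    then have "countable (\<Union>k. (\<lambda>\<xi>. \<xi> / of_real p ^ k) ` {\<xi>. b 0 \<xi> = 0})" by blast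
    moreover have "Z \<subseteq> (\<Union>k. (\<lambda>\<xi>. \<xi> / of_real p ^ k) ` {\<xi>. b 0 \<xi> = 0})"
    proof
      fix \<xi> assume "\<xi> \<in> Z"
      then obtain k where "b 0 (of_real p ^ k * \<xi>) = 0" by (auto simp: Z_def)
      moreover have "\<xi> = (of_real p ^ k * \<xi>) / of_real p ^ k" using p_pos by simp
      ultimately show "\<xi> \<in> (\<Union>k. (\<lambda>\<xi>. \<xi> / of_real p ^ k) ` {\<xi>. b 0 \<xi> = 0})" by blast
    qed
    ultimately show ?thesis using countable_subset by blast
  qed
  \<comment> \<open>\<open>T\<close> solves the equation for the value at \<xi> and evaluates its
    argument only at \<open>p^(k+1) * \<xi>\<close>. If a function is known on \<open>D m\<close>,
    its image under \<open>T\<close> is determined on \<open>D (Suc m)\<close>.\<close>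
  define T where "T = (\<lambda>h \<xi>. (G \<xi> - (\<Sum>k. b (Suc k) \<xi> * h (of_real p ^ Suc k * \<xi>))) / b 0 \<xi>)"
  define h where "h = (\<lambda>m. (T ^^ m) (eval_fps \<phi>))"
  have h_Suc: "h (Suc m) = T (h m)" for m by (simp add: h_def)
  have D_step: "of_real p ^ Suc k * \<xi> \<in> D m" if "\<xi> \<in> D (Suc m)" for \<xi> m k
  proof -
    have "norm (of_real p ^ Suc k * \<xi>) \<le> norm (of_real p * \<xi>)"
      using pk_less[of k "of_real p * \<xi>"] by (simp add: mult_ac)
    also have "\<dots> < \<delta> / p ^ m" using that p_pos by (simp add: D_def norm_mult field_simps)
    finally have "norm (of_real p ^ Suc k * \<xi>) < \<delta> / p ^ m" .
    moreover have "of_real p ^ Suc k * \<xi> \<notin> Z"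
      using that p_inv by (induction k) (auto simp: D_def mult.assoc)
    ultimately show ?thesis by (simp add: D_def)
  qed
  have T_cong: "T g \<xi> = T g' \<xi>" if "\<xi> \<in> D (Suc m)" "\<And>\<zeta>. \<zeta> \<in> D m \<Longrightarrow> g \<zeta> = g' \<zeta>" for g g' \<xi> m
    unfolding T_def using that D_step by simp
  have D_sub: "D m \<subseteq> D (Suc m)" for m by (rule D_mono) simp
  \<comment> \<open>On the initial disc this is the functional equation of the power series;
    afterwards it propagates because \<open>T\<close> looks only at points of the smaller
    domain.\<close>
  have step: "h (Suc m) \<xi> = h m \<xi>" if "\<xi> \<in> D m" for m \<xi>
    using that
  proof (induction m arbitrary: \<xi>)
    case 0
    then have n\<xi>: "norm \<xi> < \<delta>" by (simp add: D_def)
    have r\<xi>: "ereal (norm \<xi>) < fps_conv_radius \<phi>"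
      using n\<xi> rad_less by (metis ereal_less(2) ereal_less_eq(3) le_less_trans less_imp_le)
    have "(\<lambda>k. b k \<xi> * eval_fps \<phi> (of_real p ^ k * \<xi>)) sums G \<xi>"
      using eq[OF r\<xi>] by (rule has_sum_imp_sums)
    then have "(\<lambda>k. b (Suc k) \<xi> * eval_fps \<phi> (of_real p ^ Suc k * \<xi>)) sums (G \<xi> - b 0 \<xi> * eval_fps \<phi> \<xi>)"
      by (subst sums_Suc_iff) simp
    then have "(\<Sum>k. b (Suc k) \<xi> * eval_fps \<phi> (of_real p ^ Suc k * \<xi>)) = G \<xi> - b 0 \<xi> * eval_fps \<phi> \<xi>"
      by (rule sums_unique[symmetric])
    moreover have "b 0 \<xi> \<noteq> 0" using n\<xi> \<delta>2(2) by (simp add: \<delta>_def)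
    ultimately show ?case by (simp add: h_def T_def del: power_Suc)
  next
    case (Suc m)
    then show ?case unfolding h_Suc using T_cong[OF Suc.prems, of "h (Suc m)" "h m"] by (simp add: h_Suc)
  qed
  have stable: "h m' \<xi> = h m \<xi>" if "\<xi> \<in> D m" "m \<le> m'" for m m' \<xi>
    using that(2)
  proof (induction m' rule: dec_induct)
    case (step n)
    then show ?case using \<open>\<And>\<xi> m. \<xi> \<in> D m \<Longrightarrow> h (Suc m) \<xi> = h m \<xi>\<close>[of \<xi> n] D_mono[OF step(1)] that(1) by auto
  qed simp
  have near_0: "h m \<xi> = eval_fps \<phi> \<xi>" if "norm \<xi> < \<delta>" for m \<xi>
    using stable[of \<xi> 0 m] that Z_ball[OF that] by (simp add: D_def h_def)
  have holo: "h m holomorphic_on D m" for m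
  proof (induction m)
    case 0
    have "D 0 \<subseteq> eball 0 (fps_conv_radius \<phi>)"
    proof
      fix x assume "x \<in> D 0"
      then have "ereal (norm x) < ereal \<delta>" by (simp add: D_def)
      also note rad_less
      finally show "x \<in> eball 0 (fps_conv_radius \<phi>)" by (simp add: in_eball_iff)
    qed
    then show ?case by (simp add: h_def holomorphic_on_eval_fps)
  next
    case (Suc m)
    have "(\<lambda>\<xi>. \<Sum>k. b (Suc k) \<xi> * (h m \<circ> (\<lambda>\<xi>. of_real p * \<xi>)) (of_real p ^ k * \<xi>)) holomorphic_on D (Suc m)"
    proof (rule scaled_series(1)[where \<delta> = \<delta> and M = M])
      show "h m \<circ> (\<lambda>\<xi>. of_real p * \<xi>) holomorphic_on D (Suc m)"
        using D_step[of _ m 0] by (intro holomorphic_on_compose_gen[OF _ Suc] holomorphic_intros) auto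
      show "of_real p * \<xi> \<in> D (Suc m)" if "\<xi> \<in> D (Suc m)" for \<xi>
        using D_step[OF that, of 0] D_sub by auto
      show "norm ((h m \<circ> (\<lambda>\<xi>. of_real p * \<xi>)) \<xi>) \<le> M" if "norm \<xi> < \<delta>" for \<xi>
      proof -
        have "norm (of_real p * \<xi>) < \<delta>" using that pk_less[of 1 \<xi>] by simp
        then show ?thesis using near_0[of "of_real p * \<xi>" m] \<delta>_M by simp
      qed
      show "\<exists>B. summable B \<and> (\<forall>k \<xi>. norm \<xi> \<le> R \<longrightarrow> norm (b (Suc k) \<xi>) \<le> B k)" for R
      proof -
        obtain B where "summable B" "\<forall>k \<xi>. norm \<xi> \<le> R \<longrightarrow> norm (b k \<xi>) \<le> B k" using b(2) by blast
        then show ?thesis by (intro exI[of _ "\<lambda>k. B (Suc k)"]) (auto simp: summable_Suc_iff)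
      qed
    qed (use D_open \<delta> b in auto)
    then have "(\<lambda>\<xi>. \<Sum>k. b (Suc k) \<xi> * h m (of_real p ^ Suc k * \<xi>)) holomorphic_on D (Suc m)"
      by (simp add: o_def mult.assoc)
    moreover have "b 0 \<xi> \<noteq> 0" if "\<xi> \<in> D (Suc m)" for \<xi>
    proof
      assume "b 0 \<xi> = 0"
      then have "\<xi> \<in> Z" unfolding Z_def by (auto intro!: exI[of _ 0])
      then show False using that by (simp add: D_def)
    qed
    ultimately show ?case unfolding h_Suc T_def
      by (intro holomorphic_intros holomorphic_on_subset[OF G] holomorphic_on_subset[OF b(1)[of 0]]) auto
  qed
  define \<Phi> where "\<Phi> = (\<lambda>\<xi>. h (LEAST m. \<xi> \<in> D m) \<xi>)"
  have \<Phi>_eq: "\<Phi> \<xi> = h m \<xi>" if "\<xi> \<in> D m" for \<xi> m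
    using stable[of \<xi> "LEAST m. \<xi> \<in> D m" m] LeastI[of "\<lambda>m. \<xi> \<in> D m", OF that] Least_le[of "\<lambda>m. \<xi> \<in> D m", OF that]
    by (simp add: \<Phi>_def)
  show thesis
  proof
    show "countable Z" "closed Z" by fact+
    show "of_real p * \<xi> \<notin> Z" if "\<xi> \<notin> Z" for \<xi> using p_inv[OF that] .
    have "\<Phi> holomorphic_on (\<Union>m. D m)"
    proof (rule holomorphic_on_UN_open)
      show "\<Phi> holomorphic_on D m" for m
        using holo[of m] by (rule holomorphic_transform) (simp add: \<Phi>_eq)
    qed (rule D_open)
    then show "\<Phi> holomorphic_on - Z" by (simp only: D_cover)
    show "ball 0 \<delta> \<inter> Z = {}" using Z_ball by auto
    show "\<Phi> \<xi> = eval_fps \<phi> \<xi>" if "norm \<xi> < \<delta>" for \<xi>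
    proof -
      have "\<xi> \<in> D 0" using that Z_ball by (simp add: D_def)
      then show ?thesis using \<Phi>_eq[of \<xi> 0] by (simp add: h_def)
    qed
  qed (fact \<delta> rad_less)+
qed

context q_pair
begin

text \<open>The continuation starts from a convergent germ. This convergence is an assumption here
  and is supplied by a nonsingular spiral, since membership in \<open>H_spiral\<close> contains
  it.\<close>

lemma borel_theta_continuation:
  assumes "generic_q_gevrey q f" "fps_nth f 0 = 0" "fps_conv_radius (borel_theta q f) > 0"
  obtains Z \<Phi> \<epsilon> where "countable Z" "closed Z" "\<And>\<xi>. \<xi> \<notin> Z \<Longrightarrow> of_real p * \<xi> \<notin> Z" 
    "\<Phi> holomorphic_on - Z" "\<epsilon> > 0" "ereal \<epsilon> < fps_conv_radius (borel_theta q f)" "ball 0 \<epsilon> \<inter> Z = {}"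
    "\<And>\<xi>. norm \<xi> < \<epsilon> \<Longrightarrow> \<Phi> \<xi> = eval_fps (borel_theta q f) \<xi>"
proof -
  obtain n a where a: "\<And>j. j \<le> n \<Longrightarrow> fps_conv_radius (a j) > 0" "fps_nth (a 0) 0 * fps_nth (a n) 0 \<noteq> 0"
    "fps_conv_radius (q_diff_op q n a f) > 0"
    using assms(1) by (auto simp: generic_q_gevrey_def)
  define b where "b = (\<lambda>k \<xi>. (\<Sum>j\<le>n. fps_nth (a j) k * of_real (p ^ (k * (k - 1) div 2)) * \<xi> ^ k * (of_real q * (of_real p ^ k * \<xi>)) ^ (n - j)))"
  define G where "G = eval_fps (borel_theta q (q_diff_op q n a f))"
  \<comment> \<open>At \<xi> \<open>= 0\<close> the power with exponent \<open>n - j\<close>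
    vanishes unless \<open>j = n\<close>, where it is \<open>0^0 = 1\<close>. So
    \<open>b 0 0\<close> is the constant term of \<open>a n\<close>.\<close>
  have "b 0 0 = (\<Sum>j\<in>{n}. fps_nth (a j) 0)"
    unfolding b_def by (intro sum.mono_neutral_cong_right) (auto simp: power_0_left)
  then have b00: "b 0 0 \<noteq> 0" using a(2) by auto
  have b_holo: "b k holomorphic_on UNIV" for k
    unfolding b_def by (intro holomorphic_intros)
  have G_holo: "G holomorphic_on UNIV"
    unfolding G_def using fps_conv_radius_borel_theta[OF a(3)] by (intro holomorphic_on_eval_fps) auto
  have b_bound: "\<exists>B. summable B \<and> (\<forall>k \<xi>. norm \<xi> \<le> R \<longrightarrow> norm (b k \<xi>) \<le> B k)" for R
  proof (intro exI conjI allI impI)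
    let ?B = "\<lambda>k. \<Sum>j\<le>n. norm (fps_nth (a j) k) * p ^ (k * (k - 1) div 2) * \<bar>R\<bar> ^ k * (q * \<bar>R\<bar>) ^ (n - j)"
    show "summable ?B"
      using a(1) by (intro summable_sum summable_mult2 summable_fps_qcoeff) auto
    show "norm (b k \<xi>) \<le> ?B k" if "norm \<xi> \<le> R" for k \<xi>
      unfolding b_def
    proof (rule order_trans[OF norm_sum], rule sum_mono)
      fix j
      have "p ^ k * norm \<xi> \<le> \<bar>R\<bar>"
        using that p_pos p_less_1 mult_left_le_one_le[of "norm \<xi>" "p ^ k"] by (simp add: power_le_one)
      then show "norm (fps_nth (a j) k * of_real (p ^ (k * (k - 1) div 2)) * \<xi> ^ k * (of_real q * (of_real p ^ k * \<xi>)) ^ (n - j))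
          \<le> norm (fps_nth (a j) k) * p ^ (k * (k - 1) div 2) * \<bar>R\<bar> ^ k * (q * \<bar>R\<bar>) ^ (n - j)"
        using that p_pos q_gt_1 unfolding norm_mult norm_power norm_of_real
        by (intro mult_mono power_mono) auto
    qed
  qed
  have eq: "((\<lambda>k. b k \<xi> * eval_fps (borel_theta q f) (of_real p ^ k * \<xi>)) has_sum G \<xi>) UNIV"
    if "norm \<xi> < fps_conv_radius (borel_theta q f)" for \<xi>
    unfolding b_def G_def by (rule borel_functional_equation[OF assms(2) a(1) that])
  show thesis
    by (rule continuation_by_functional_equation[OF assms(3) b_holo b_bound b00 G_holo eq]) (assumption | rule that)+
qed

end

section \<open>Continued values along spirals\<close>

text \<open>Removing the countable closed set \<open>Z\<close> leaves the domain open and connected,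
  and the spiral accumulates at 0, so the domain meets the disc where both functions are given by
  the power series. The identity theorem does the rest.\<close>

lemma spiral_continuation_eq:
  assumes cont: "spiral_continuation q \<xi> \<phi> \<Omega> g" and "\<xi> \<noteq> 0" "q > 1"
    and Z: "countable Z" "closed Z" "\<Phi> holomorphic_on - Z" "\<epsilon> > 0" "ball 0 \<epsilon> \<inter> Z = {}"
    and \<Phi>: "\<And>\<zeta>. norm \<zeta> < \<epsilon> \<Longrightarrow> \<Phi> \<zeta> = eval_fps \<phi> \<zeta>"
    and \<zeta>: "\<zeta> \<in> \<Omega>" "\<zeta> \<notin> Z"
  shows "g \<zeta> = \<Phi> \<zeta>"
proof -
  have \<Omega>: "open \<Omega>" "connected \<Omega>" "g holomorphic_on \<Omega>"
    using cont by (auto simp: spiral_continuation_def)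
  obtain r where r: "r > 0" "(\<Union>m::int. ball (\<xi> * of_real (q powi m)) (r * q powi m)) \<subseteq> \<Omega>"
    using cont unfolding spiral_continuation_def by blast
  obtain e where e: "e > 0" "\<And>x. x \<in> \<Omega> \<Longrightarrow> x \<noteq> 0 \<Longrightarrow> dist x 0 < e \<Longrightarrow> g x = eval_fps \<phi> x"
    using cont unfolding spiral_continuation_def eventually_at by blast
  \<comment> \<open>The point 0 is left out because agreement \<open>at 0 within\<close> the domain
    says nothing about the value at 0 itself.\<close>
  define S where "S = \<Omega> \<inter> ball 0 (min e \<epsilon>) - {0}"
  have "(\<lambda>n. norm \<xi> * (1 / q) ^ n) \<longlonglongrightarrow> norm \<xi> * 0"
    using \<open>q > 1\<close> by (intro tendsto_intros LIMSEQ_power_zero) auto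
  then have "\<forall>\<^sub>F n in sequentially. norm \<xi> * (1 / q) ^ n < min e \<epsilon>"
    using e(1) \<open>\<epsilon> > 0\<close> by (intro order_tendstoD) auto
  then obtain n where n: "norm \<xi> * (1 / q) ^ n < min e \<epsilon>" by (auto simp: eventually_sequentially)
  have "\<xi> * of_real (q powi (- int n)) \<in> ball (\<xi> * of_real (q powi (- int n))) (r * q powi (- int n))"
    using r(1) \<open>q > 1\<close> by simp
  then have "\<xi> * of_real (q powi (- int n)) \<in> \<Omega>" using r(2) by blast
  moreover have "norm (\<xi> * of_real (q powi (- int n))) < min e \<epsilon>"
    using n \<open>q > 1\<close> by (simp add: norm_mult norm_power norm_inverse power_int_minus power_divide divide_inverse power_inverse)
  ultimately have "\<xi> * of_real (q powi (- int n)) \<in> S"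
    using \<open>\<xi> \<noteq> 0\<close> \<open>q > 1\<close> unfolding S_def by simp
  then have "S \<noteq> {}" by blast
  show ?thesis
  proof (rule analytic_continuation_open[where s = S and s' = "\<Omega> - Z" and f = g and g = \<Phi> and z = \<zeta>])
    show "open S" "open (\<Omega> - Z)" using \<Omega>(1) Z(2) by (auto simp: S_def open_Diff)
    show "S \<noteq> {}" by fact
    show "connected (\<Omega> - Z)" using \<Omega> Z(1) by (intro connected_open_diff_countable) auto
    show "S \<subseteq> \<Omega> - Z" using Z(5) by (auto simp: S_def)
    show "g holomorphic_on \<Omega> - Z" using \<Omega>(3) by (rule holomorphic_on_subset) auto
    show "\<Phi> holomorphic_on \<Omega> - Z" using Z(3) by (rule holomorphic_on_subset) auto
    show "\<zeta> \<in> \<Omega> - Z" using \<zeta> by simp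
    fix z assume "z \<in> S"
    then show "g z = \<Phi> z" using e(2)[of z] \<Phi>[of z] by (simp add: S_def)
  qed
qed

lemma spiral_continuation_center:
  assumes "spiral_continuation q \<xi> \<phi> \<Omega> g"
  shows "\<xi> \<in> \<Omega>"
proof -
  obtain r where r: "r > 0" "(\<Union>m::int. ball (\<xi> * of_real (q powi m)) (r * q powi m)) \<subseteq> \<Omega>"
    using assms unfolding spiral_continuation_def by blast
  have "\<xi> \<in> ball (\<xi> * of_real (q powi 0)) (r * q powi 0)" using r(1) by simp
  then show ?thesis using r(2) by blast
qed

text \<open>The point may belong to \<open>Z\<close>, where the comparison with \<Phi> is silent.
  But two continuations can differ only on \<open>Z\<close>, the set where they differ is open, and
  a nonempty open set is uncountable.\<close>

lemma continued_value_eq: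
  assumes cont: "spiral_continuation q \<xi> \<phi> \<Omega> g" and "\<xi> \<noteq> 0" "q > 1"
    and Z: "countable Z" "closed Z" "\<Phi> holomorphic_on - Z" "\<epsilon> > 0" "ball 0 \<epsilon> \<inter> Z = {}"
    and \<Phi>: "\<And>\<zeta>. norm \<zeta> < \<epsilon> \<Longrightarrow> \<Phi> \<zeta> = eval_fps \<phi> \<zeta>"
  shows "continued_value q \<phi> \<xi> = g \<xi>"
  unfolding continued_value_def
proof (rule the_equality)
  show "\<exists>\<Omega> g'. spiral_continuation q \<xi> \<phi> \<Omega> g' \<and> g \<xi> = g' \<xi>" using cont by blast
  fix w assume "\<exists>\<Omega> g'. spiral_continuation q \<xi> \<phi> \<Omega> g' \<and> w = g' \<xi>"
  then obtain \<Omega>' g' where cont': "spiral_continuation q \<xi> \<phi> \<Omega>' g'" and w: "w = g' \<xi>" by blast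
  have op: "open \<Omega>" "open \<Omega>'" and holo: "g holomorphic_on \<Omega>" "g' holomorphic_on \<Omega>'"
    using cont cont' by (auto simp: spiral_continuation_def)
  let ?S = "\<Omega> \<inter> \<Omega>'"
  have "continuous_on ?S (\<lambda>x. g x - g' x)"
    using holo by (intro continuous_intros holomorphic_on_imp_continuous_on) (auto intro: holomorphic_on_subset)
  then have "open ((\<lambda>x. g x - g' x) -` (- {0}) \<inter> ?S)"
    using op by (subst (asm) continuous_on_open_vimage) auto
  moreover have "(\<lambda>x. g x - g' x) -` (- {0}) \<inter> ?S \<subseteq> Z"
    using spiral_continuation_eq[OF cont assms(2,3) Z \<Phi>] spiral_continuation_eq[OF cont' assms(2,3) Z \<Phi>] by force
  ultimately have empty: "(\<lambda>x. g x - g' x) -` (- {0}) \<inter> ?S = {}"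
    using Z(1) countable_subset uncountable_ball open_contains_ball by (metis ex_in_conv)
  show "w = g \<xi>"
  proof (rule ccontr)
    assume "w \<noteq> g \<xi>"
    then have "\<xi> \<in> (\<lambda>x. g x - g' x) -` (- {0}) \<inter> ?S"
      using spiral_continuation_center[OF cont] spiral_continuation_center[OF cont'] w by simp
    then show False using empty by blast
  qed
qed

section \<open>Nonsingular points and the domain of the continued transform\<close>

locale q_borel = q_pair +
  fixes f :: "complex fps" and Z :: "complex set" and \<Phi> :: "complex \<Rightarrow> complex" and \<epsilon> :: real
  assumes Z: "countable Z" "closed Z" "\<Phi> holomorphic_on - Z" "\<epsilon> > 0" "ball 0 \<epsilon> \<inter> Z = {}"
    and Z_inv: "\<And>\<xi>. \<xi> \<notin> Z \<Longrightarrow> of_real p * \<xi> \<notin> Z"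
    and \<epsilon>_rad: "ereal \<epsilon> < fps_conv_radius (borel_theta q f)"
    and \<Phi>: "\<And>\<xi>. norm \<xi> < \<epsilon> \<Longrightarrow> \<Phi> \<xi> = eval_fps (borel_theta q f) \<xi>"
begin

definition nonsingular :: "complex set" where
  "nonsingular = {\<xi>. \<xi> \<noteq> 0 \<and> borel_theta q f \<in> H_spiral q \<xi>}"

definition cont_phi :: "complex \<Rightarrow> complex" where
  "cont_phi = continued_value q (borel_theta q f)"

text \<open>The discs around a spiral scale with it, so a point \<zeta> in one of them has its own
  system of smaller discs in the same domain. Hence one pair of domain and function serves all
  spirals near the given one. The bound \<open>r \<le> norm \<xi>\<close> keeps 0 out of the
  discs.\<close>

lemma nonsingular_witness:
  assumes "\<xi> \<in> nonsingular"
  obtains \<Omega> g r where "spiral_continuation q \<xi> (borel_theta q f) \<Omega> g" "q_exp_growth q \<Omega> g"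
    "0 < r" "r \<le> norm \<xi>" "\<And>m::int. ball (\<xi> * of_real (q powi m)) (r * q powi m) \<subseteq> \<Omega>"
    "\<And>m \<zeta>. \<zeta> \<in> ball (\<xi> * of_real (q powi m)) (r * q powi m) \<Longrightarrow> \<zeta> \<in> nonsingular \<and> cont_phi \<zeta> = g \<zeta>"
proof -
  obtain \<Omega> g where g: "spiral_continuation q \<xi> (borel_theta q f) \<Omega> g" "q_exp_growth q \<Omega> g"
    and rad: "fps_conv_radius (borel_theta q f) > 0"
    using assms unfolding nonsingular_def H_spiral_def by blast
  obtain r0 where r0: "r0 > 0" "(\<Union>m::int. ball (\<xi> * of_real (q powi m)) (r0 * q powi m)) \<subseteq> \<Omega>"
    using g(1) unfolding spiral_continuation_def by blast
  define r where "r = min r0 (norm \<xi>)"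
  have r: "0 < r" "r \<le> norm \<xi>" using r0(1) assms by (auto simp: r_def nonsingular_def)
  have qm: "q powi m > 0" for m using q_gt_1 by simp
  have sub: "ball (\<xi> * of_real (q powi m)) (r * q powi m) \<subseteq> \<Omega>" for m
  proof -
    have "r * q powi m \<le> r0 * q powi m" using qm[of m] by (intro mult_right_mono) (auto simp: r_def)
    then have "ball (\<xi> * of_real (q powi m)) (r * q powi m) \<subseteq> ball (\<xi> * of_real (q powi m)) (r0 * q powi m)" by auto
    then show ?thesis using r0(2) by blast
  qed
  have "\<zeta> \<in> nonsingular \<and> cont_phi \<zeta> = g \<zeta>" if \<zeta>: "\<zeta> \<in> ball (\<xi> * of_real (q powi m)) (r * q powi m)" for m \<zeta>
  proof -
    have "\<zeta> \<noteq> 0"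
    proof
      assume "\<zeta> = 0"
      then have "norm \<xi> * q powi m < r * q powi m" using \<zeta> q_gt_1 by (simp add: norm_mult norm_power_int)
      then show False using r(2) qm[of m] by simp
    qed
    define r' where "r' = r * q powi m - dist (\<xi> * of_real (q powi m)) \<zeta>"
    have "r' > 0" using \<zeta> by (simp add: r'_def)
    moreover have "ball (\<zeta> * of_real (q powi k)) (r' * q powi k) \<subseteq> \<Omega>" for k
    proof
      fix w assume w: "w \<in> ball (\<zeta> * of_real (q powi k)) (r' * q powi k)"
      have mk: "q powi (m + k) = q powi m * q powi k" using q_gt_1 by (simp add: power_int_add)
      have "dist (\<xi> * of_real (q powi (m + k))) (\<zeta> * of_real (q powi k)) = dist (\<xi> * of_real (q powi m)) \<zeta> * q powi k"
      proof -
        have "\<xi> * of_real (q powi (m + k)) - \<zeta> * of_real (q powi k) = (\<xi> * of_real (q powi m) - \<zeta>) * of_real (q powi k)"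
          unfolding mk by (simp add: algebra_simps)
        then show ?thesis using q_gt_1 by (simp add: dist_norm norm_mult norm_power_int)
      qed
      then have "dist (\<xi> * of_real (q powi (m + k))) w < dist (\<xi> * of_real (q powi m)) \<zeta> * q powi k + r' * q powi k"
        using w dist_triangle[of "\<xi> * of_real (q powi (m + k))" w "\<zeta> * of_real (q powi k)"] by simp
      also have "\<dots> = r * q powi (m + k)" unfolding mk r'_def by (simp add: algebra_simps)
      finally show "w \<in> \<Omega>" using sub[of "m + k"] by auto
    qed
    ultimately have cont: "spiral_continuation q \<zeta> (borel_theta q f) \<Omega> g"
      using g(1) unfolding spiral_continuation_def by blast
    have "cont_phi \<zeta> = g \<zeta>" unfolding cont_phi_def
      using \<open>\<zeta> \<noteq> 0\<close> by (intro continued_value_eq[OF cont _ q_gt_1 Z]) (use \<Phi> in auto)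
    moreover have "\<zeta> \<in> nonsingular" using cont g(2) rad \<open>\<zeta> \<noteq> 0\<close> unfolding nonsingular_def H_spiral_def by blast
    ultimately show ?thesis by blast
  qed
  with g r sub show thesis using that by blast
qed

lemma nonsingular_nonzero: "\<xi> \<in> nonsingular \<Longrightarrow> \<xi> \<noteq> 0" by (simp add: nonsingular_def)

lemma nonsingular_scale: "\<xi> \<in> nonsingular \<Longrightarrow> of_real (q powi m) * \<xi> \<in> nonsingular"
proof (erule nonsingular_witness)
  fix r :: real and g and \<Omega> :: "complex set" assume "0 < r"
    and *: "\<And>m \<zeta>. \<zeta> \<in> ball (\<xi> * of_real (q powi m)) (r * q powi m) \<Longrightarrow> \<zeta> \<in> nonsingular \<and> cont_phi \<zeta> = g \<zeta>"
  then have "\<xi> * of_real (q powi m) \<in> ball (\<xi> * of_real (q powi m)) (r * q powi m)" using q_gt_1 by simp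
  then show ?thesis using * by (metis mult.commute)
qed

lemma nonsingular_scale_p: "\<xi> \<in> nonsingular \<Longrightarrow> of_real p ^ k * \<xi> \<in> nonsingular"
  using nonsingular_scale[of \<xi> "- int k"] by (simp add: p_eq power_int_minus power_divide divide_inverse power_inverse)

lemma nonsingular_nbhd:
  assumes "\<xi> \<in> nonsingular"
  obtains r where "r > 0" "ball \<xi> r \<subseteq> nonsingular" "cont_phi holomorphic_on ball \<xi> r"
    "\<And>m::int. ball (\<xi> * of_real (q powi m)) (r * q powi m) \<subseteq> nonsingular"
proof -
  obtain \<Omega> g r where w: "spiral_continuation q \<xi> (borel_theta q f) \<Omega> g" 
    "0 < r" "\<And>m::int. ball (\<xi> * of_real (q powi m)) (r * q powi m) \<subseteq> \<Omega>"
    "\<And>m \<zeta>. \<zeta> \<in> ball (\<xi> * of_real (q powi m)) (r * q powi m) \<Longrightarrow> \<zeta> \<in> nonsingular \<and> cont_phi \<zeta> = g \<zeta>"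
    using nonsingular_witness[OF assms] by metis
  have "ball \<xi> r \<subseteq> \<Omega>" using w(3)[of 0] by simp
  then have "g holomorphic_on ball \<xi> r" using w(1) unfolding spiral_continuation_def by (meson holomorphic_on_subset)
  then have "cont_phi holomorphic_on ball \<xi> r"
    by (rule holomorphic_transform) (use w(4)[of _ 0] in auto)
  moreover have "ball \<xi> r \<subseteq> nonsingular" using w(4)[of _ 0] by auto
  ultimately show thesis using w(2,4) that by blast
qed

lemma nonsingular_open: "open nonsingular"
  unfolding open_contains_ball using nonsingular_nbhd by metis

lemma cont_phi_holomorphic: "cont_phi holomorphic_on nonsingular"
  unfolding holomorphic_on_open[OF nonsingular_open]
proof
  fix \<xi> assume "\<xi> \<in> nonsingular"
  then obtain r where "r > 0" "cont_phi holomorphic_on ball \<xi> r" using nonsingular_nbhd by metis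
  then show "\<exists>f'. (cont_phi has_field_derivative f') (at \<xi>)" by (simp add: holomorphic_on_open)
qed

lemma cont_phi_eq_\<Phi>:
  assumes "\<xi> \<in> nonsingular" "\<xi> \<notin> Z"
  shows "cont_phi \<xi> = \<Phi> \<xi>"
proof -
  obtain \<Omega> g r where w: "spiral_continuation q \<xi> (borel_theta q f) \<Omega> g" 
    "0 < r" "\<And>m \<zeta>. \<zeta> \<in> ball (\<xi> * of_real (q powi m)) (r * q powi m) \<Longrightarrow> \<zeta> \<in> nonsingular \<and> cont_phi \<zeta> = g \<zeta>"
    using nonsingular_witness[OF assms(1)] by metis
  have "cont_phi \<xi> = g \<xi>" using w(3)[of \<xi> 0] w(2) by simp
  also have "\<dots> = \<Phi> \<xi>"
    using spiral_continuation_eq[OF w(1) _ q_gt_1 Z \<Phi>] spiral_continuation_center[OF w(1)] assms nonsingular_nonzero by blast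
  finally show ?thesis .
qed

text \<open>Nonsingular points may lie in \<open>Z\<close>, and points off \<open>Z\<close> may lie
  on singular spirals. Gluing both descriptions gives an open connected domain that contains a disc
  around 0 and is stable under multiplication by \<open>p\<close>, as the continuation of \<psi>
  requires.\<close>

definition ext_phi :: "complex \<Rightarrow> complex" where
  "ext_phi \<xi> = (if \<xi> \<in> nonsingular then cont_phi \<xi> else \<Phi> \<xi>)"

definition ext_dom :: "complex set" where "ext_dom = nonsingular \<union> - Z"

lemma ext_dom_open: "open ext_dom"
  using nonsingular_open Z(2) by (auto simp: ext_dom_def)

lemma ext_phi_holomorphic: "ext_phi holomorphic_on ext_dom"
  unfolding ext_dom_def
proof (rule holomorphic_on_Un)
  show "ext_phi holomorphic_on nonsingular" using cont_phi_holomorphic by (rule holomorphic_transform) (simp add: ext_phi_def)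
  show "ext_phi holomorphic_on - Z" using Z(3) by (rule holomorphic_transform) (simp add: ext_phi_def cont_phi_eq_\<Phi>)
qed (use nonsingular_open Z(2) in auto)

lemma ext_dom_inv: "\<xi> \<in> ext_dom \<Longrightarrow> of_real p * \<xi> \<in> ext_dom"
  using nonsingular_scale_p[of \<xi> 1] Z_inv[of \<xi>] by (auto simp: ext_dom_def)

lemma closure_compl_Z: "closure (- Z) = UNIV"
proof -
  have "interior Z = {}"
  proof (rule ccontr)
    assume "interior Z \<noteq> {}"
    then obtain x e where "e > 0" "ball x e \<subseteq> Z" by (auto simp: mem_interior)
    then show False using Z(1) countable_subset uncountable_ball by blast
  qed
  then show ?thesis by (simp add: closure_complement)
qed

text \<open>The complement of a countable set is connected and dense, and a set between a connected
  set and its closure is connected.\<close>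

lemma ext_dom_connected: "connected ext_dom"
proof (rule connected_intermediate_closure)
  show "connected (- Z)"
    using connected_open_diff_countable[OF _ open_UNIV connected_UNIV Z(1)] by (simp add: Compl_eq_Diff_UNIV)
qed (auto simp: ext_dom_def closure_compl_Z)

lemma ext_phi_near_0: "norm \<xi> < \<epsilon> \<Longrightarrow> ext_phi \<xi> = eval_fps (borel_theta q f) \<xi>"
  using \<Phi>[of \<xi>] cont_phi_eq_\<Phi>[of \<xi>] Z(5) by (force simp: ext_phi_def)

lemma ext_dom_near_0: "norm \<xi> < \<epsilon> \<Longrightarrow> \<xi> \<in> ext_dom"
  using Z(5) by (auto simp: ext_dom_def)

section \<open>The second Borel transform as a series of dilates of the first\<close>

definition psi_coeff :: "nat \<Rightarrow> complex" where
  "psi_coeff k = of_real ((- 1) ^ k * qcoeff p k * p ^ k / \<kappa>)"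

lemma psi_coeff_summable: "summable (\<lambda>k. norm (psi_coeff k))"
proof -
  have "norm (psi_coeff k) = (qcoeff p k * p ^ k) * (1 / \<bar>\<kappa>\<bar>)" for k
    unfolding psi_coeff_def norm_of_real using qcoeff_pos[of k] p_pos by (simp add: abs_mult power_abs)
  then show ?thesis using summable_qcoeff[of p] p_pos by (auto intro!: summable_mult2 summable_divide)
qed

text \<open>\<open>psi_coeff\<close> consists of the coefficients of
  \<open>E (- p w) / \<kappa>\<close>. At \<open>w = p^n\<close> this is
  \<open>1 / qpoch p n\<close>, the quotient of the coefficients of the two transforms after scaling
  by \<open>1 - p\<close>.\<close>

lemma psi_coeff_powers_sums: "(\<lambda>k. psi_coeff k * of_real p ^ (k * n)) sums of_real (1 / qpoch p n)"
proof -
  have "(\<lambda>k. of_real (of_real (qcoeff p k) * (- (p ^ Suc n)) ^ k) / of_real \<kappa> :: complex) sums (of_real (qE p (- (p ^ Suc n))) / of_real \<kappa>)"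
    by (intro sums_divide sums_of_real qE_sums)
  also have "(\<lambda>k. of_real (of_real (qcoeff p k) * (- (p ^ Suc n)) ^ k) / of_real \<kappa> :: complex) = (\<lambda>k. psi_coeff k * of_real p ^ (k * n))"
  proof
    fix k
    have "(- (p ^ Suc n)) ^ k = (- 1) ^ k * (p ^ k * p ^ (k * n))"
      by (simp add: power_minus[of "p * p ^ n"] power_mult_distrib power_mult power_commutes flip: power_mult) (simp add: mult.commute)
    then show "of_real (of_real (qcoeff p k) * (- (p ^ Suc n)) ^ k) / of_real \<kappa> = psi_coeff k * of_real p ^ (k * n)"
      by (simp add: psi_coeff_def)
  qed
  finally show ?thesis using \<kappa>_nonzero unfolding qE_minus_pow_Suc by simp
qed

text \<open>The argument is scaled: \<open>cont_psi \<xi>\<close> is the value of the other Borel transform at \<open>\<xi> / (1 - p)\<close>.\<close>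

definition cont_psi :: "complex \<Rightarrow> complex" where
  "cont_psi \<xi> = (\<Sum>k. psi_coeff k * ext_phi (of_real p ^ k * \<xi>))"

lemma cont_psi_holomorphic: "cont_psi holomorphic_on ext_dom"
  and cont_psi_summable: "\<xi> \<in> ext_dom \<Longrightarrow> summable (\<lambda>k. norm (psi_coeff k * ext_phi (of_real p ^ k * \<xi>)))"
proof -
  have "fps_conv_radius (borel_theta q f) > 0"
    using \<epsilon>_rad Z(4) by (metis ereal_less(2) less_trans)
  then obtain \<delta> M where \<delta>: "\<delta> > 0" "\<And>\<xi>. norm \<xi> < \<delta> \<Longrightarrow> norm (eval_fps (borel_theta q f) \<xi>) \<le> M"
    using eval_fps_bounded_near_0 by metis
  have near: "norm (ext_phi \<xi>) \<le> M" if "norm \<xi> < min \<delta> \<epsilon>" for \<xi>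
    using that ext_phi_near_0[of \<xi>] \<delta>(2)[of \<xi>] by simp
  have psi_coeff: "\<exists>B. summable B \<and> (\<forall>k \<xi>. norm (\<xi>::complex) \<le> R \<longrightarrow> norm (psi_coeff k) \<le> B k)" for R
    using psi_coeff_summable by (intro exI[of _ "\<lambda>k. norm (psi_coeff k)"]) auto
  note * = scaled_series[where c = "\<lambda>k \<xi>. psi_coeff k" and \<delta> = "min \<delta> \<epsilon>" and M = M, OF ext_dom_open ext_phi_holomorphic ext_dom_inv _ near _ psi_coeff]
  show "cont_psi holomorphic_on ext_dom" unfolding cont_psi_def using \<delta>(1) Z(4) by (intro *(1)) auto
  show "summable (\<lambda>k. norm (psi_coeff k * ext_phi (of_real p ^ k * \<xi>)))" if "\<xi> \<in> ext_dom"
    using \<delta>(1) Z(4) that by (intro *(2)) auto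
qed

text \<open>Expanding \<phi> at every \<open>p^k * \<xi>\<close> and summing over \<open>k\<close>
  first multiplies its coefficient of index \<open>n\<close> by \<open>1 / qpoch p n\<close>. This
  identifies the germ of the series with the second transform.\<close>

lemma cont_psi_near_0:
  assumes "norm \<xi> < \<epsilon>"
  shows "cont_psi \<xi> = eval_fps (borel_e q f) (\<xi> / of_real (1 - p))"
proof -
  let ?\<phi> = "fps_nth (borel_theta q f)"
  define F where "F = (\<lambda>k n. psi_coeff k * (?\<phi> n * (of_real p ^ k * \<xi>) ^ n))"
  have pk: "norm (of_real p ^ k * \<xi>) \<le> norm \<xi>" for k
    using p_pos p_less_1 by (simp add: norm_mult norm_power power_le_one mult_left_le_one_le)
  have rad: "ereal (norm (of_real p ^ k * \<xi>)) < fps_conv_radius (borel_theta q f)" for k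
  proof -
    have "ereal (norm (of_real p ^ k * \<xi>)) < ereal \<epsilon>" using pk[of k] assms by simp
    also note \<epsilon>_rad
    finally show ?thesis .
  qed
  have summ: "(\<lambda>(k, n). F k n) summable_on UNIV \<times> UNIV"
  proof (rule abs_summable_on_TimesI)
    show "((\<lambda>n. norm (F k n)) has_sum norm (psi_coeff k) * (\<Sum>n. norm (?\<phi> n * (of_real p ^ k * \<xi>) ^ n))) UNIV" for k
      unfolding F_def norm_mult[of "psi_coeff k"] using norm_summable_fps[OF rad[of k]]
      by (intro has_sum_cmult_right norm_summable_imp_has_sum) (auto simp: summable_sums)
    show "(\<lambda>k. norm (psi_coeff k) * (\<Sum>n. norm (?\<phi> n * (of_real p ^ k * \<xi>) ^ n))) summable_on UNIV"
    proof (rule norm_summable_imp_summable_on, rule summable_comparison_test'[where N = 0])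
      let ?S = "\<lambda>k. \<Sum>n. norm (?\<phi> n * (of_real p ^ k * \<xi>) ^ n)"
      show "summable (\<lambda>k. norm (psi_coeff k) * ?S 0)"
        using psi_coeff_summable by (rule summable_mult2)
      fix k
      have "?S k \<le> ?S 0"
        using norm_summable_fps[OF rad[of k]] norm_summable_fps[OF rad[of 0]] pk[of k] 
        by (intro suminf_le) (auto simp: norm_mult norm_power intro!: mult_left_mono power_mono)
      then show "norm (norm (norm (psi_coeff k) * ?S k)) \<le> norm (psi_coeff k) * ?S 0"
        using norm_summable_fps[OF rad[of k]] by (auto simp: suminf_nonneg abs_mult intro!: mult_left_mono)
    qed
  qed
  have rows: "(F k has_sum psi_coeff k * ext_phi (of_real p ^ k * \<xi>)) UNIV" for k
  proof -
    have "norm (of_real p ^ k * \<xi>) < \<epsilon>" using pk[of k] assms by simp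
    then show ?thesis unfolding F_def ext_phi_near_0[OF \<open>norm (of_real p ^ k * \<xi>) < \<epsilon>\<close>]
      by (intro has_sum_cmult_right norm_summable_imp_has_sum norm_summable_fps sums_eval_fps rad)
  qed
  have cols: "((\<lambda>k. F k n) has_sum of_real (1 / qpoch p n) * (?\<phi> n * \<xi> ^ n)) UNIV" for n
  proof -
    have "summable (\<lambda>k. norm (psi_coeff k * of_real p ^ (k * n)))"
    proof (rule summable_comparison_test'[OF psi_coeff_summable, where N = 0])
      show "norm (norm (psi_coeff k * of_real p ^ (k * n))) \<le> norm (psi_coeff k)" for k
        using p_pos p_less_1 by (simp add: norm_mult norm_power power_le_one mult_left_le)
    qed
    then have "((\<lambda>k. psi_coeff k * of_real p ^ (k * n) * (?\<phi> n * \<xi> ^ n)) has_sum of_real (1 / qpoch p n) * (?\<phi> n * \<xi> ^ n)) UNIV"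
      by (intro has_sum_cmult_left norm_summable_imp_has_sum psi_coeff_powers_sums)
    then show ?thesis by (simp add: F_def power_mult_distrib power_mult mult_ac)
  qed
  have "((\<lambda>k. psi_coeff k * ext_phi (of_real p ^ k * \<xi>)) has_sum cont_psi \<xi>) UNIV"
    unfolding cont_psi_def using cont_psi_summable[OF ext_dom_near_0[OF assms]]
    by (intro norm_summable_imp_has_sum) (auto simp: summable_norm_cancel summable_sums)
  then have "((\<lambda>n. of_real (1 / qpoch p n) * (?\<phi> n * \<xi> ^ n)) has_sum cont_psi \<xi>) UNIV"
    by (rule has_sum_swap_sums[OF summ rows cols])
  then have "(\<lambda>n. of_real (1 / qpoch p n) * (?\<phi> n * \<xi> ^ n)) sums cont_psi \<xi>" by (rule has_sum_imp_sums)
  moreover have "of_real (1 / qpoch p n) * (?\<phi> n * \<xi> ^ n) = fps_nth (borel_e q f) n * (\<xi> / of_real (1 - p)) ^ n" for n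
    using p_less_1 by (simp add: borel_theta_nth borel_e_def q_fact_eq power_divide del: of_real_diff)
  ultimately show ?thesis by (simp add: eval_fps_def sums_iff)
qed

text \<open>A continued value asks for a continuation without growth condition, and the series
  provides one on the rescaled \<open>ext_dom\<close>, which contains discs around the
  spiral.\<close>

lemma continued_value_borel_e:
  assumes "\<xi> \<in> nonsingular"
  shows "continued_value q (borel_e q f) (\<xi> / of_real (1 - p)) = cont_psi \<xi>"
proof -
  define s where "s = complex_of_real (1 - p)"
  have s: "s \<noteq> 0" "norm s = 1 - p" using p_less_1 by (auto simp: s_def simp del: of_real_diff)
  define g where "g = (\<lambda>w. cont_psi (s * w))"
  have img: "(\<lambda>w. s * w) -` A = (\<lambda>z. z / s) ` A" for A
    using s(1) by (force simp: image_iff)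
  have holo: "g holomorphic_on (\<lambda>w. s * w) -` A" if "A \<subseteq> ext_dom" for A
  proof -
    have "cont_psi \<circ> (\<lambda>w. s * w) holomorphic_on (\<lambda>w. s * w) -` A"
      using that by (intro holomorphic_on_compose_gen[OF _ cont_psi_holomorphic] holomorphic_intros) auto
    then show ?thesis by (simp add: g_def o_def)
  qed
  have near: "g w = eval_fps (borel_e q f) w" if "norm w < \<epsilon> / (1 - p)" for w
  proof -
    have "norm (s * w) < \<epsilon>" using that p_less_1 by (simp add: norm_mult s field_simps)
    then show ?thesis using cont_psi_near_0[of "s * w"] s(1) by (simp add: g_def s_def)
  qed
  have \<epsilon>': "\<epsilon> / (1 - p) > 0" using Z(4) p_less_1 by simp
  have cont: "spiral_continuation q (\<xi> / s) (borel_e q f) ((\<lambda>w. s * w) -` ext_dom) g"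
    unfolding spiral_continuation_def
  proof (intro conjI)
    show "open ((\<lambda>w. s * w) -` ext_dom)" by (intro open_vimage ext_dom_open continuous_intros)
    show "connected ((\<lambda>w. s * w) -` ext_dom)"
      unfolding img using s(1) by (intro connected_continuous_image ext_dom_connected continuous_intros) auto
    show "g holomorphic_on (\<lambda>w. s * w) -` ext_dom" by (rule holo) simp
    obtain r where r: "r > 0" "\<And>m::int. ball (\<xi> * of_real (q powi m)) (r * q powi m) \<subseteq> nonsingular"
      using nonsingular_nbhd[OF assms] by metis
    have "(\<Union>m::int. ball (\<xi> / s * of_real (q powi m)) (r / (1 - p) * q powi m)) \<subseteq> (\<lambda>w. s * w) -` ext_dom"
    proof (rule UN_least, rule subsetI)
      fix w and m :: int assume w: "w \<in> ball (\<xi> / s * of_real (q powi m)) (r / (1 - p) * q powi m)"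
      have "\<xi> * of_real (q powi m) - s * w = s * (\<xi> / s * of_real (q powi m) - w)"
        using s(1) by (simp add: algebra_simps)
      then have "dist (\<xi> * of_real (q powi m)) (s * w) = (1 - p) * dist (\<xi> / s * of_real (q powi m)) w"
        by (simp only: dist_norm norm_mult s)
      also have "\<dots> < (1 - p) * (r / (1 - p) * q powi m)"
        using w p_less_1 by (intro mult_strict_left_mono) auto
      finally show "w \<in> (\<lambda>w. s * w) -` ext_dom" using r(2)[of m] p_less_1 by (auto simp: ext_dom_def)
    qed
    then show "\<exists>r>0. (\<Union>m::int. ball (\<xi> / s * of_real (q powi m)) (r * q powi m)) \<subseteq> (\<lambda>w. s * w) -` ext_dom"
      using r(1) p_less_1 by (intro exI[of _ "r / (1 - p)"]) auto
    show "\<forall>\<^sub>F x in at 0 within (\<lambda>w. s * w) -` ext_dom. g x = eval_fps (borel_e q f) x"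
      unfolding eventually_at using \<epsilon>' near by (intro exI[of _ "\<epsilon> / (1 - p)"]) auto
  qed
  have "continued_value q (borel_e q f) (\<xi> / s) = g (\<xi> / s)"
  \<comment> \<open>The reference function for uniqueness is the series itself, considered off the
    rescaled set \<open>Z\<close>.\<close>
  proof (rule continued_value_eq[OF cont _ q_gt_1, where Z = "(\<lambda>w. s * w) -` Z" and \<Phi> = g and \<epsilon> = "\<epsilon> / (1 - p)"])
    show "countable ((\<lambda>w. s * w) -` Z)" unfolding img using Z(1) by simp
    show "closed ((\<lambda>w. s * w) -` Z)" by (intro closed_vimage Z(2) continuous_intros)
    show "g holomorphic_on - (\<lambda>w. s * w) -` Z" using holo[of "- Z"] by (simp add: ext_dom_def vimage_Compl)
    show "ball 0 (\<epsilon> / (1 - p)) \<inter> (\<lambda>w. s * w) -` Z = {}"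
    proof -
      have "s * w \<in> ball 0 \<epsilon>" if "w \<in> ball 0 (\<epsilon> / (1 - p))" for w
        using that p_less_1 by (simp add: norm_mult s field_simps)
      then show ?thesis using Z(5) by blast
    qed
  qed (use \<epsilon>' near nonsingular_nonzero[OF assms] s(1) in auto)
  then show ?thesis using s(1) by (simp add: g_def s_def)
qed

lemma cont_psi_N_summable:
  assumes "\<xi> \<in> nonsingular"
  shows "summable (\<lambda>k. norm (psi_coeff k * cont_phi (of_real p ^ k * \<xi>)))"
    and "(\<lambda>k. psi_coeff k * cont_phi (of_real p ^ k * \<xi>)) sums cont_psi \<xi>"
proof -
  have *: "ext_phi (of_real p ^ k * \<xi>) = cont_phi (of_real p ^ k * \<xi>)" for k
    using nonsingular_scale_p[OF assms] by (simp add: ext_phi_def)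
  show "summable (\<lambda>k. norm (psi_coeff k * cont_phi (of_real p ^ k * \<xi>)))"
    using cont_psi_summable[of \<xi>] assms unfolding * by (simp add: ext_dom_def)
  then show "(\<lambda>k. psi_coeff k * cont_phi (of_real p ^ k * \<xi>)) sums cont_psi \<xi>"
    unfolding cont_psi_def * by (rule summable_sums[OF summable_norm_cancel])
qed

end

section \<open>Growth along spirals and the sums over a spiral\<close>

context q_borel
begin

text \<open>The q-exponential growth condition at \<open>q^n * l\<close>: \<open>Q^n\<close> stands
  for the power of the norm, with \<open>Q\<close> in the role of \<open>q powr \<mu>\<close>, and
  \<open>E\<close> at \<open>1 - p\<close> times the norm is the q-exponential. As
  \<open>nat n\<close> is 0 for negative \<open>n\<close>, the same formula also bounds the values
  near 0.\<close>

definition growth_bound :: "real \<Rightarrow> real \<Rightarrow> int \<Rightarrow> complex \<Rightarrow> real" where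
  "growth_bound C Q n l = C * Q ^ nat n * qE p ((1 - p) * (q powi n * norm l))"

lemma growth_bound_mono:
  assumes "0 \<le> C" "C \<le> C'" "1 \<le> Q" "Q \<le> Q'" "n \<le> n'"
  shows "growth_bound C Q n l \<le> growth_bound C' Q' n' l"
proof -
  have "Q ^ nat n \<le> Q' ^ nat n'"
    using assms by (intro order_trans[OF power_mono[of Q Q'] power_increasing]) auto
  moreover have "q powi n \<le> q powi n'" using assms q_gt_1 by (intro power_int_increasing) auto
  then have "qE p ((1 - p) * (q powi n * norm l)) \<le> qE p ((1 - p) * (q powi n' * norm l))"
    using p_less_1 q_gt_1 by (intro qE_mono mult_left_mono mult_right_mono) auto
  moreover have "1 \<le> qE p ((1 - p) * (q powi n * norm l))"
    using p_less_1 q_gt_1 by (intro qE_ge_1) auto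
  ultimately show ?thesis
    unfolding growth_bound_def using assms by (intro mult_mono) auto
qed

lemma growth_bound_ge: "C \<ge> 0 \<Longrightarrow> Q \<ge> 1 \<Longrightarrow> C \<le> growth_bound C Q n l"
proof -
  assume "C \<ge> 0" "Q \<ge> 1"
  moreover have "1 \<le> qE p ((1 - p) * (q powi n * norm l))"
    using p_less_1 q_gt_1 by (intro qE_ge_1) auto
  moreover have "1 \<le> Q ^ nat n" using \<open>Q \<ge> 1\<close> by simp
  ultimately have "C * (1 * 1) \<le> C * (Q ^ nat n * qE p ((1 - p) * (q powi n * norm l)))"
    by (intro mult_left_mono mult_mono) auto
  then show ?thesis by (simp add: growth_bound_def mult.assoc)
qed

text \<open>Three ranges of \<open>n\<close>: close to 0 the germ is bounded, far out the growth
  condition holds, and in between finitely many closed discs are compact. Halving the radius keeps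
  these closed discs inside the discs of holomorphy.\<close>

lemma cont_phi_growth_local:
  assumes "l0 \<in> nonsingular"
  shows "\<exists>d>0. \<exists>C>0. \<exists>Q\<ge>1. \<forall>l\<in>ball l0 d. \<forall>n::int. norm (cont_phi (of_real (q powi n) * l)) \<le> growth_bound C Q n l"
proof -
  obtain \<Omega> g r where w: "spiral_continuation q l0 (borel_theta q f) \<Omega> g" "q_exp_growth q \<Omega> g"
    "0 < r" "r \<le> norm l0" "\<And>m::int. ball (l0 * of_real (q powi m)) (r * q powi m) \<subseteq> \<Omega>"
    "\<And>m \<zeta>. \<zeta> \<in> ball (l0 * of_real (q powi m)) (r * q powi m) \<Longrightarrow> \<zeta> \<in> nonsingular \<and> cont_phi \<zeta> = g \<zeta>"
    using nonsingular_witness[OF assms] by blast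
  have qm: "q powi m > 0" for m using q_gt_1 by simp
  have in_cball: "of_real (q powi m) * l \<in> cball (l0 * of_real (q powi m)) (r / 2 * q powi m)"
    if "l \<in> ball l0 (r / 2)" for l m
  proof -
    have "l0 * of_real (q powi m) - of_real (q powi m) * l = of_real (q powi m) * (l0 - l)"
      by (simp add: algebra_simps)
    then have "dist (l0 * of_real (q powi m)) (of_real (q powi m) * l) = q powi m * dist l0 l"
      using q_gt_1 by (simp add: dist_norm norm_mult norm_power_int)
    moreover have "q powi m * dist l0 l \<le> q powi m * (r / 2)"
      using that qm[of m] by (intro mult_left_mono) auto
    ultimately show ?thesis by (simp add: mult.commute)
  qed
  have cball_sub: "cball (l0 * of_real (q powi m)) (r / 2 * q powi m) \<subseteq> ball (l0 * of_real (q powi m)) (r * q powi m)" for m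
  proof
    fix x assume "x \<in> cball (l0 * of_real (q powi m)) (r / 2 * q powi m)"
    then have "dist (l0 * of_real (q powi m)) x \<le> r / 2 * q powi m" by simp
    also have "\<dots> < r * q powi m" using w(3) qm[of m] by simp
    finally show "x \<in> ball (l0 * of_real (q powi m)) (r * q powi m)" by simp
  qed
  obtain e where e: "e > 0" "\<And>x. x \<in> \<Omega> \<Longrightarrow> x \<noteq> 0 \<Longrightarrow> dist x 0 < e \<Longrightarrow> g x = eval_fps (borel_theta q f) x"
    using w(1) unfolding spiral_continuation_def eventually_at by blast
  have "fps_conv_radius (borel_theta q f) > 0"
    using \<epsilon>_rad Z(4) by (metis ereal_less(2) less_trans)
  then obtain \<delta> M where \<delta>: "\<delta> > 0" "\<And>\<xi>. norm \<xi> < \<delta> \<Longrightarrow> norm (eval_fps (borel_theta q f) \<xi>) \<le> M"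
    using eval_fps_bounded_near_0 by metis
  obtain A \<mu> R where A: "A > 0" "\<mu> > 0" "\<And>x. x \<in> \<Omega> \<Longrightarrow> norm x > R \<Longrightarrow> norm (g x) < A * norm x powr \<mu> * q_exp q (norm x)"
    using w(2) unfolding q_exp_growth_def by blast
  have norm_l: "norm l0 / 2 \<le> norm l" "norm l \<le> 2 * norm l0" if "l \<in> ball l0 (r / 2)" for l
    using that w(4) norm_triangle_ineq2[of l0 l] norm_triangle_ineq2[of l l0]
    by (auto simp: dist_norm norm_minus_commute)
  have l0: "norm l0 > 0" using nonsingular_nonzero[OF assms] by simp
  obtain n1 where n1: "\<And>k. k \<ge> n1 \<Longrightarrow> p ^ k * (2 * norm l0) < min e \<delta>"
  proof -
    have "(\<lambda>k. p ^ k * (2 * norm l0)) \<longlonglongrightarrow> 0 * (2 * norm l0)"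
      using p_pos p_less_1 by (intro tendsto_intros LIMSEQ_power_zero) auto
    then have "\<forall>\<^sub>F k in sequentially. p ^ k * (2 * norm l0) < min e \<delta>"
      using e(1) \<delta>(1) by (intro order_tendstoD) auto
    then show thesis using that by (auto simp: eventually_sequentially)
  qed
  obtain n2 where n2: "q ^ n2 > R / (norm l0 / 2)" using real_arch_pow[OF q_gt_1] by blast
  let ?I = "{- int n1..int n2}"
  have "\<forall>m\<in>?I. \<exists>B. \<forall>x\<in>cball (l0 * of_real (q powi m)) (r / 2 * q powi m). norm (cont_phi x) \<le> B"
  proof
    fix m
    have "continuous_on (cball (l0 * of_real (q powi m)) (r / 2 * q powi m)) cont_phi"
      using w(6) cball_sub by (intro holomorphic_on_imp_continuous_on holomorphic_on_subset[OF cont_phi_holomorphic]) blast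
    then have "bounded (cont_phi ` cball (l0 * of_real (q powi m)) (r / 2 * q powi m))"
      by (intro compact_imp_bounded compact_continuous_image) auto
    then show "\<exists>B. \<forall>x\<in>cball (l0 * of_real (q powi m)) (r / 2 * q powi m). norm (cont_phi x) \<le> B"
      by (auto simp: bounded_iff)
  qed
  then obtain B where B: "\<And>m x. m \<in> ?I \<Longrightarrow> x \<in> cball (l0 * of_real (q powi m)) (r / 2 * q powi m) \<Longrightarrow> norm (cont_phi x) \<le> B m"
    by metis
  \<comment> \<open>One summand for each range. Since \<open>norm l \<le> 2 * norm l0\<close>, the
    power of \<open>norm (q^k * l)\<close> is at most \<open>(q powr \<mu>)^k\<close> times the
    factor included here.\<close>
  define C where "C = \<bar>M\<bar> + (\<Sum>m\<in>?I. \<bar>B m\<bar>) + A * (2 * norm l0) powr \<mu> + 1"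
  have Aterm: "0 \<le> A * (2 * norm l0) powr \<mu>" using A(1) by simp
  have Bsum: "0 \<le> (\<Sum>m\<in>?I. \<bar>B m\<bar>)" by (simp add: sum_nonneg)
  have "C > 0" using Aterm Bsum unfolding C_def by (smt (verit))
  have "q powr \<mu> \<ge> 1" using q_gt_1 A(2) by (simp add: ge_one_powr_ge_zero)
  have "norm (cont_phi (of_real (q powi n) * l)) \<le> growth_bound C (q powr \<mu>) n l" if l: "l \<in> ball l0 (r / 2)" for l n
  proof -
    let ?x = "of_real (q powi n) * l"
    have xb: "?x \<in> ball (l0 * of_real (q powi n)) (r * q powi n)"
      using in_cball[OF l] cball_sub[of n] by blast
    have x\<Omega>: "?x \<in> \<Omega>" and Vg: "cont_phi ?x = g ?x" and xN: "?x \<in> nonsingular"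
      using xb w(5)[of n] w(6)[OF xb] by blast+
    have nx: "norm ?x = q powi n * norm l" using q_gt_1 by (simp add: norm_mult norm_power_int)
    consider "n < - int n1" | "n \<in> ?I" | "int n2 < n" by force
    then show ?thesis
    proof cases
      case 1
      then obtain k where k: "n = - int k" "k \<ge> n1" by (intro that[of "nat (- n)"]) auto
      have "q powi n = p ^ k" using q_gt_1 by (simp add: k p_eq power_int_minus power_divide divide_inverse power_inverse)
      then have "norm ?x \<le> p ^ k * (2 * norm l0)"
        unfolding nx using norm_l(2)[OF l] p_pos by (simp add: mult_left_mono)
      then have "norm ?x < min e \<delta>" using n1[OF k(2)] by linarith
      moreover have "?x \<noteq> 0" using nonsingular_nonzero[OF xN] .
      ultimately have "norm (cont_phi ?x) \<le> M" using e(2)[OF x\<Omega>] \<delta>(2)[of ?x] Vg by simp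
      also have "\<dots> \<le> C" using Aterm Bsum unfolding C_def by linarith
      also have "\<dots> \<le> growth_bound C (q powr \<mu>) n l"
        using \<open>C > 0\<close> \<open>q powr \<mu> \<ge> 1\<close> by (intro growth_bound_ge) auto
      finally show ?thesis .
    next
      case 2
      have "norm (cont_phi ?x) \<le> B n" using B[OF 2 in_cball[OF l]] .
      also have "\<dots> \<le> (\<Sum>m\<in>?I. \<bar>B m\<bar>)"
        using member_le_sum[OF 2, of "\<lambda>m. \<bar>B m\<bar>"] by (smt (verit) finite_atLeastAtMost_int)
      also have "\<dots> \<le> C" using Aterm unfolding C_def by linarith
      also have "\<dots> \<le> growth_bound C (q powr \<mu>) n l"
        using \<open>C > 0\<close> \<open>q powr \<mu> \<ge> 1\<close> by (intro growth_bound_ge) auto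
      finally show ?thesis .
    next
      case 3
      then obtain k where k: "n = int k" "k \<ge> n2" by (intro that[of "nat n"]) auto
      have "R < q ^ n2 * (norm l0 / 2)" using n2 l0 by (simp add: divide_less_eq)
      also have "\<dots> \<le> q ^ k * norm l"
        using norm_l(1)[OF l] k(2) q_gt_1 by (intro mult_mono power_increasing) auto
      finally have "R < norm ?x" unfolding nx unfolding k(1) by simp
      then have "norm (cont_phi ?x) \<le> A * norm ?x powr \<mu> * q_exp q (norm ?x)" using A(3)[OF x\<Omega>] Vg by simp
      also have "\<dots> \<le> (A * (2 * norm l0) powr \<mu> * (q powr \<mu>) ^ k) * qE p ((1 - p) * (q powi n * norm l))"
      proof (rule mult_mono)
        have "norm ?x powr \<mu> = (q powr \<mu>) ^ k * norm l powr \<mu>"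
          unfolding nx unfolding k(1) using q_gt_1 by (simp add: powr_mult powr_power powr_powr powr_realpow[symmetric] mult.commute)
        also have "\<dots> \<le> (q powr \<mu>) ^ k * (2 * norm l0) powr \<mu>"
          using norm_l(2)[OF l] A(2) by (intro mult_left_mono powr_mono2) auto
        finally show "A * norm ?x powr \<mu> \<le> A * (2 * norm l0) powr \<mu> * (q powr \<mu>) ^ k"
          using A(1) by (simp add: mult_ac)
        show "q_exp q (norm ?x) \<le> qE p ((1 - p) * (q powi n * norm l))"
          unfolding q_exp_eq_qE nx by simp
        show "0 \<le> q_exp q (norm ?x)"
          unfolding q_exp_eq_qE using p_less_1 by (intro order_trans[OF zero_le_one qE_ge_1]) auto
      qed (use A(1) in auto)
      also have "\<dots> = growth_bound (A * (2 * norm l0) powr \<mu>) (q powr \<mu>) n l"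
        by (simp add: growth_bound_def k(1))
      also have "\<dots> \<le> growth_bound C (q powr \<mu>) n l"
        using Aterm Bsum \<open>q powr \<mu> \<ge> 1\<close> unfolding C_def by (intro growth_bound_mono) auto
      finally show ?thesis .
    qed
  qed
  then show ?thesis using w(3) \<open>C > 0\<close> \<open>q powr \<mu> \<ge> 1\<close> half_gt_zero by blast
qed

lemma cont_phi_growth:
  assumes "compact K" "K \<subseteq> nonsingular"
  obtains C Q where "C > 0" "Q \<ge> 1"
    "\<And>l n. l \<in> K \<Longrightarrow> norm (cont_phi (of_real (q powi n) * l)) \<le> growth_bound C Q n l"
proof -
  have "\<forall>l0\<in>K. \<exists>d C Q. d > 0 \<and> C > 0 \<and> Q \<ge> 1 \<and>
     (\<forall>l\<in>ball l0 d. \<forall>n::int. norm (cont_phi (of_real (q powi n) * l)) \<le> growth_bound C Q n l)"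
    using cont_phi_growth_local assms(2) by blast
  then obtain d C Q where *: "\<And>l0. l0 \<in> K \<Longrightarrow> d l0 > 0 \<and> C l0 > 0 \<and> Q l0 \<ge> (1::real) \<and>
     (\<forall>l\<in>ball l0 (d l0). \<forall>n::int. norm (cont_phi (of_real (q powi n) * l)) \<le> growth_bound (C l0) (Q l0) n l)"
    by metis
  obtain T where T: "T \<subseteq> K" "finite T" "K \<subseteq> (\<Union>l0\<in>T. ball l0 (d l0))"
  proof (rule compactE_image[OF assms(1), of K "\<lambda>l0. ball l0 (d l0)"])
    show "K \<subseteq> (\<Union>l0\<in>K. ball l0 (d l0))" using * by force
  qed auto
  show thesis
  proof
    have Cn: "0 \<le> C t" "0 \<le> Q t" if "t \<in> T" for t using *[of t] T(1) that by auto
    show "1 + (\<Sum>t\<in>T. C t) > 0" "1 + (\<Sum>t\<in>T. Q t) \<ge> 1"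
      using sum_nonneg[of T C] sum_nonneg[of T Q] Cn by auto
    fix l n assume "l \<in> K"
    then obtain t where t: "t \<in> T" "l \<in> ball t (d t)" using T(3) by blast
    have "norm (cont_phi (of_real (q powi n) * l)) \<le> growth_bound (C t) (Q t) n l"
      using *[of t] T(1) t by blast
    also have "\<dots> \<le> growth_bound (1 + (\<Sum>t\<in>T. C t)) (1 + (\<Sum>t\<in>T. Q t)) n l"
      using *[of t] T(1) t member_le_sum[OF t(1), of C] member_le_sum[OF t(1), of Q] T(2) Cn
      by (intro growth_bound_mono) fastforce+
    finally show "norm (cont_phi (of_real (q powi n) * l)) \<le> growth_bound (1 + (\<Sum>t\<in>T. C t)) (1 + (\<Sum>t\<in>T. Q t)) n l" .
  qed
qed

lemma p_pow_q_powi: "p ^ k * q powi n = q powi (n - int k)"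
  using q_gt_1 by (simp add: p_eq power_int_diff power_divide divide_inverse power_inverse)

text \<open>The series for \<psi> at \<open>q^n * l\<close> uses \<phi> at
  \<open>q^(n-k) * l\<close> only, and the bound increases with \<open>n\<close>. So \<psi> inherits
  it up to the sum of the norms of the coefficients.\<close>

lemma cont_psi_growth:
  assumes "l \<in> nonsingular" "C > 0" "Q \<ge> 1" and cont_phi: "\<And>n. norm (cont_phi (of_real (q powi n) * l)) \<le> growth_bound C Q n l"
  shows "norm (cont_psi (of_real (q powi n) * l)) \<le> (\<Sum>k. norm (psi_coeff k)) * growth_bound C Q n l"
proof -
  let ?\<xi> = "of_real (q powi n) * l"
  note S = cont_psi_N_summable[OF nonsingular_scale[OF assms(1), of n]]
  have "norm (cont_psi ?\<xi>) \<le> (\<Sum>k. norm (psi_coeff k * cont_phi (of_real p ^ k * ?\<xi>)))"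
    using summable_norm[OF S(1)] S(2) by (simp add: sums_iff)
  also have "\<dots> \<le> (\<Sum>k. norm (psi_coeff k) * growth_bound C Q n l)"
  proof (rule suminf_le[OF _ S(1)])
    fix k
    have "of_real p ^ k * ?\<xi> = of_real (q powi (n - int k)) * l"
      unfolding p_pow_q_powi[symmetric] by simp
    then have "norm (cont_phi (of_real p ^ k * ?\<xi>)) \<le> growth_bound C Q (n - int k) l"
      using cont_phi[of "n - int k"] by (simp only:)
    also have "\<dots> \<le> growth_bound C Q n l" using assms by (intro growth_bound_mono) auto
    finally show "norm (psi_coeff k * cont_phi (of_real p ^ k * ?\<xi>)) \<le> norm (psi_coeff k) * growth_bound C Q n l"
      unfolding norm_mult by (rule mult_left_mono) simp
  qed (rule summable_mult2[OF psi_coeff_summable])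
  also have "\<dots> = (\<Sum>k. norm (psi_coeff k)) * growth_bound C Q n l"
    by (rule suminf_mult2[OF psi_coeff_summable, symmetric])
  finally show ?thesis .
qed

text \<open>The coefficients here are those of \<open>\<kappa> * qA (p w)\<close>, and
  \<open>psi_coeff\<close> belongs to \<open>E (- p w) / \<kappa>\<close>; the two series are
  reciprocal. The double series converges absolutely because \<phi> is bounded on the points
  \<open>p^k * l\<close>.\<close>

lemma cont_phi_eq_cont_psi_series:
  assumes "l \<in> nonsingular"
  shows "((\<lambda>k. of_real (\<kappa> * (p ^ k / qpoch p k)) * cont_psi (of_real p ^ k * l)) has_sum cont_phi l) UNIV"
proof -
  obtain C Q where CQ: "C > 0" "Q \<ge> 1"
    and g: "\<And>n. norm (cont_phi (of_real (q powi n) * l)) \<le> growth_bound C Q n l"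
  proof -
    have "compact {l}" "{l} \<subseteq> nonsingular" using assms by auto
    from cont_phi_growth[OF this] show thesis using that by (metis singletonI)
  qed
  define M where "M = growth_bound C Q 0 l"
  have cont_phi_le: "norm (cont_phi (of_real p ^ k * l)) \<le> M" for k
  proof -
    have "p ^ k = q powi (- int k)" using p_pow_q_powi[of k 0] by simp
    then have "norm (cont_phi (of_real p ^ k * l)) \<le> growth_bound C Q (- int k) l"
      using g[of "- int k"] by (metis of_real_power)
    also have "\<dots> \<le> M" unfolding M_def using CQ by (intro growth_bound_mono) auto
    finally show ?thesis .
  qed
  define e where "e = (\<lambda>k. of_real (\<kappa> * (p ^ k / qpoch p k)) :: complex)"
  have e_sum: "summable (\<lambda>k. norm (e k))"
  proof -
    have "summable (\<lambda>k. \<bar>\<kappa>\<bar> * (1 / qpoch p k * p ^ k))"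
      using p_pos p_less_1 by (intro summable_mult summable_qA_real) auto
    then show ?thesis unfolding e_def norm_of_real using qpoch_pos p_pos
      by (simp add: abs_mult power_abs abs_of_pos less_imp_le)
  qed
  define F where "F = (\<lambda>k j. e k * (psi_coeff j * cont_phi (of_real p ^ j * (of_real p ^ k * l))))"
  have summ: "(\<lambda>(k, j). F k j) summable_on UNIV \<times> UNIV"
  proof (rule abs_summable_on_TimesI)
    let ?S = "\<lambda>k. \<Sum>j. norm (psi_coeff j * cont_phi (of_real p ^ j * (of_real p ^ k * l)))"
    have S: "summable (\<lambda>j. norm (psi_coeff j * cont_phi (of_real p ^ j * (of_real p ^ k * l))))" for k
      by (rule cont_psi_N_summable(1)[OF nonsingular_scale_p[OF assms]])
    show "((\<lambda>j. norm (F k j)) has_sum norm (e k) * ?S k) UNIV" for k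
      unfolding F_def norm_mult[of "e k"] using S[of k]
      by (intro has_sum_cmult_right norm_summable_imp_has_sum) (auto simp: summable_sums)
    show "(\<lambda>k. norm (e k) * ?S k) summable_on UNIV"
    proof (rule norm_summable_imp_summable_on, rule summable_comparison_test'[where N = 0])
      show "summable (\<lambda>k. norm (e k) * ((\<Sum>j. norm (psi_coeff j)) * M))"
        using e_sum by (rule summable_mult2)
      fix k
      have "?S k \<le> (\<Sum>j. norm (psi_coeff j) * M)"
      proof (rule suminf_le[OF _ S])
        show "norm (psi_coeff j * cont_phi (of_real p ^ j * (of_real p ^ k * l))) \<le> norm (psi_coeff j) * M" for j
          using cont_phi_le[of "j + k"] by (simp add: norm_mult mult_left_mono power_add mult.assoc)
      qed (rule summable_mult2[OF psi_coeff_summable])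
      then have "?S k \<le> (\<Sum>j. norm (psi_coeff j)) * M" by (simp add: suminf_mult2[OF psi_coeff_summable])
      then show "norm (norm (norm (e k) * ?S k)) \<le> norm (e k) * ((\<Sum>j. norm (psi_coeff j)) * M)"
        using S[of k] by (auto simp: suminf_nonneg abs_mult intro!: mult_left_mono)
    qed
  qed
  obtain S where S: "((\<lambda>(k, j). F k j) has_sum S) (UNIV \<times> UNIV)"
    using summ by (auto simp: summable_on_def)
  have rows: "((\<lambda>k. e k * cont_psi (of_real p ^ k * l)) has_sum S) UNIV"
  proof (rule has_sum_SigmaD[OF S])
    show "((\<lambda>j. case (k, j) of (k, j) \<Rightarrow> F k j) has_sum e k * cont_psi (of_real p ^ k * l)) UNIV" for k
      unfolding F_def case_prod_conv using cont_psi_N_summable[OF nonsingular_scale_p[OF assms, of k]]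
      by (intro has_sum_cmult_right norm_summable_imp_has_sum)
  qed
  \<comment> \<open>Grouping by the total dilation \<open>p^n\<close> lets Euler's convolution
    annihilate every diagonal except \<open>n = 0\<close>.\<close>
  have tri: "((\<lambda>(n, k). F k (n - k)) has_sum S) (Sigma UNIV (\<lambda>n. {..n}))"
    by (rule has_sum_reindex_bij_witness[where i = "\<lambda>(k, m). (k + m, k)" and j = "\<lambda>(n, k). (k, n - k)", THEN iffD2, OF _ _ _ _ _ _ S])
       auto
  have diag: "((\<lambda>k. F k (n - k)) has_sum (if n = 0 then cont_phi l else 0)) {..n}" for n
  proof -
    have "F k (n - k) = of_real (p ^ n * (1 / qpoch p k * ((- 1) ^ (n - k) * qcoeff p (n - k)))) * cont_phi (of_real p ^ n * l)"
      if "k \<le> n" for k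
    proof -
      have "p ^ n = p ^ k * p ^ (n - k)" using that by (simp flip: power_add)
      then have coeff: "\<kappa> * (p ^ k / qpoch p k) * ((- 1) ^ (n - k) * qcoeff p (n - k) * p ^ (n - k) / \<kappa>)
          = p ^ n * (1 / qpoch p k * ((- 1) ^ (n - k) * qcoeff p (n - k)))"
        using \<kappa>_nonzero by simp
      have arg: "of_real p ^ (n - k) * (of_real p ^ k * l) = of_real p ^ n * l"
        using that by (simp flip: power_add mult.assoc)
      show ?thesis
        unfolding F_def e_def psi_coeff_def arg coeff[symmetric] by (simp only: of_real_mult[symmetric] mult.assoc[symmetric])
    qed
    then have "(\<Sum>k\<le>n. F k (n - k)) = of_real (p ^ n * (\<Sum>k\<le>n. 1 / qpoch p k * ((- 1) ^ (n - k) * qcoeff p (n - k)))) * cont_phi (of_real p ^ n * l)"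
      unfolding sum_distrib_left of_real_sum sum_distrib_right by (intro sum.cong) auto
    also have "\<dots> = (if n = 0 then cont_phi l else 0)" unfolding euler_convolution by simp
    finally show ?thesis by (intro has_sum_finiteI) auto
  qed
  have "((\<lambda>n::nat. if n = 0 then cont_phi l else 0) has_sum S) UNIV"
    by (rule has_sum_SigmaD[OF tri]) (use diag in simp)
  moreover have "((\<lambda>n::nat. if n = 0 then cont_phi l else 0) has_sum cont_phi l) UNIV"
    by (subst has_sum_cong_neutral[where S = UNIV and T = "{0}" and g = "\<lambda>_. cont_phi l"]) (auto intro: has_sum_finiteI)
  ultimately have "S = cont_phi l" using has_sum_unique by blast
  with rows show ?thesis by (simp add: e_def)
qed

end

section \<open>Uniform majorants on compact sets of spirals\<close>

context q_borel
begin

definition val_norms :: "complex \<Rightarrow> real" where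
  "val_norms \<xi> = norm (cont_phi \<xi>) + norm (cont_psi \<xi>)"

text \<open>The first clause keeps theta and \<open>E\<close> from vanishing, the second bounds the
  terms of the sum with \<open>E\<close>. The third carries the extra factor
  \<open>E (p / norm z)\<close> and so bounds the double series behind the interchange. A single
  \<beta> for all \<open>l\<close> is what the integration over a segment needs.\<close>

definition dominated :: "complex \<Rightarrow> complex \<Rightarrow> (int \<Rightarrow> real) \<Rightarrow> bool" where
  "dominated x l \<beta> \<longleftrightarrow> (\<forall>n. let \<xi> = of_real (p powi n) * l; z = of_real q * \<xi> / x in
     qT z \<noteq> 0 \<and> p powi n * val_norms \<xi> \<le> \<beta> n * norm (qE p z) \<and>
     p powi n * val_norms \<xi> * qE p (p / norm z) \<le> \<beta> n * norm (qT z))"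

lemma p_powi_eq: "p powi n = q powi (- n)"
  using q_gt_1 by (simp add: p_eq power_int_minus power_int_divide_distrib divide_inverse power_int_inverse)

lemma q_p_powi: "q * p powi n = q powi (1 - n)"
  using q_gt_1 by (simp add: p_powi_eq power_int_diff power_int_minus divide_inverse)

text \<open>Towards 0 the values are bounded and the weight \<open>p^n\<close> is summable. Towards
  infinity the growth of \<phi> and \<psi> has to be beaten by the denominator, whose argument
  contains \<open>1 / x\<close>; a small \<open>norm x\<close> gives a geometric gain. Zeros are
  avoided as \<open>x\<close> lies on no spiral of \<open>- l\<close>.\<close>

lemma uniform_domination:
  assumes "compact K" "K \<subseteq> nonsingular"
  shows "\<exists>\<rho>>0. \<forall>x. 0 < norm x \<and> norm x < \<rho> \<and> (\<forall>l\<in>K. x \<notin> q_spiral q (- l)) \<longrightarrow>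
       (\<exists>\<beta>. \<beta> summable_on UNIV \<and> (\<forall>l\<in>K. dominated x l \<beta>))"
proof -
  obtain C Q where CQ: "C > 0" "Q \<ge> 1" 
    and cont_phi: "\<And>l n. l \<in> K \<Longrightarrow> norm (cont_phi (of_real (q powi n) * l)) \<le> growth_bound C Q n l"
    using cont_phi_growth[OF assms] by blast
  have "0 \<notin> K" using assms(2) nonsingular_nonzero by blast
  then obtain a where a: "a > 0" "\<And>l. l \<in> K \<Longrightarrow> a \<le> norm l"
    using separate_point_closed[OF compact_imp_closed[OF assms(1)]] by (metis dist_0_norm)
  obtain B where B: "B > 0" "\<And>l. l \<in> K \<Longrightarrow> norm l \<le> B"
    using compact_imp_bounded[OF assms(1)] by (auto simp: bounded_pos)
  define b0 where "b0 = (1 - p) * a"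
  \<comment> \<open>The threshold of \<open>qE_growth_compare\<close> with \<open>Q / p\<close> in
    place of \<open>Q\<close>: towards infinity the weight \<open>p powi n\<close> contributes a
    further factor \<open>1 / p\<close> per step.\<close>
  define s0 where "s0 = 2 * (Q / p) * (1 + 1 / b0)"
  have b0: "b0 > 0" using a p_less_1 by (simp add: b0_def)
  have Qp: "Q / p \<ge> 1" using CQ p_pos p_less_1 by (simp add: le_divide_eq)
  have s0: "s0 > 0" using b0 Qp CQ p_pos unfolding s0_def by (intro mult_pos_pos add_pos_pos) auto
  define S where "S = 1 + (\<Sum>k. norm (psi_coeff k))"
  have S: "S > 0" using suminf_nonneg[OF psi_coeff_summable] by (simp add: S_def)
  have val_norms: "val_norms (of_real (p powi n) * l) \<le> S * growth_bound C Q (- n) l" if "l \<in> K" for l n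
  proof -
    have "norm (cont_psi (of_real (q powi (- n)) * l)) \<le> (\<Sum>k. norm (psi_coeff k)) * growth_bound C Q (- n) l"
      using that assms(2) CQ cont_phi[OF that] by (intro cont_psi_growth) auto
    then show ?thesis
      using cont_phi[OF that, of "- n"] unfolding val_norms_def S_def p_powi_eq distrib_right mult_1_left by linarith
  qed
  show ?thesis
  \<comment> \<open>At \<open>n = - k\<close> the argument of the denominator has norm
    \<open>s * ((1 - p) * norm l) / p^k\<close> with \<open>s = q / ((1 - p) * norm x)\<close>; the
    radius is chosen to make \<open>s \<ge> s0\<close>.\<close>
  proof (intro exI[of _ "q / ((1 - p) * s0)"] conjI allI impI)
    show "q / ((1 - p) * s0) > 0" using q_gt_1 p_less_1 s0 by simp
    fix x :: complex
    assume "0 < norm x \<and> norm x < q / ((1 - p) * s0) \<and> (\<forall>l\<in>K. x \<notin> q_spiral q (- l))"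
    then have x: "0 < norm x" "norm x < q / ((1 - p) * s0)" "\<And>l. l \<in> K \<Longrightarrow> x \<notin> q_spiral q (- l)"
      by blast+
    define w where "w = (\<lambda>l. of_real q * l / x)"
    have cw: "compact (w ` K)"
      unfolding w_def using x(1) assms(1) by (intro compact_continuous_image continuous_intros) auto
    have wK: "w l \<noteq> 0" if "l \<in> K" for l using that nonsingular_nonzero assms(2) q_gt_1 x(1) by (auto simp: w_def)
    have wK': "w l \<noteq> - of_real (p powi n)" if "l \<in> K" for l n
    proof
      assume "w l = - of_real (p powi n)"
      then have "of_real q * l = - (of_real (p powi n) * x)" using x(1) by (simp add: w_def divide_eq_eq)
      then have "of_real (p powi (- n)) * (of_real q * l) = - (of_real (p powi (- n)) * of_real (p powi n) * x)"
        by simp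
      also have "\<dots> = - x" using p_pos by (simp add: power_int_minus)
      finally have "- x = l * (of_real q * of_real (p powi (- n)))" by (simp only: mult_ac)
      also have "complex_of_real q * of_real (p powi (- n)) = of_real (q powi (1 + n))"
        unfolding of_real_mult[symmetric] q_p_powi by simp
      finally have "x = - l * of_real (q powi (1 + n))"
        by (metis minus_minus mult_minus_left)
      then show False using x(3)[OF that] by (auto simp: q_spiral_def)
    qed
    obtain M where M: "M > 0"
      "\<And>l n. l \<in> K \<Longrightarrow> qT (p powi n * norm (w l)) \<le> M * norm (qT (of_real (p powi n) * w l))"
    proof (rule qT_compact_bound[OF cw])
      fix M assume "M > 0" "\<And>v n. v \<in> w ` K \<Longrightarrow> qT (p powi n * norm v) \<le> M * norm (qT (of_real (p powi n) * v))"
      then show thesis using that by blast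
    qed (use wK wK' in auto)
    \<comment> \<open>Geometric in both directions: the weight \<open>p^n\<close> towards 0, the
      gain \<open>1 / 2\<close> per step towards infinity.\<close>
    define \<alpha> where "\<alpha> = (\<lambda>n::int. if n \<ge> 0 then p ^ nat n * qE p ((1 - p) * B) else (1 / 2) ^ nat (- n))"
    define \<beta> where "\<beta> = (\<lambda>n. M * (S * C) * \<alpha> n)"
    have \<alpha>_pos: "\<alpha> n \<ge> 0" for n
      using p_pos p_less_1 B(1) order_trans[OF zero_le_one qE_ge_1[of "(1 - p) * B"]] by (auto simp: \<alpha>_def)
    have "(\<lambda>n. norm (\<alpha> n)) summable_on UNIV"
    proof (rule summable_on_int)
      show "summable (\<lambda>n. norm (\<alpha> (int n)))"
      proof -
        have "norm (\<alpha> (int n)) = p ^ n * qE p ((1 - p) * B)" for n using \<alpha>_pos[of "int n"] by (simp add: \<alpha>_def)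
        then show ?thesis using p_pos p_less_1 by (auto intro!: summable_mult2 summable_geometric)
      qed
      show "summable (\<lambda>n. norm (\<alpha> (- int n)))"
      proof (subst summable_Suc_iff[symmetric])
        have "norm (\<alpha> (- int (Suc n))) = (1 / 2) ^ Suc n" for n using \<alpha>_pos[of "- int (Suc n)"] by (simp add: \<alpha>_def nat_add_distrib)
        then show "summable (\<lambda>n. norm (\<alpha> (- int (Suc n))))"
          by (simp only: summable_Suc_iff) (auto intro!: summable_geometric)
      qed
    qed
    then have "\<beta> summable_on UNIV"
      unfolding \<beta>_def by (intro summable_on_cmult_right) (rule abs_summable_summable)
    moreover have "dominated x l \<beta>" if l: "l \<in> K" for l
      unfolding dominated_def
    proof (intro allI, unfold Let_def)
      fix n
      let ?\<xi> = "of_real (p powi n) * l"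
      let ?z = "of_real q * ?\<xi> / x"
      have z: "?z = of_real (p powi n) * w l" by (simp add: w_def)
      have "qT (w l) \<noteq> 0" using wK wK' l by (intro qT_nonzero) auto
      then have qTz: "qT ?z \<noteq> 0"
        using qT_ratio_invariant[OF wK[OF l], of n] qT_pos[of "p powi n * norm (w l)"] wK[OF l] p_pos
        unfolding z by auto
      have nz: "?z \<noteq> 0" unfolding z using wK[OF l] p_pos by simp
      have norm_z: "norm ?z = p powi n * norm (w l)"
        unfolding z using p_pos by (simp add: norm_mult norm_power_int)
      have T: "qT (norm ?z) \<le> M * norm (qT ?z)" using M(2)[OF l, of n] unfolding norm_z unfolding z .
      note lower = qE_lower_bound[OF T nz M(1)]
      have E1: "qE p (norm ?z) \<ge> 1" by (intro qE_ge_1) auto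
      have main: "p powi n * val_norms ?\<xi> \<le> (S * C) * \<alpha> n * qE p (norm ?z)"
      proof (cases "n \<ge> 0")
        case True
        have pn: "p powi n = p ^ nat n" using True by (simp add: power_int_def)
        have "val_norms ?\<xi> \<le> S * growth_bound C Q (- n) l" by (rule val_norms[OF l])
        also have "growth_bound C Q (- n) l \<le> C * qE p ((1 - p) * B)"
        proof -
          have "q powi (- n) * norm l \<le> 1 * B"
          proof (rule mult_mono)
            show "q powi (- n) \<le> 1"
              using p_pos p_less_1 unfolding p_powi_eq[symmetric] pn by (simp add: power_le_one)
          qed (use B(2)[OF l] q_gt_1 in auto)
          then have "qE p ((1 - p) * (q powi (- n) * norm l)) \<le> qE p ((1 - p) * B)"
            using p_less_1 q_gt_1 by (intro qE_mono mult_left_mono) auto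
          then show ?thesis unfolding growth_bound_def using True CQ by simp
        qed
        finally have "val_norms ?\<xi> \<le> S * (C * qE p ((1 - p) * B))" using S by simp
        then have "p powi n * val_norms ?\<xi> \<le> p powi n * (S * (C * qE p ((1 - p) * B)))"
          using p_pos by (intro mult_left_mono) auto
        also have "\<dots> = (S * C) * \<alpha> n * 1" using True by (simp add: \<alpha>_def pn)
        also have "\<dots> \<le> (S * C) * \<alpha> n * qE p (norm ?z)"
          using S CQ \<alpha>_pos[of n] E1 by (intro mult_left_mono) auto
        finally show ?thesis .
      next
        case False
        define k where "k = nat (- n)"
        have n: "n = - int k" using False by (simp add: k_def)
        have pn: "p powi n = (1 / p) ^ k" by (simp add: n power_int_minus power_divide divide_inverse power_inverse)
        have qn: "q powi (- n) = 1 / p ^ k" by (simp add: n q_eq power_divide)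
        define s where "s = q / ((1 - p) * norm x)"
        have "s0 \<le> s"
          using x(1,2) s0 p_less_1 by (simp add: s_def field_simps)
        moreover have "b0 \<le> (1 - p) * norm l"
          unfolding b0_def using a(2)[OF l] p_less_1 by (intro mult_left_mono) auto
        ultimately have cmp: "(Q / p) ^ k * qE p ((1 - p) * norm l / p ^ k) \<le> (1 / 2) ^ k * qE p (s * ((1 - p) * norm l) / p ^ k)"
          by (intro qE_growth_compare[OF b0 Qp]) (auto simp: s0_def)
        have zs: "norm ?z = s * ((1 - p) * norm l) / p ^ k"
          unfolding norm_z pn w_def s_def using p_pos p_less_1 q_gt_1 by (simp add: norm_mult norm_divide norm_power power_divide)
        have "p powi n * val_norms ?\<xi> \<le> p powi n * (S * growth_bound C Q (- n) l)"
          using val_norms[OF l, of n] p_pos by (intro mult_left_mono) auto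
        also have "\<dots> = (S * C) * ((Q / p) ^ k * qE p ((1 - p) * norm l / p ^ k))"
          unfolding growth_bound_def qn pn k_def[symmetric] by (simp add: power_divide)
        also have "\<dots> \<le> (S * C) * ((1 / 2) ^ k * qE p (s * ((1 - p) * norm l) / p ^ k))"
          using cmp S CQ by (intro mult_left_mono) auto
        also have "\<dots> = (S * C) * \<alpha> n * qE p (norm ?z)"
          unfolding zs using False by (simp add: \<alpha>_def k_def)
        finally show ?thesis .
      qed
      have nonneg: "0 \<le> (S * C) * \<alpha> n" using S CQ \<alpha>_pos[of n] by simp
      have "p powi n * val_norms ?\<xi> \<le> (S * C) * \<alpha> n * (M * norm (qE p ?z))"
        using main lower(1) mult_left_mono[OF lower(1) nonneg] by linarith
      moreover have "p powi n * val_norms ?\<xi> * qE p (p / norm ?z) \<le> (S * C) * \<alpha> n * (M * norm (qT ?z))"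
      proof -
        have "0 \<le> qE p (p / norm ?z)" using p_pos by (intro order_trans[OF zero_le_one qE_ge_1]) auto
        from mult_right_mono[OF main this]
        have "p powi n * val_norms ?\<xi> * qE p (p / norm ?z) \<le> (S * C) * \<alpha> n * (qE p (p / norm ?z) * qE p (norm ?z))"
          by (simp only: mult_ac)
        then show ?thesis using mult_left_mono[OF lower(2) nonneg] by linarith
      qed
      ultimately show "qT ?z \<noteq> 0 \<and> p powi n * val_norms ?\<xi> \<le> \<beta> n * norm (qE p ?z) \<and>
         p powi n * val_norms ?\<xi> * qE p (p / norm ?z) \<le> \<beta> n * norm (qT ?z)"
        using qTz by (simp add: \<beta>_def mult_ac)
    qed
    ultimately show "\<exists>\<beta>. \<beta> summable_on UNIV \<and> (\<forall>l\<in>K. dominated x l \<beta>)" by blast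
  qed
qed

lemma integrand_theta_eq: "integrand_theta q f x \<xi> = cont_phi \<xi> / theta p (of_real q * \<xi> / x)"
  by (simp add: integrand_theta_def cont_phi_def p_eq)

lemma spiral_integrand_e_eq: "\<xi> \<in> nonsingular \<Longrightarrow> spiral_integrand_e q f x \<xi> = cont_psi \<xi> / qE p (of_real q * \<xi> / x)"
  using continued_value_borel_e[of \<xi>] p_less_1
  by (simp add: spiral_integrand_e_def integrand_e_def q_exp_eq_qE flip: p_eq)

lemma dominatedD:
  assumes "dominated x l \<beta>" "l \<in> nonsingular" "x \<noteq> 0"
  defines "\<xi> \<equiv> \<lambda>n. of_real (p powi n) * l"
  shows "theta p (of_real q * \<xi> n / x) \<noteq> 0" "qE p (of_real q * \<xi> n / x) \<noteq> 0"
    and "norm (integrand_theta q f x (\<xi> n) * of_real (p powi n)) \<le> \<beta> n / \<bar>\<kappa>\<bar>"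
    and "norm (spiral_integrand_e q f x (\<xi> n) * of_real (p powi n)) \<le> \<beta> n"
    and "p powi n * norm (cont_psi (\<xi> n)) * qE p (p / norm (of_real q * \<xi> n / x)) / norm (qT (of_real q * \<xi> n / x)) \<le> \<beta> n"
proof -
  let ?z = "of_real q * \<xi> n / x"
  have \<xi>nonsingular: "\<xi> n \<in> nonsingular" unfolding \<xi>_def p_powi_eq by (rule nonsingular_scale[OF assms(2)])
  then have z: "?z \<noteq> 0" using q_gt_1 assms(3) nonsingular_nonzero by auto
  have d: "qT ?z \<noteq> 0" "p powi n * val_norms (\<xi> n) \<le> \<beta> n * norm (qE p ?z)"
     "p powi n * val_norms (\<xi> n) * qE p (p / norm ?z) \<le> \<beta> n * norm (qT ?z)"
    using assms(1) unfolding dominated_def \<xi>_def Let_def by blast+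
  have th: "theta p ?z = of_real \<kappa> * qT ?z" by (rule theta_eq_qT[OF z])
  show "theta p ?z \<noteq> 0" using d(1) \<kappa>_nonzero th by simp
  show E: "qE p ?z \<noteq> 0" using d(1) by (auto simp: qT_def)
  have pn: "p powi n > 0" using p_pos by simp
  have E1: "qE p (p / norm ?z) \<ge> 1" using p_pos by (intro qE_ge_1) auto
  have VU: "norm (cont_phi (\<xi> n)) \<le> val_norms (\<xi> n)" and cont_psival_norms: "norm (cont_psi (\<xi> n)) \<le> val_norms (\<xi> n)" and U0: "0 \<le> val_norms (\<xi> n)"
    by (auto simp: val_norms_def)
  have "p powi n * norm (cont_phi (\<xi> n)) * 1 \<le> p powi n * val_norms (\<xi> n) * qE p (p / norm ?z)"
    using pn VU E1 U0 by (intro mult_mono mult_nonneg_nonneg) auto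
  also note d(3)
  finally have "p powi n * norm (cont_phi (\<xi> n)) / norm (qT ?z) \<le> \<beta> n"
    using d(1) by (simp add: divide_le_eq)
  then have "p powi n * norm (cont_phi (\<xi> n)) / norm (qT ?z) / \<bar>\<kappa>\<bar> \<le> \<beta> n / \<bar>\<kappa>\<bar>"
    by (rule divide_right_mono) simp
  then show "norm (integrand_theta q f x (\<xi> n) * of_real (p powi n)) \<le> \<beta> n / \<bar>\<kappa>\<bar>"
    unfolding integrand_theta_eq th using p_pos by (simp add: norm_mult norm_divide norm_power_int mult_ac)
  have "p powi n * norm (cont_psi (\<xi> n)) \<le> p powi n * val_norms (\<xi> n)" using pn cont_psival_norms by simp
  also note d(2)
  finally have "p powi n * norm (cont_psi (\<xi> n)) / norm (qE p ?z) \<le> \<beta> n" using E by (simp add: divide_le_eq)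
  then show "norm (spiral_integrand_e q f x (\<xi> n) * of_real (p powi n)) \<le> \<beta> n"
    unfolding spiral_integrand_e_eq[OF \<xi>nonsingular] using p_pos by (simp add: norm_mult norm_divide norm_power_int mult_ac)
  have "p powi n * norm (cont_psi (\<xi> n)) * qE p (p / norm ?z) \<le> p powi n * val_norms (\<xi> n) * qE p (p / norm ?z)"
    using pn cont_psival_norms E1 by (intro mult_right_mono mult_left_mono) auto
  also note d(3)
  finally show "p powi n * norm (cont_psi (\<xi> n)) * qE p (p / norm ?z) / norm (qT ?z) \<le> \<beta> n"
    using d(1) by (simp add: divide_le_eq)
qed

lemma spiral_sums:
  assumes \<beta>: "\<beta> summable_on UNIV" and dom: "dominated x l \<beta>" "l \<in> nonsingular" "x \<noteq> 0"
  shows "jackson_integrable p l (integrand_theta q f x)"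
    and "jackson_integrable p l (spiral_integrand_e q f x)"
    and "jackson_integral p l (integrand_theta q f x) = jackson_integral p l (spiral_integrand_e q f x)"
proof -
  note ext_dom = dominatedD[OF dom]
  show "jackson_integrable p l (integrand_theta q f x)"
    unfolding jackson_integrable_def
  proof (rule abs_summable_summable, rule summable_on_comparison_test)
    show "(\<lambda>n. \<beta> n / \<bar>\<kappa>\<bar>) summable_on UNIV"
      using summable_on_cmult_left[OF \<beta>, of "1 / \<bar>\<kappa>\<bar>"] by simp
  qed (use ext_dom(3) in auto)
  show int_e: "jackson_integrable p l (spiral_integrand_e q f x)"
    unfolding jackson_integrable_def
    by (rule abs_summable_summable, rule summable_on_comparison_test[OF \<beta>]) (use ext_dom(4) in auto)
  define \<xi> where "\<xi> = (\<lambda>n. of_real (p powi n) * l)"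
  define z where "z = (\<lambda>n. of_real q * \<xi> n / x)"
  have \<xi>nonsingular: "\<xi> n \<in> nonsingular" for n unfolding \<xi>_def p_powi_eq by (rule nonsingular_scale[OF dom(2)])
  have z0: "z n \<noteq> 0" for n unfolding z_def using q_gt_1 dom(3) nonsingular_nonzero[OF \<xi>nonsingular] by simp
  have \<xi>_n: "\<xi> n = of_real (p powi n) * l" for n by (simp add: \<xi>_def)
  have z_n: "z n = of_real q * \<xi> n / x" for n by (simp add: z_def)
  note D' = ext_dom[folded \<xi>_n, folded z_n]
  have th: "theta p (z n) = of_real \<kappa> * qT (z n)" for n by (rule theta_eq_qT[OF z0])
  \<comment> \<open>\<open>G m k\<close> is the share of the value of \<psi> at
    \<open>p^m * l\<close> that comes from expanding \<phi> at \<open>p^(m-k) * l\<close>, rewritten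
    with theta at \<open>z m\<close>. For fixed \<open>m\<close> the sum over \<open>k\<close> is an
    Euler series.\<close>
  define G where "G = (\<lambda>m k. of_real (p powi m) * cont_psi (\<xi> m) * of_real \<kappa> / theta p (z m) * (of_real (qcoeff p k) * (of_real p / z m) ^ k))"
  have cols: "(G m has_sum spiral_integrand_e q f x (\<xi> m) * of_real (p powi m)) UNIV" for m
  proof -
    have "(G m has_sum of_real (p powi m) * cont_psi (\<xi> m) * of_real \<kappa> / theta p (z m) * qE p (of_real p / z m)) UNIV"
      unfolding G_def by (intro has_sum_cmult_right norm_summable_imp_has_sum summable_norm_qE qE_sums)
    also have "of_real (p powi m) * cont_psi (\<xi> m) * of_real \<kappa> / theta p (z m) * qE p (of_real p / z m)
       = cont_psi (\<xi> m) / qE p (z m) * of_real (p powi m)"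
      using D'(1)[of m] D'(2)[of m] \<kappa>_nonzero unfolding th by (simp add: qT_def)
    finally show ?thesis unfolding spiral_integrand_e_eq[OF \<xi>nonsingular] z_n .
  qed
  have summ: "(\<lambda>(m, k). G m k) summable_on UNIV \<times> UNIV"
  proof (rule abs_summable_on_TimesI)
    show "((\<lambda>k. norm (G m k)) has_sum p powi m * norm (cont_psi (\<xi> m)) / norm (qT (z m)) * qE p (p / norm (z m))) UNIV" for m
    proof -
      have "((\<lambda>k. p powi m * norm (cont_psi (\<xi> m)) / norm (qT (z m)) * (of_real (qcoeff p k) * (of_real p / norm (z m)) ^ k))
         has_sum p powi m * norm (cont_psi (\<xi> m)) / norm (qT (z m)) * qE p (of_real p / norm (z m))) UNIV"
        by (intro has_sum_cmult_right norm_summable_imp_has_sum summable_norm_qE qE_sums)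
      also have "(\<lambda>k. p powi m * norm (cont_psi (\<xi> m)) / norm (qT (z m)) * (of_real (qcoeff p k) * (of_real p / norm (z m)) ^ k)) = (\<lambda>k. norm (G m k))"
        using p_pos \<kappa>_nonzero qcoeff_pos unfolding G_def th
        by (auto simp: norm_mult norm_divide norm_power norm_power_int abs_of_pos)
      finally show ?thesis by simp
    qed
    show "(\<lambda>m. p powi m * norm (cont_psi (\<xi> m)) / norm (qT (z m)) * qE p (p / norm (z m))) summable_on UNIV"
    proof (rule summable_on_comparison_test[OF \<beta>])
      show "p powi m * norm (cont_psi (\<xi> m)) / norm (qT (z m)) * qE p (p / norm (z m)) \<le> \<beta> m" for m
        using D'(5)[of m] by simp
      show "0 \<le> p powi m * norm (cont_psi (\<xi> m)) / norm (qT (z m)) * qE p (p / norm (z m))" for m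
        using p_pos order_trans[OF zero_le_one qE_ge_1[of "p / norm (z m)"]] by simp
    qed
  qed
  obtain S where S: "((\<lambda>(m, k). G m k) has_sum S) (UNIV \<times> UNIV)"
    using summ by (auto simp: summable_on_def)
  have e_sum: "((\<lambda>m. spiral_integrand_e q f x (\<xi> m) * of_real (p powi m)) has_sum S) UNIV"
    by (rule has_sum_SigmaD[OF S]) (use cols in auto)
  \<comment> \<open>With \<open>m = n + k\<close>, the sum over \<open>k\<close> for fixed
    \<open>n\<close> reassembles \<phi> at \<open>p^n * l\<close>, that is, a term of the theta
    sum.\<close>
  have S': "((\<lambda>(n, k). G (n + int k) k) has_sum S) (UNIV \<times> UNIV)"
    by (rule has_sum_reindex_bij_witness[where i = "\<lambda>(m, k). (m - int k, k)" and j = "\<lambda>(n, k). (n + int k, k)", THEN iffD2, OF _ _ _ _ _ _ S])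
       auto
  have "((\<lambda>k. G (n + int k) k) has_sum integrand_theta q f x (\<xi> n) * of_real (p powi n)) UNIV" for n
  proof -
    have "((\<lambda>k. of_real (p powi n) / theta p (z n) * (of_real (\<kappa> * (p ^ k / qpoch p k)) * cont_psi (of_real p ^ k * \<xi> n)))
        has_sum of_real (p powi n) / theta p (z n) * cont_phi (\<xi> n)) UNIV"
      by (intro has_sum_cmult_right cont_phi_eq_cont_psi_series \<xi>nonsingular)
    moreover have "G (n + int k) k = of_real (p powi n) / theta p (z n) * (of_real (\<kappa> * (p ^ k / qpoch p k)) * cont_psi (of_real p ^ k * \<xi> n))" for k
    proof -
      have pnk: "p powi (n + int k) = p ^ k * p powi n" using p_pos by (simp add: power_int_add)
      have \<xi>k: "\<xi> (n + int k) = of_real p ^ k * \<xi> n" by (simp only: \<xi>_n pnk of_real_mult of_real_power mult.assoc)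
      have zk: "z (n + int k) = of_real p ^ k * z n" by (simp add: z_def \<xi>k)
      define T where "T = theta p (z (n + int k))"
      have T0: "T \<noteq> 0" unfolding T_def by (rule D'(1))
      have shift: "theta p (z n) = z n ^ k * of_real (p ^ (k * (k - 1) div 2)) * T"
        using gtheta_shift_pow[OF z0, of n k] by (simp add: T_def zk theta_eq_gtheta)
      have "of_real p / z (n + int k) = of_real p / (of_real p ^ k * z n)" by (simp add: zk)
      \<comment> \<open>The denominator \<open>p^(k*k)\<close> contains \<open>p^k\<close> and two
        triangular powers: one cancels against \<open>qcoeff p k\<close>, the other is the one in
        \<open>shift\<close>.\<close>
      have tri2: "p ^ k * (p ^ (k * (k - 1) div 2) * p ^ (k * (k - 1) div 2)) = (p ^ k) ^ k"
      proof -
        have "2 * (k * (k - 1) div 2) = k * (k - 1)" by (rule dvd_mult_div_cancel) auto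
        moreover have "k + k * (k - 1) = k * k" by (cases k) auto
        ultimately have "k + (k * (k - 1) div 2 + k * (k - 1) div 2) = k * k" by linarith
        then show ?thesis by (metis power_add power_mult)
      qed
      have coeff: "of_real (qcoeff p k) * (of_real p / (of_real p ^ k * z n)) ^ k
         = of_real (1 / qpoch p k) / (z n ^ k * of_real (p ^ (k * (k - 1) div 2)))"
      proof -
        define t where "t = complex_of_real (p ^ (k * (k - 1) div 2))"
        have "(complex_of_real p / (of_real p ^ k * z n)) ^ k = of_real p ^ k / ((of_real p ^ k) ^ k * z n ^ k)"
          by (simp only: power_divide power_mult_distrib)
        also have "(complex_of_real p ^ k) ^ k = of_real p ^ k * (t * t)"
          using arg_cong[OF tri2, of complex_of_real] unfolding t_def of_real_mult of_real_power by (rule sym)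
        finally have "(complex_of_real p / (of_real p ^ k * z n)) ^ k = 1 / (t * t * z n ^ k)"
          using p_pos by simp
        moreover have "complex_of_real (qcoeff p k) = t * of_real (1 / qpoch p k)"
          by (simp add: qcoeff_def t_def)
        moreover have "t \<noteq> 0" using p_pos by (simp add: t_def)
        ultimately show ?thesis unfolding t_def[symmetric] by simp
      qed
      show ?thesis
        unfolding G_def \<xi>k pnk shift T_def[unfolded zk, symmetric] zk coeff
        by (simp add: mult_ac)
    qed
    ultimately show ?thesis by (simp add: integrand_theta_eq z_def mult_ac)
  qed
  then have "((\<lambda>n. integrand_theta q f x (\<xi> n) * of_real (p powi n)) has_sum S) UNIV"
    by (intro has_sum_SigmaD[OF S']) auto
  with e_sum show "jackson_integral p l (integrand_theta q f x) = jackson_integral p l (spiral_integrand_e q f x)"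
    unfolding jackson_integral_def \<xi>_def by (simp add: infsumI)
qed

end

section \<open>Integrals over a half line\<close>

context q_pair
begin

lemma scale_interval_unique:
  assumes "t \<in> {p powi n..<p powi n * q}" "t \<in> {p powi m..<p powi m * q}"
  shows "n = m"
proof -
  have le: "\<not> n < m" if "t \<in> {p powi n..<p powi n * q}" "t \<in> {p powi m..<p powi m * q}" for n m
  proof
    assume "n < m"
    then have "p powi m \<le> p powi (n + 1)" using p_pos p_less_1 by (intro power_int_decreasing) auto
    then have "p powi m * q \<le> p powi n"
      using p_pos by (simp add: power_int_add_1 q_eq divide_le_eq)
    then show False using that by auto
  qed
  show ?thesis using le[OF assms] le[OF assms(2,1)] by linarith
qed

lemma scale_interval_exists:
  assumes "t > 0"
  obtains n where "t \<in> {p powi n..<p powi n * q}"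
proof
  define k where "k = \<lfloor>log q t\<rfloor>"
  have pq: "p powi (- k) = q powi k" using p_pos by (simp add: q_eq power_int_minus power_int_divide_distrib divide_inverse power_int_inverse)
  have "q powi k \<le> t"
  proof -
    have "q powi k = q powr real_of_int k" using q_gt_1 by (simp add: powr_real_of_int')
    also have "\<dots> \<le> q powr (log q t)" using q_gt_1 by (intro powr_mono) (auto simp: k_def)
    finally show ?thesis using q_gt_1 assms by simp
  qed
  moreover have "t < q powi k * q"
  proof -
    have "t = q powr (log q t)" using q_gt_1 assms by simp
    also have "\<dots> < q powr (real_of_int k + 1)" using q_gt_1 unfolding k_def by (intro powr_less_mono) linarith+
    also have "\<dots> = q powi k * q" using q_gt_1 by (simp add: powr_add powr_real_of_int')
    finally show ?thesis .
  qed
  ultimately show "t \<in> {p powi (- k)..<p powi (- k) * q}" unfolding pq by simp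
qed

text \<open>The substitution of \<open>p^n * t\<close> for \<open>t\<close> carries each piece of
  the half line to \<open>[1, q)\<close>. The integrals of the norms of the pieces are at most
  \<open>(q - 1) * \<beta> n\<close>, hence summable, which justifies exchanging sum and integral on
  the half line and on the interval alike.\<close>

lemma integral_scale_decomposition:
  fixes H :: "real \<Rightarrow> complex"
  assumes cont: "continuous_on {0<..} H" and \<beta>: "\<beta> summable_on UNIV"
    and bd: "\<And>n t. t \<in> {1..q} \<Longrightarrow> norm (of_real (p powi n) * H (p powi n * t)) \<le> \<beta> n"
  shows "set_integrable lborel {0<..} H"
    and "((\<lambda>t. \<Sum>\<^sub>\<infinity>n. of_real (p powi n) * H (p powi n * t)) has_integral set_lebesgue_integral lborel {0<..} H) {1..q}"
proof -
  define S where "S = (\<lambda>t. \<Sum>\<^sub>\<infinity>n. of_real (p powi n) * H (p powi n * t))"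
  \<comment> \<open>An enumeration of the integers, because the exchange of series and integral is
    applied to sequences.\<close>
  define e where "e = int_decode"
  define f where "f = (\<lambda>i t. indicator {1..<q} t *\<^sub>R (of_real (p powi e i) * H (p powi e i * t)))"
  define g where "g = (\<lambda>i t. indicator {p powi e i..<p powi e i * q} t *\<^sub>R H t)"
  have pn: "p powi n > 0" for n using p_pos by simp
  have bij_e: "bij e" unfolding e_def by (rule bij_int_decode)
  have \<beta>0: "\<beta> n \<ge> 0" for n using order_trans[OF norm_ge_zero bd[of 1 n]] q_gt_1 by simp
  have \<beta>_sum: "summable (\<lambda>i. \<beta> (e i))"
    using \<beta> summable_on_reindex_bij_betw[OF bij_e, of \<beta>] \<beta>0 by (simp add: summable_on_UNIV_nonneg_real_iff)
  have f_int: "integrable lborel (f i)" for i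
  proof -
    have "continuous_on {1..q} (\<lambda>t. of_real (p powi e i) * H (p powi e i * t))"
      using pn[of "e i"] by (intro continuous_intros continuous_on_compose2[OF cont]) auto
    then have "set_integrable lborel {1..q} (\<lambda>t. of_real (p powi e i) * H (p powi e i * t))"
      by (rule borel_integrable_atLeastAtMost')
    then have "set_integrable lborel {1..<q} (\<lambda>t. of_real (p powi e i) * H (p powi e i * t))"
      by (rule set_integrable_subset) auto
    then show ?thesis by (simp add: set_integrable_def f_def)
  qed
  have fg: "f i t = (p powi e i) *\<^sub>R g i (0 + p powi e i * t)" for i t
    using pn[of "e i"] by (auto simp: f_def g_def indicator_def scaleR_conv_of_real)
  have g_int: "integrable lborel (g i)" for i
  proof -
    have "integrable lborel (\<lambda>t. (1 / (p powi e i)) *\<^sub>R f i t)" using f_int by simp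
    also have "(\<lambda>t. (1 / (p powi e i)) *\<^sub>R f i t) = (\<lambda>t. g i (0 + p powi e i * t))"
      using p_pos by (auto simp: fg fun_eq_iff)
    finally have "integrable lborel (\<lambda>t. g i (0 + p powi e i * t))" .
    then show ?thesis using pn[of "e i"] lborel_integrable_real_affine_iff[of "p powi e i" "g i" 0] by (metis less_irrefl)
  qed
  have int_eq: "integral\<^sup>L lborel (g i) = integral\<^sup>L lborel (f i)" for i
    using lborel_integral_real_affine[of "p powi e i" "g i" 0] p_pos by (simp add: fg[abs_def])
  have norm_eq: "(\<integral>t. norm (g i t) \<partial>lborel) = (\<integral>t. norm (f i t) \<partial>lborel)" for i
    using lborel_integral_real_affine[of "p powi e i" "\<lambda>t. norm (g i t)" 0] p_pos by (simp add: fg)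
  have f_norm: "norm (f i t) \<le> indicator {1..q} t *\<^sub>R \<beta> (e i)" for i t
    using bd[of t "e i"] \<beta>0[of "e i"] by (auto simp: f_def indicator_def)
  have f_norm_int: "(\<integral>t. norm (f i t) \<partial>lborel) \<le> (q - 1) * \<beta> (e i)" for i
  proof -
    have "integrable lborel (indicator {1..q} :: real \<Rightarrow> real)"
      using q_gt_1 by (intro integrable_real_indicator) auto
    then have "(\<integral>t. norm (f i t) \<partial>lborel) \<le> (\<integral>t. indicator {1..q} t *\<^sub>R \<beta> (e i) \<partial>lborel)"
      using f_norm f_int by (intro integral_mono) (auto intro: integrable_norm)
    also have "\<dots> = (q - 1) * \<beta> (e i)" using q_gt_1 by simp
    finally show ?thesis .
  qed
  have sum_norm: "summable (\<lambda>i. \<integral>t. norm (f i t) \<partial>lborel)"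
    by (rule summable_comparison_test'[OF summable_mult[OF \<beta>_sum, of "q - 1"], where N = 0])
       (use f_norm_int in \<open>simp add: integral_nonneg\<close>)
  have f_sum: "summable (\<lambda>i. norm (f i t))" for t
    by (rule summable_comparison_test'[OF summable_mult[OF \<beta>_sum, of "indicator {1..q} t"], where N = 0])
       (use f_norm in simp)
  have f_suminf: "(\<Sum>i. f i t) = indicator {1..<q} t *\<^sub>R S t" for t
  proof (cases "t \<in> {1..<q}")
    case True
    have "(\<lambda>n. of_real (p powi n) * H (p powi n * t)) summable_on UNIV"
      by (rule abs_summable_summable, rule summable_on_comparison_test[OF \<beta>]) (use bd[of t] True in auto)
    then have "((\<lambda>n. of_real (p powi n) * H (p powi n * t)) has_sum S t) UNIV"
      unfolding S_def by (rule has_sum_infsum)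
    then have "((\<lambda>i. of_real (p powi e i) * H (p powi e i * t)) has_sum S t) UNIV"
      using has_sum_reindex_bij_betw[OF bij_e, of "\<lambda>n. of_real (p powi n) * H (p powi n * t)"] by simp
    then have "(\<lambda>i. of_real (p powi e i) * H (p powi e i * t)) sums S t" by (rule has_sum_imp_sums)
    then show ?thesis using True by (simp add: f_def sums_iff)
  qed (simp add: f_def)
  have g_sums: "(\<lambda>i. g i t) sums (indicator {0<..} t *\<^sub>R H t)" and g_sum: "summable (\<lambda>i. norm (g i t))" for t
  proof -
    show "(\<lambda>i. g i t) sums (indicator {0<..} t *\<^sub>R H t)"
    proof (cases "t > 0")
      case True
      then obtain n where n: "t \<in> {p powi n..<p powi n * q}" by (rule scale_interval_exists)
      obtain i where i: "e i = n" using bij_e by (metis bij_pointE)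
      have "g j t = (if j = i then H t else 0)" for j
      proof (cases "j = i")
        case False
        then have "e j \<noteq> n" using bij_e i by (metis bij_pointE)
        then have "t \<notin> {p powi e j..<p powi e j * q}" using scale_interval_unique[OF n] by blast
        then show ?thesis using False by (simp add: g_def)
      qed (use n i in \<open>simp add: g_def\<close>)
      then show ?thesis using True sums_single[of i "\<lambda>_. H t"] by (simp add: eq_commute[of i])
    next
      case False
      have "g j t = 0" for j
        using False pn[of "e j"] by (auto simp: g_def indicator_def)
      then show ?thesis using False by simp
    qed
    show "summable (\<lambda>i. norm (g i t))"
    proof (rule summable_finite[of "{i. g i t \<noteq> 0}"])
      have inj: "i = j" if "g i t \<noteq> 0" "g j t \<noteq> 0" for i j
      proof -
        have "e i = e j"
          using that by (intro scale_interval_unique[of t]) (auto simp: g_def indicator_def split: if_splits)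
        then show ?thesis using bij_e by (metis bij_pointE)
      qed
      show "finite {i. g i t \<noteq> 0}"
      proof (cases "\<exists>i. g i t \<noteq> 0")
        case True
        then obtain i where "g i t \<noteq> 0" by blast
        then have "{i. g i t \<noteq> 0} \<subseteq> {i}" using inj by blast
        then show ?thesis by (rule finite_subset) simp
      qed simp
    qed auto
  qed
  have g_suminf: "(\<Sum>i. g i t) = indicator {0<..} t *\<^sub>R H t" for t
    using g_sums[of t] by (simp add: sums_iff)
  have sum_norm_g: "summable (\<lambda>i. \<integral>t. norm (g i t) \<partial>lborel)" using sum_norm by (simp add: norm_eq)
  show "set_integrable lborel {0<..} H"
    unfolding set_integrable_def g_suminf[symmetric]
    by (rule integrable_suminf[OF g_int AE_I2 sum_norm_g]) (rule g_sum)
  have S_int: "set_integrable lborel {1..<q} S"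
    unfolding set_integrable_def f_suminf[symmetric]
    by (rule integrable_suminf[OF f_int AE_I2 sum_norm]) (rule f_sum)
  have "set_lebesgue_integral lborel {0<..} H = (\<Sum>i. integral\<^sup>L lborel (g i))"
    unfolding set_lebesgue_integral_def g_suminf[symmetric]
    by (rule integral_suminf[OF g_int AE_I2 sum_norm_g]) (rule g_sum)
  also have "\<dots> = (\<Sum>i. integral\<^sup>L lborel (f i))" by (simp add: int_eq)
  also have "\<dots> = set_lebesgue_integral lborel {1..<q} S"
    unfolding set_lebesgue_integral_def f_suminf[symmetric]
    by (rule integral_suminf[OF f_int AE_I2 sum_norm, symmetric]) (rule f_sum)
  also have "\<dots> = integral {1..<q} S" by (rule set_borel_integral_eq_integral(2)[OF S_int])
  finally have half_open: "(S has_integral set_lebesgue_integral lborel {0<..} H) {1..<q}"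
    using set_borel_integral_eq_integral(1)[OF S_int] by (simp add: integrable_integral)
  \<comment> \<open>Half-open intervals were needed for a partition of the half line; the endpoint
    \<open>q\<close> is a null set.\<close>
  have "negligible {t \<in> {1..<q} - {1..q}. S t \<noteq> 0}" "negligible {t \<in> {1..q} - {1..<q}. S t \<noteq> 0}"
    by (rule negligible_subset[OF negligible_sing[of q]]; auto)+
  from has_integral_spike_set_eq[THEN iffD1, OF this half_open]
  have "(S has_integral set_lebesgue_integral lborel {0<..} H) {1..q}" .
  then show "((\<lambda>t. \<Sum>\<^sub>\<infinity>n. of_real (p powi n) * H (p powi n * t)) has_integral set_lebesgue_integral lborel {0<..} H) {1..q}"
    by (simp add: S_def)
qed

end

lemma ray_in_closed_segment:
  assumes "q > 1"
  shows "z \<in> closed_segment (cis d) (of_real q * cis d) \<longleftrightarrow> (\<exists>t\<in>{1..q}. z = of_real t * cis d)"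
proof
  assume "z \<in> closed_segment (cis d) (of_real q * cis d)"
  then obtain u where u: "0 \<le> u" "u \<le> 1" "z = (1 - u) *\<^sub>R cis d + u *\<^sub>R (of_real q * cis d)"
    by (auto simp: in_segment)
  have "z = of_real (1 + (q - 1) * u) * cis d" by (simp add: u(3) scaleR_conv_of_real algebra_simps)
  moreover have "1 + (q - 1) * u \<in> {1..q}"
    using assms u mult_left_mono[of u 1 "q - 1"] mult_right_mono[of 1 q u] by (auto simp: algebra_simps)
  ultimately show "\<exists>t\<in>{1..q}. z = of_real t * cis d" by blast
next
  assume "\<exists>t\<in>{1..q}. z = of_real t * cis d"
  then obtain t where t: "t \<in> {1..q}" "z = of_real t * cis d" by blast
  define u where "u = (t - 1) / (q - 1)"
  have u: "0 \<le> u" "u \<le> 1" "t = 1 + (q - 1) * u" using t assms by (auto simp: u_def)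
  have "z = (1 - u) *\<^sub>R cis d + u *\<^sub>R (of_real q * cis d)"
    unfolding t(2) u(3) by (simp add: scaleR_conv_of_real algebra_simps)
  then show "z \<in> closed_segment (cis d) (of_real q * cis d)" using u(1,2) by (auto simp: in_segment)
qed

context q_borel
begin

text \<open>Both half line integrals become integrals over \<open>[1, q]\<close> of sums over
  spirals, whose equality is known for every starting point in that range. The spiral sum with
  \<open>E\<close> has its argument divided by \<open>1 - p\<close>; the corresponding change of
  variable turns the prefactor \<open>(q - 1) / ln q\<close> into \<open>q / ln q\<close>.\<close>

lemma half_line_sums:
  assumes hl: "half_line d \<subseteq> nonsingular" and x: "x / cis d \<notin> \<real>\<^sub>\<le>\<^sub>0"
    and \<beta>: "\<beta> summable_on UNIV"
    and dom: "\<And>l. l \<in> closed_segment (cis d) (of_real q * cis d) \<Longrightarrow> dominated x l \<beta>"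
  shows "half_line_integrable d (integrand_theta q f x)"
    and "half_line_integrable d (integrand_e q f x)"
    and "direction_sum_theta q d f x = direction_sum_e q d f x"
    and "((\<lambda>m. spiral_sum_e q m f x / m) has_contour_integral of_real (ln q) * direction_sum_e q d f x)
           (linepath (cis d) (of_real q * cis d))"
proof -
  have x0: "x \<noteq> 0" using x by auto
  have ray: "of_real t * cis d \<in> nonsingular" if "t > 0" for t
    using hl that by (auto simp: half_line_def)
  have qT_ray: "qT (of_real q * (of_real t * cis d) / x) \<noteq> 0" if "t > 0" for t
  proof (rule qT_nonzero)
    show "of_real q * (of_real t * cis d) / x \<noteq> 0" using that q_gt_1 x0 by simp
    fix n
    show "of_real q * (of_real t * cis d) / x \<noteq> - of_real (p powi n)"
    proof
      assume "of_real q * (of_real t * cis d) / x = - of_real (p powi n)"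
      then have "of_real q * of_real t * cis d = - of_real (p powi n) * x" using x0 by (simp add: divide_eq_eq mult.assoc)
      then have "x / cis d = of_real (- (q * t / p powi n))"
        using p_pos by (simp add: field_simps)
      moreover have "- (q * t / p powi n) \<le> 0" using q_gt_1 that p_pos by simp
      ultimately show False using x by (metis nonpos_Reals_of_real_iff)
    qed
  qed
  have dom': "dominated x (of_real t * cis d) \<beta>" if "t \<in> {1..q}" for t
    using that by (intro dom) (auto simp: ray_in_closed_segment[OF q_gt_1])
  define Ht where "Ht = (\<lambda>t. integrand_theta q f x (of_real t * cis d) * cis d)"
  define He where "He = (\<lambda>t. spiral_integrand_e q f x (of_real t * cis d) * cis d)"
  define F where "F = (\<lambda>\<Phi> (t::real). \<Sum>\<^sub>\<infinity>n. of_real (p powi n) * (\<Phi> (of_real (p powi n * t) * cis d) * cis d) :: complex)"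
  have cont_t: "continuous_on {0<..} Ht"
  proof -
    have "continuous_on {0<..} (\<lambda>t. cont_phi (of_real t * cis d) / (of_real \<kappa> * (qE p (of_real q * (of_real t * cis d) / x) * qE p (of_real p / (of_real q * (of_real t * cis d) / x)))) * cis d)"
      using ray qT_ray x0 q_gt_1 \<kappa>_nonzero
      by (intro continuous_intros continuous_on_compose2[OF holomorphic_on_imp_continuous_on[OF cont_phi_holomorphic]])
         (auto simp: qT_def)
    then show ?thesis
    proof (rule continuous_on_eq)
      fix t :: real assume "t \<in> {0<..}"
      then have "of_real q * (of_real t * cis d) / x \<noteq> 0" using x0 q_gt_1 by simp
      from theta_eq_qT[OF this]
      show "cont_phi (of_real t * cis d) / (of_real \<kappa> * (qE p (of_real q * (of_real t * cis d) / x) * qE p (of_real p / (of_real q * (of_real t * cis d) / x)))) * cis d = Ht t"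
        unfolding Ht_def integrand_theta_eq qT_def by simp
    qed
  qed
  have cont_e: "continuous_on {0<..} He"
  proof -
    have cont_cont_psi: "continuous_on nonsingular cont_psi"
      by (rule holomorphic_on_imp_continuous_on[OF holomorphic_on_subset[OF cont_psi_holomorphic]]) (auto simp: ext_dom_def)
    have "continuous_on {0<..} (\<lambda>t. cont_psi (of_real t * cis d) / qE p (of_real q * (of_real t * cis d) / x) * cis d)"
      using ray qT_ray x0
      by (intro continuous_intros continuous_on_compose2[OF cont_cont_psi]) (auto simp: qT_def)
    then show ?thesis
      by (rule continuous_on_eq) (simp add: He_def spiral_integrand_e_eq[OF ray])
  qed
  have arg: "of_real (p powi n * t) * cis d = of_real (p powi n) * (of_real t * cis d)" for n t
    by simp
  have bd_t: "norm (of_real (p powi n) * Ht (p powi n * t)) \<le> \<beta> n / \<bar>\<kappa>\<bar>" if "t \<in> {1..q}" for n t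
  proof -
    have "of_real t * cis d \<in> nonsingular" using that by (intro ray) auto
    from dominatedD(3)[OF dom'[OF that] this x0, of n]
    show ?thesis unfolding Ht_def arg by (simp add: norm_mult mult.commute)
  qed
  have bd_e: "norm (of_real (p powi n) * He (p powi n * t)) \<le> \<beta> n" if "t \<in> {1..q}" for n t
  proof -
    have "of_real t * cis d \<in> nonsingular" using that by (intro ray) auto
    from dominatedD(4)[OF dom'[OF that] this x0, of n]
    show ?thesis unfolding He_def arg by (simp add: norm_mult mult.commute)
  qed
  have \<beta>': "(\<lambda>n. \<beta> n / \<bar>\<kappa>\<bar>) summable_on UNIV"
    using summable_on_cmult_left[OF \<beta>, of "1 / \<bar>\<kappa>\<bar>"] by simp
  note dec_t = integral_scale_decomposition[OF cont_t \<beta>' bd_t]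
  note dec_e = integral_scale_decomposition[OF cont_e \<beta> bd_e]
  let ?It = "set_lebesgue_integral lborel {0<..} Ht" and ?Ie = "set_lebesgue_integral lborel {0<..} He"
  \<comment> \<open>Dividing the Jackson integral by its starting point removes the starting point
    from its prefactor. This is the reason for the measure \<open>d\<lambda> / \<lambda>\<close> in
    the averaging formula.\<close>
  have series: "of_real q * (\<Sum>\<^sub>\<infinity>n. of_real (p powi n) * (G (of_real (p powi n * t) * cis d) * cis d))
      = of_real (q / (1 - p)) * jackson_integral p (of_real t * cis d) G / (of_real t * cis d) * cis d"
    if "t \<in> {1..q}" for t G
  proof -
    have "of_real (p powi n) * (G (of_real (p powi n * t) * cis d) * cis d)
       = cis d * (G (of_real (p powi n) * (of_real t * cis d)) * of_real (p powi n))" for n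
      unfolding arg by (simp only: mult_ac)
    then have "(\<Sum>\<^sub>\<infinity>n. of_real (p powi n) * (G (of_real (p powi n * t) * cis d) * cis d))
       = cis d * (\<Sum>\<^sub>\<infinity>n. G (of_real (p powi n) * (of_real t * cis d)) * of_real (p powi n))"
      by (simp only: infsum_cmult_right')
    then show ?thesis
      unfolding jackson_integral_def using that p_less_1
      by (simp del: of_real_power_int of_real_diff add: field_simps)
  qed
  have "?It = ?Ie"
  proof (rule has_integral_unique[OF dec_t(2)])
    have "(\<Sum>\<^sub>\<infinity>n. of_real (p powi n) * He (p powi n * t)) = (\<Sum>\<^sub>\<infinity>n. of_real (p powi n) * Ht (p powi n * t))"
      if t: "t \<in> {1..q}" for t
    proof -
      have "of_real t * cis d \<in> nonsingular" using t by (intro ray) auto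
      note eq = spiral_sums(3)[OF \<beta> dom'[OF t] this x0]
      have "of_real q * (\<Sum>\<^sub>\<infinity>n. of_real (p powi n) * He (p powi n * t)) = of_real q * (\<Sum>\<^sub>\<infinity>n. of_real (p powi n) * Ht (p powi n * t))"
        unfolding He_def Ht_def series[OF t] eq ..
      then show ?thesis using q_gt_1 by simp
    qed
    then show "((\<lambda>t. \<Sum>\<^sub>\<infinity>n. of_real (p powi n) * Ht (p powi n * t)) has_integral ?Ie) {1..q}"
      using has_integral_eq[OF _ dec_e(2)] by simp
  qed
  show "half_line_integrable d (integrand_theta q f x)"
    using dec_t(1) by (simp add: half_line_integrable_def Ht_def)
  \<comment> \<open>The rescaling built into the Jackson integrand is undone here, at the cost of a
    factor \<open>1 - p\<close> in the integral.\<close>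
  have resc: "integrand_e q f x (of_real t * cis d) * cis d = He ((1 - p) * t)" for t
  proof -
    have "complex_of_real ((1 - p) * t) * cis d / of_real (1 - 1 / q) = of_real t * cis d"
      using p_less_1 unfolding p_eq[symmetric] by (simp del: of_real_diff)
    then show ?thesis by (simp only: He_def spiral_integrand_e_def)
  qed
  have resc': "indicator {0<..} t *\<^sub>R (integrand_e q f x (of_real t * cis d) * cis d)
      = (\<lambda>t. indicator {0<..} t *\<^sub>R He t) (0 + (1 - p) * t)" for t
    unfolding resc using p_less_1 by (auto simp: indicator_def zero_less_mult_iff)
  show "half_line_integrable d (integrand_e q f x)"
    unfolding half_line_integrable_def set_integrable_def resc'
    using dec_e(1) p_less_1 by (intro lborel_integrable_real_affine) (auto simp: set_integrable_def)
  have "?Ie = (1 - p) *\<^sub>R half_line_integral d (integrand_e q f x)"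
    unfolding half_line_integral_def set_lebesgue_integral_def resc'
    using lborel_integral_real_affine[of "1 - p" "\<lambda>t. indicator {0<..} t *\<^sub>R He t" 0] p_less_1 by simp
  then have De: "direction_sum_e q d f x = of_real (q / ln q) * ?Ie"
    using p_less_1 q_gt_1 by (simp add: direction_sum_e_def scaleR_conv_of_real p_eq field_simps)
  show "direction_sum_theta q d f x = direction_sum_e q d f x"
    unfolding De \<open>?It = ?Ie\<close>[symmetric] by (simp add: direction_sum_theta_def half_line_integral_def Ht_def)
  show "((\<lambda>m. spiral_sum_e q m f x / m) has_contour_integral of_real (ln q) * direction_sum_e q d f x)
           (linepath (cis d) (of_real q * cis d))"
    unfolding has_contour_integral_linepath
  proof -
    let ?S = "\<lambda>t. \<Sum>\<^sub>\<infinity>n. of_real (p powi n) * He (p powi n * t)"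
    \<comment> \<open>The path is parametrised by \<open>[0, 1]\<close>, with
      \<open>t = 1 + (q - 1) * s\<close>; the factor \<open>q - 1\<close> comes back as the
      derivative of the path.\<close>
    have "((\<lambda>s. ?S ((q - 1) *\<^sub>R s + 1)) has_integral ?Ie /\<^sub>R (q - 1) ^ DIM(real)) (cbox ((1 - 1) /\<^sub>R (q - 1)) ((q - 1) /\<^sub>R (q - 1)))"
      using dec_e(2) q_gt_1 by (intro has_integral_affinity') auto
    then have "((\<lambda>s. ?S (1 + (q - 1) * s)) has_integral ?Ie /\<^sub>R (q - 1)) {0..1}"
      using q_gt_1 by (simp add: add.commute)
    then have "((\<lambda>s. of_real (q - 1) * of_real q * ?S (1 + (q - 1) * s)) has_integral of_real (q - 1) * of_real q * (?Ie /\<^sub>R (q - 1))) {0..1}"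
      by (rule has_integral_mult_right)
    also have "of_real (q - 1) * of_real q * (?Ie /\<^sub>R (q - 1)) = of_real (ln q) * direction_sum_e q d f x"
      unfolding De using q_gt_1 by (simp add: scaleR_conv_of_real del: of_real_diff)
    finally have "((\<lambda>s. of_real (q - 1) * of_real q * ?S (1 + (q - 1) * s)) has_integral of_real (ln q) * direction_sum_e q d f x) {0..1}" .
    then show "((\<lambda>s. spiral_sum_e q (linepath (cis d) (of_real q * cis d) s) f x / linepath (cis d) (of_real q * cis d) s *
          (of_real q * cis d - cis d)) has_integral of_real (ln q) * direction_sum_e q d f x) {0..1}"
    proof (rule has_integral_eq[rotated])
      fix s :: real assume s: "s \<in> {0..1}"
      define t where "t = 1 + (q - 1) * s"
      have t: "t \<in> {1..q}"
        using s q_gt_1 mult_left_mono[of s 1 "q - 1"] mult_right_mono[of 1 q s] by (auto simp: t_def algebra_simps)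
      have lp: "linepath (cis d) (of_real q * cis d) s = of_real t * cis d"
        by (simp add: linepath_def t_def scaleR_conv_of_real algebra_simps)
      have diff: "of_real q * cis d - cis d = of_real (q - 1) * cis d" by (simp add: algebra_simps)
      have eq: "of_real q * ?S t = spiral_sum_e q (of_real t * cis d) f x / (of_real t * cis d) * cis d"
        unfolding He_def series[OF t] by (simp add: spiral_sum_e_def p_eq)
      show "of_real (q - 1) * of_real q * ?S (1 + (q - 1) * s) =
         spiral_sum_e q (linepath (cis d) (of_real q * cis d) s) f x / linepath (cis d) (of_real q * cis d) s * (of_real q * cis d - cis d)"
        unfolding lp t_def[symmetric] diff mult.assoc[of "of_real (q - 1)"] eq by (simp only: mult_ac)
    qed
  qed
qed

end

theorem theorem4:
  fixes q d :: real and f :: "complex fps" and l :: complex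
  assumes "q > 1"
    and "fps_nth f 0 = 0"
    and "generic_q_gevrey q f"
    and "l \<noteq> 0"
    and "- pi \<le> d" "d < pi"
    and "\<not> singular_direction q f l"
    and "\<And>m. m \<noteq> 0 \<Longrightarrow> singular_direction q f m \<Longrightarrow> half_line d \<inter> q_spiral q m = {}"
  shows "(\<exists>\<rho>>0. \<forall>x\<in>spiral_domain q l \<rho>.
            jackson_integrable (1 / q) l (integrand_theta q f x) \<and>
            jackson_integrable (1 / q) l (spiral_integrand_e q f x) \<and>
            spiral_sum_theta q l f x = spiral_sum_e q l f x) \<and>
         (\<exists>\<rho>>0. \<forall>x\<in>slit_sector d \<rho>.
            half_line_integrable d (integrand_theta q f x) \<and>
            half_line_integrable d (integrand_e q f x) \<and>
            direction_sum_theta q d f x = direction_sum_e q d f x \<and>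
            (\<forall>m\<in>closed_segment (cis d) (of_real q * cis d).
               jackson_integrable (1 / q) m (spiral_integrand_e q f x)) \<and>
            (\<lambda>m. spiral_sum_e q m f x / m)
               contour_integrable_on linepath (cis d) (of_real q * cis d) \<and>
            direction_sum_e q d f x =
              1 / of_real (ln q) *
              contour_integral (linepath (cis d) (of_real q * cis d))
                (\<lambda>m. spiral_sum_e q m f x / m))"
proof -
  interpret q_pair "1 / q" q
    using assms(1) by unfold_locales auto
  have spiral_self: "m \<in> q_spiral q m" for m
    by (auto simp: q_spiral_def intro!: range_eqI[of _ _ 0])
  \<comment> \<open>The nonsingular spiral through \<open>l\<close> yields the convergence of the
    transform at 0, from which the global continuation starts.\<close>
  have "borel_theta q f \<in> H_spiral q l"
    using assms(7) by (simp add: singular_direction_def)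
  then have "fps_conv_radius (borel_theta q f) > 0"
    by (simp add: H_spiral_def)
  then obtain Z \<Phi> \<epsilon> where data: "countable Z" "closed Z" "\<And>\<xi>. \<xi> \<notin> Z \<Longrightarrow> of_real (1 / q) * \<xi> \<notin> Z"
    "\<Phi> holomorphic_on - Z" "\<epsilon> > 0" "ereal \<epsilon> < fps_conv_radius (borel_theta q f)" "ball 0 \<epsilon> \<inter> Z = {}"
    "\<And>\<xi>. norm \<xi> < \<epsilon> \<Longrightarrow> \<Phi> \<xi> = eval_fps (borel_theta q f) \<xi>"
    using borel_theta_continuation[OF assms(3,2)] by blast
  interpret q_borel "1 / q" q f Z \<Phi> \<epsilon>
    by unfold_locales (fact data)+
  have nonsingular_iff: "\<xi> \<in> nonsingular \<longleftrightarrow> \<xi> \<noteq> 0 \<and> \<not> singular_direction q f \<xi>" for \<xi>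
    by (simp add: nonsingular_def singular_direction_def)
  have "l \<in> nonsingular" using assms(4,7) by (simp add: nonsingular_iff)
  have hl: "half_line d \<subseteq> nonsingular"
  proof
    fix m assume m: "m \<in> half_line d"
    then have "m \<noteq> 0" by (auto simp: half_line_def)
    moreover have "\<not> singular_direction q f m"
      using assms(8)[OF \<open>m \<noteq> 0\<close>] m spiral_self[of m] by blast
    ultimately show "m \<in> nonsingular" by (simp add: nonsingular_iff)
  qed
  \<comment> \<open>This compact segment meets every spiral of the half line, so one radius works
    for the whole direction.\<close>
  define K where "K = closed_segment (cis d) (of_real q * cis d)"
  have K_ray: "\<exists>t>0. m = of_real t * cis d" if mK: "m \<in> K" for m
  proof -
    obtain t where "t \<in> {1..q}" "m = of_real t * cis d"
      using mK unfolding K_def ray_in_closed_segment[OF assms(1)] by blast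
    then show ?thesis by (intro exI[of _ t]) auto
  qed
  then have "K \<subseteq> half_line d" unfolding half_line_def by blast
  then have KN: "K \<subseteq> nonsingular" using hl by blast
  have single: "compact {l}" "{l} \<subseteq> nonsingular" using \<open>l \<in> nonsingular\<close> by auto
  obtain \<rho>1 where \<rho>1: "\<rho>1 > 0"
    "\<forall>x. 0 < norm x \<and> norm x < \<rho>1 \<and> (\<forall>m\<in>{l}. x \<notin> q_spiral q (- m)) \<longrightarrow>
       (\<exists>\<beta>. \<beta> summable_on UNIV \<and> (\<forall>m\<in>{l}. dominated x m \<beta>))"
    using uniform_domination[OF single] by blast
  have "compact K" by (simp add: K_def)
  obtain \<rho>2 where \<rho>2: "\<rho>2 > 0"
    "\<forall>x. 0 < norm x \<and> norm x < \<rho>2 \<and> (\<forall>m\<in>K. x \<notin> q_spiral q (- m)) \<longrightarrow>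
       (\<exists>\<beta>. \<beta> summable_on UNIV \<and> (\<forall>m\<in>K. dominated x m \<beta>))"
    using uniform_domination[OF \<open>compact K\<close> KN] by blast
  show ?thesis
  proof (rule conjI; intro exI conjI ballI)
    show "\<rho>1 > 0" "\<rho>2 > 0" by fact+
  next
    fix x assume x: "x \<in> spiral_domain q l \<rho>1"
    then obtain \<beta> where "\<beta> summable_on UNIV" "dominated x l \<beta>"
      using \<rho>1(2) by (auto simp: spiral_domain_def)
    moreover have "x \<noteq> 0" using x by (auto simp: spiral_domain_def)
    ultimately have s: "jackson_integrable (1 / q) l (integrand_theta q f x)"
      "jackson_integrable (1 / q) l (spiral_integrand_e q f x)"
      "jackson_integral (1 / q) l (integrand_theta q f x) = jackson_integral (1 / q) l (spiral_integrand_e q f x)"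
      using spiral_sums \<open>l \<in> nonsingular\<close> by blast+
    show "jackson_integrable (1 / q) l (integrand_theta q f x)"
      "jackson_integrable (1 / q) l (spiral_integrand_e q f x)" by fact+
    show "spiral_sum_theta q l f x = spiral_sum_e q l f x"
      unfolding spiral_sum_theta_def spiral_sum_e_def s(3) ..
  next
    fix x assume x: "x \<in> slit_sector d \<rho>2"
    have slit: "x / cis d \<notin> \<real>\<^sub>\<le>\<^sub>0" using x by (simp add: slit_sector_def)
    then have "x \<noteq> 0" by auto
    \<comment> \<open>The spirals of all \<open>- m\<close> lie on the half line opposite to
      \<open>d\<close>, which the slit removes.\<close>
    have "x \<notin> q_spiral q (- m)" if m: "m \<in> K" for m
    proof
      assume "x \<in> q_spiral q (- m)"
      then obtain n where n: "x = - m * of_real (q powi n)" by (auto simp: q_spiral_def)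
      obtain t where t: "t > 0" "m = of_real t * cis d" using K_ray[OF m] by blast
      have "x / cis d = of_real (- (t * q powi n))"
        unfolding n t(2) by simp
      moreover have "- (t * q powi n) \<le> 0" using t(1) assms(1) by simp
      ultimately show False using slit by (metis nonpos_Reals_of_real_iff)
    qed
    moreover have "norm x < \<rho>2" using x by (simp add: slit_sector_def)
    ultimately obtain \<beta> where \<beta>: "\<beta> summable_on UNIV" "\<And>m. m \<in> K \<Longrightarrow> dominated x m \<beta>"
      using \<rho>2(2) \<open>x \<noteq> 0\<close> by auto
    note sums = half_line_sums[OF hl slit \<beta>[unfolded K_def]]
    show "half_line_integrable d (integrand_theta q f x)" by (rule sums(1))
    show "half_line_integrable d (integrand_e q f x)" by (rule sums(2))
    show "direction_sum_theta q d f x = direction_sum_e q d f x" by (rule sums(3))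
    show "(\<lambda>m. spiral_sum_e q m f x / m) contour_integrable_on linepath (cis d) (of_real q * cis d)"
      using sums(4) by (auto simp: contour_integrable_on_def)
    show "direction_sum_e q d f x = 1 / of_real (ln q) *
        contour_integral (linepath (cis d) (of_real q * cis d)) (\<lambda>m. spiral_sum_e q m f x / m)"
      using contour_integral_unique[OF sums(4)] assms(1) by simp
    fix m assume "m \<in> closed_segment (cis d) (of_real q * cis d)"
    then have "m \<in> K" by (simp add: K_def)
    then show "jackson_integrable (1 / q) m (spiral_integrand_e q f x)"
      using spiral_sums(2)[OF \<beta>(1) \<beta>(2)] KN \<open>x \<noteq> 0\<close> by blast
  qed
qed

end
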